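(* Let $\mathcal{D}$ be a distribution on $\mathbb{S}^{n-1}\times[0,1]$ such that $\mathbb{E}[y\mid\mathbf{x}]=u\left(\sum_{i=1}^t\mathbf{a}_ih_i(\mathbf{x})\right)$, where $u:\mathbb{R}\to[0,1]$ is a known $L$-Lipschitz non-decreasing function, $h_1,\dots,h_t$ are origin-centered halfspaces with margin $\rho$ on $\mathcal{X}$, and $\mathbf{a}\in\mathbb{R}^t$ has $\|\mathbf{a}\|_1=A$. Given samples $(\mathbf{x}_i,y_i)_{i=1}^m$ drawn i.i.d. from $\mathcal{D}$, there exists an algorithm that outputs a hypothesis $h$ such that with probability $1-\delta$, \[\mathbb{E}_{(\mathbf{x},y)\sim\mathcal{D}}\left[\left(h(\mathbf{x})-u\left(\sum_{i=1}^t\mathbf{a}_ih_i(\mathbf{x})\right)\right)^2\right]\le\epsilon\] for $m=\left(\frac{LA}{\epsilon}\right)^{O(1/\rho)}\log(1/\delta)$. The algorithm runs in time polynomial in $m$ and $n$.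
   Context: $\mathcal{X}\subseteq\mathbb{S}^{n-1}$ denotes the support of the marginal of $\mathcal{D}$ on instances. An origin-centered halfspace with margin $\rho$ on $\mathcal{X}$ is a function $h(\mathbf{x})=\mathrm{sign}(\mathbf{w}\cdot\mathbf{x})$ (taking values in $\{0,1\}$, i.e. $1$ iff $\mathbf{w}\cdot\mathbf{x}\ge0$) with $\|\mathbf{w}\|=1$ and $|\mathbf{w}\cdot\mathbf{x}|\ge\rho$ for all $\mathbf{x}\in\mathcal{X}$. The weight vectors $\mathbf{w}_i$ and coefficients $\mathbf{a}$ are unknown.
   Formalization: The constant in O(1/ρ) is uniform for δ ≤ δ₀ and may depend on δ₀ < 1; with one constant for all δ in (0,1) the claim fails, since as δ → 1 the formula gives a single sample. Time is counted on an exact real-arithmetic machine with unit-cost evaluation of u. *)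

theory Defs
  imports "HOL-Probability.Probability"
begin

section \<open>A real RAM with an oracle\<close>

text \<open>
  The dimension and the number of examples are inputs of the algorithm, so the running time has to
  refer to one program that is uniform in both. The model is the usual unit-cost real RAM, written
  as a while language. A state consists of index registers, which hold natural numbers, and of a
  memory of real cells. Real instructions address the memory through index registers:
  \<open>RArith f i j k\<close> sets cell \<open>r i\<close> to the result of \<open>f\<close> on the cells \<open>r j\<close> and \<open>r k\<close>.
  The known function \<open>u\<close> is available as an oracle, one evaluation per unit of time.
  As in the algebraic models of Blum, Shub and Smale there is no rounding instruction. Indices are
  only added and subtracted, so the bit length of an index grows at most linearly in the number of steps.
  The constants of a program are rational.
  Truncated subtraction and division by zero follow the HOL conventions.
\<close>

datatype arith = Plus | Minus | Times | Divide

fun arith_op :: "arith \<Rightarrow> real \<Rightarrow> real \<Rightarrow> real" where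
  "arith_op Plus a b = a + b"
| "arith_op Minus a b = a - b"
| "arith_op Times a b = a * b"
| "arith_op Divide a b = a / b"

datatype test = ILess nat nat | RLess nat nat | Neg test

datatype com =
    Skip
  | IConst nat nat
  | IAdd nat nat nat
  | ISub nat nat nat
  | RConst nat rat
  | RCopy nat nat
  | RArith arith nat nat nat
  | Oracle nat nat
  | Seq com com
  | Cond test com com
  | Loop test com

type_synonym state = "(nat \<Rightarrow> nat) \<times> (nat \<Rightarrow> real)"

fun holds :: "test \<Rightarrow> state \<Rightarrow> bool" where
  "holds (ILess i j) (r, M) = (r i < r j)"
| "holds (RLess i j) (r, M) = (M (r i) < M (r j))"
| "holds (Neg b) s = (\<not> holds b s)"

text \<open>\<open>exec u c s k s'\<close>: with oracle \<open>u\<close>, program \<open>c\<close> started in \<open>s\<close> halts after \<open>k\<close> steps in \<open>s'\<close>.\<close>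

inductive exec :: "(real \<Rightarrow> real) \<Rightarrow> com \<Rightarrow> state \<Rightarrow> nat \<Rightarrow> state \<Rightarrow> bool" for u where
  Skip: "exec u Skip s 1 s"
| IConst: "exec u (IConst i c) (r, M) 1 (r(i := c), M)"
| IAdd: "exec u (IAdd i j k) (r, M) 1 (r(i := r j + r k), M)"
| ISub: "exec u (ISub i j k) (r, M) 1 (r(i := r j - r k), M)"
| RConst: "exec u (RConst i c) (r, M) 1 (r, M(r i := of_rat c))"
| RCopy: "exec u (RCopy i j) (r, M) 1 (r, M(r i := M (r j)))"
| RArith: "exec u (RArith f i j k) (r, M) 1 (r, M(r i := arith_op f (M (r j)) (M (r k))))"
| Oracle: "exec u (Oracle i j) (r, M) 1 (r, M(r i := u (M (r j))))"
| Seq: "exec u c1 s1 k1 s2 \<Longrightarrow> exec u c2 s2 k2 s3 \<Longrightarrow> exec u (Seq c1 c2) s1 (k1 + k2) s3"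
| CondTrue: "holds b s \<Longrightarrow> exec u c1 s k s' \<Longrightarrow> exec u (Cond b c1 c2) s (Suc k) s'"
| CondFalse: "\<not> holds b s \<Longrightarrow> exec u c2 s k s' \<Longrightarrow> exec u (Cond b c1 c2) s (Suc k) s'"
| LoopFalse: "\<not> holds b s \<Longrightarrow> exec u (Loop b c) s 1 s"
| LoopTrue: "holds b s1 \<Longrightarrow> exec u c s1 k1 s2 \<Longrightarrow> exec u (Loop b c) s2 k2 s3
    \<Longrightarrow> exec u (Loop b c) s1 (Suc (k1 + k2)) s3"

inductive_cases exec_elims:
  "exec u Skip s k s'" "exec u (IConst i c) s k s'" "exec u (IAdd i j l) s k s'"
  "exec u (ISub i j l) s k s'" "exec u (RConst i q) s k s'" "exec u (RCopy i j) s k s'"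
  "exec u (RArith f i j l) s k s'" "exec u (Oracle i j) s k s'" "exec u (Seq c1 c2) s k s'"
  "exec u (Cond b c1 c2) s k s'"

inductive_cases exec_LoopE: "exec u (Loop b c) s k s'"

lemma exec_deterministic:
  "exec u c s k s' \<Longrightarrow> exec u c s l s'' \<Longrightarrow> l = k \<and> s'' = s'"
proof (induction arbitrary: l s'' rule: exec.induct)
  case (Seq c1 s1 k1 s2 c2 k2 s3)
  from Seq.prems show ?case by (rule exec_elims(9)) (use Seq.IH in blast)
next
  case (CondTrue b s c1 k s' c2)
  from CondTrue.prems show ?case by (rule exec_elims(10)) (use CondTrue in blast)+
next
  case (CondFalse b s c2 k s' c1)
  from CondFalse.prems show ?case by (rule exec_elims(10)) (use CondFalse in blast)+
next
  case (LoopFalse b s c)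
  from LoopFalse.prems show ?case by (rule exec_LoopE) (use LoopFalse in auto)
next
  case (LoopTrue b s1 c k1 s2 k2 s3)
  from LoopTrue.prems show ?case by (rule exec_LoopE) (use LoopTrue in blast)+
qed (auto elim: exec_elims)

definition halts_within :: "(real \<Rightarrow> real) \<Rightarrow> com \<Rightarrow> state \<Rightarrow> nat \<Rightarrow> state \<Rightarrow> bool" where
  "halts_within u c s T s' \<longleftrightarrow> (\<exists>k\<le>T. exec u c s k s')"

definition memory :: "real list \<Rightarrow> nat \<Rightarrow> real" where
  "memory xs k = (if k < length xs then xs ! k else 0)"


section \<open>Learners and their hypotheses\<close>

text \<open>
  A point of \<open>n\<close>-dimensional space is a function in \<^term>\<open>PiE {..<n} (\<lambda>_. UNIV :: real set)\<close>.
  An algorithm is a pair of programs. The learner maps numerical parameters and a sample to a finite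
  list of reals that represents the hypothesis. The predictor maps a representation and a point to
  the value of the hypothesis at that point.
\<close>

type_synonym point = "nat \<Rightarrow> real"
type_synonym sample = "nat \<Rightarrow> point \<times> real"

definition learner_input :: "real list \<Rightarrow> nat \<Rightarrow> nat \<Rightarrow> sample \<Rightarrow> state" where
  "learner_input ps n m S =
    ((\<lambda>_. 0)(0 := n, 1 := m),
     memory (ps @ concat (map (\<lambda>j. map (fst (S j)) [0..<n] @ [snd (S j)]) [0..<m])))"

definition learner_output :: "state \<Rightarrow> real list" where
  "learner_output s = map (snd s) [0..<fst s 0]"

definition predictor_input :: "real list \<Rightarrow> nat \<Rightarrow> point \<Rightarrow> state" where
  "predictor_input c n x = ((\<lambda>_. 0)(0 := n, 1 := length c), memory (map x [0..<n] @ c))"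

definition predictor_output :: "state \<Rightarrow> real" where
  "predictor_output s = snd s 0"

definition unit_sphere :: "nat \<Rightarrow> point set" where
  "unit_sphere n = {x \<in> PiE {..<n} (\<lambda>_. UNIV). (\<Sum>j<n. (x j)\<^sup>2) = 1}"

text \<open>
  On parameters \<open>ps\<close> and sample \<open>S\<close> the algorithm outputs the hypothesis \<open>h\<close>. Both the learning
  phase and each evaluation of \<open>h\<close> are limited to \<open>T\<close> steps; without a limit on the latter a learner
  could return the sample itself and leave all the work to the predictor.
\<close>

definition outputs_hypothesis ::
  "(real \<Rightarrow> real) \<Rightarrow> com \<Rightarrow> com \<Rightarrow> nat \<Rightarrow> nat \<Rightarrow> real list \<Rightarrow> nat \<Rightarrow> sample \<Rightarrow> (point \<Rightarrow> real) \<Rightarrow> bool"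
where
  "outputs_hypothesis u learner predictor T n ps m S h \<longleftrightarrow>
    (\<exists>s. halts_within u learner (learner_input ps n m S) T s \<and>
      (\<forall>x\<in>unit_sphere n. \<exists>s'.
        halts_within u predictor (predictor_input (learner_output s) n x) T s' \<and>
        h x = predictor_output s'))"


section \<open>Distributions and halfspaces\<close>

definition sphere_space :: "nat \<Rightarrow> point measure" where
  "sphere_space n = restrict_space (PiM {..<n} (\<lambda>_. borel)) (unit_sphere n)"

definition labelled_space :: "nat \<Rightarrow> (point \<times> real) measure" where
  "labelled_space n = sphere_space n \<Otimes>\<^sub>M restrict_space borel {0..1}"

definition instance_marginal :: "nat \<Rightarrow> (point \<times> real) measure \<Rightarrow> point measure" where
  "instance_marginal n D = distr D (sphere_space n) fst"

text \<open>Topological support: the points all of whose Euclidean neighbourhoods have positive mass.\<close>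

definition sphere_support :: "nat \<Rightarrow> point measure \<Rightarrow> point set" where
  "sphere_support n \<mu> =
    {x \<in> unit_sphere n. \<forall>r>0. measure \<mu> {z \<in> unit_sphere n. sqrt (\<Sum>j<n. (z j - x j)\<^sup>2) < r} > 0}"

definition cond_exp_label :: "nat \<Rightarrow> (point \<times> real) measure \<Rightarrow> point \<times> real \<Rightarrow> real" where
  "cond_exp_label n D = real_cond_exp D (vimage_algebra (space D) fst (sphere_space n)) snd"

definition margin_halfspace :: "nat \<Rightarrow> real \<Rightarrow> point set \<Rightarrow> (point \<Rightarrow> real) \<Rightarrow> bool" where
  "margin_halfspace n \<rho> X h \<longleftrightarrow>
    (\<exists>w\<in>unit_sphere n.
      h = (\<lambda>x. if (\<Sum>j<n. w j * x j) \<ge> 0 then 1 else 0) \<and>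
      (\<forall>x\<in>X. \<bar>\<Sum>j<n. w j * x j\<bar> \<ge> \<rho>))"

end

theory Submission
  imports Defs
begin

text \<open>
  One pass of stochastic gradient descent in the reproducing kernel Hilbert space of the kernel
  \<open>1 / (2 - x \<bullet> z)\<close>, with the gradient of the link function dropped: \<open>g\<close> is replaced by
  \<open>g + lam (y - u (g x)) ker x\<close>, and the output is the mean of all \<open>u \<circ> g\<close>. Every function
  \<open>\<Sum>k. b\<^sub>k (w \<bullet> x)\<^sup>k\<close> has norm at most \<open>2 \<Sum>k. \<bar>b\<^sub>k\<bar> 2\<^sup>k\<close> in this space, and that bound is
  submultiplicative. The sine integral \<open>Si (\<tau> s)\<close> with \<open>\<tau>\<close> of order \<open>1/\<rho>\<close> has norm \<open>exp (O (1/\<rho>))\<close> and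
  separates \<open>s \<le> -\<rho>\<close> from \<open>s \<ge> \<rho>\<close>. A majority polynomial of degree \<open>O (ln K)\<close>, where \<open>K = LA/\<epsilon>\<close>, sharpens
  it to a step up to error \<open>O (1/K)\<close> and raises the norm only to \<open>K\<close> to the power \<open>O (1/\<rho>)\<close>. Since \<open>u\<close> is
  monotone and Lipschitz, the squared distance of \<open>g\<close> to this comparator decreases in expectation
  in proportion to the squared error of \<open>u \<circ> g\<close>. An exponential supermartingale turns this into a
  bound with high probability.
\<close>

section \<open>The kernel and its norm bounds\<close>

text \<open>Margin and accuracy are handled by separate devices because \<open>Si\<close> approaches
  its limit only like 1/x. Error 1/K from \<open>Si\<close> alone would need \<open>\<tau>\<close>
  of order K/\<rho> and norm exp (O (K/\<rho>)), whereas a constant gap costs \<open>\<tau>\<close>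
  = O (1/\<rho>), and amplification multiplies the exponent by O (ln K). \<open>Si\<close> is entire
  of exponential type; a Gaussian error integral in its place would have norm exp (O (1/\<rho>^2)).
  The size of the comparator affects the sample size only. The step size is of order \<epsilon> / (L
  ln (1/\<delta>)), so that the deviation term lam ln (1/\<delta>) costs O (\<epsilon>/L), and the
  squared norm of the comparator is divided by lam m. This makes m linear in ln (1/\<delta>). A time
  bound in m and n alone must also cover the computation of the step size, whose cost grows with ln
  (1/\<delta>). That computation is therefore confined to the case in which m is known to be at
  least ln (1/\<delta>).\<close>

definition ip :: "nat \<Rightarrow> point \<Rightarrow> point \<Rightarrow> real" where
  "ip n x z = (\<Sum>j<n. x j * z j)"

definition ker :: "nat \<Rightarrow> point \<Rightarrow> point \<Rightarrow> real" where
  "ker n x z = 1 / (2 - ip n x z)"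

lemma ip_commute: "ip n x z = ip n z x"
  by (simp add: ip_def mult.commute)

lemma ker_commute: "ker n x z = ker n z x"
  by (simp add: ker_def ip_commute)

lemma ip_self: "x \<in> unit_sphere n \<Longrightarrow> ip n x x = 1"
  by (simp add: ip_def unit_sphere_def power2_eq_square)

lemma ker_self: "x \<in> unit_sphere n \<Longrightarrow> ker n x x = 1"
  by (simp add: ker_def ip_self)

lemma abs_ip_le_1:
  assumes "x \<in> unit_sphere n" "z \<in> unit_sphere n"
  shows "\<bar>ip n x z\<bar> \<le> 1"
proof -
  have "(ip n x z)\<^sup>2 \<le> (\<Sum>j<n. (x j)\<^sup>2) * (\<Sum>j<n. (z j)\<^sup>2)"
    unfolding ip_def by (rule Cauchy_Schwarz_ineq_sum)
  also have "\<dots> = 1" using assms by (simp add: unit_sphere_def)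
  finally show ?thesis by (simp add: abs_square_le_1)
qed

text \<open>A geometric series in ip/2. It makes the kernel a positive combination of the power
  kernels ip^k, to which all statements about \<open>ker\<close> are reduced term by term.\<close>

lemma ker_sums:
  assumes "x \<in> unit_sphere n" "z \<in> unit_sphere n"
  shows "(\<lambda>k. (ip n x z) ^ k / 2 ^ Suc k) sums ker n x z"
proof -
  have "norm (ip n x z / 2) < 1" using abs_ip_le_1[OF assms] by simp
  from sums_mult[OF geometric_sums[OF this], of "1/2"]
  show ?thesis using abs_ip_le_1[OF assms]
    by (simp add: ker_def power_divide divide_simps mult_ac split: if_splits)
qed

definition gram :: "nat \<Rightarrow> (nat \<Rightarrow> real) \<Rightarrow> (nat \<Rightarrow> nat \<Rightarrow> real) \<Rightarrow> real" where
  "gram J c G = (\<Sum>i<J. \<Sum>j<J. c i * c j * G i j)"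

text \<open>The Schur product theorem in coordinates: splitting off one factor ip writes the form
  for the next power as a sum over coordinates l of forms with coefficients
  \<open>c i * X i l\<close>. Hence the induction generalizes over \<open>c\<close>.\<close>

lemma gram_power_nonneg: "0 \<le> gram J c (\<lambda>i j. (ip n (X i) (X j)) ^ k)"
proof (induction k arbitrary: c)
  case 0
  have "gram J c (\<lambda>i j. (ip n (X i) (X j)) ^ 0) = (\<Sum>i<J. c i) * (\<Sum>j<J. c j)"
    by (simp add: gram_def sum_product)
  then show ?case by simp
next
  case (Suc k)
  have "gram J c (\<lambda>i j. (ip n (X i) (X j)) ^ Suc k)
      = (\<Sum>i<J. \<Sum>j<J. \<Sum>l<n. (c i * X i l) * (c j * X j l) * ip n (X i) (X j) ^ k)"
    unfolding gram_def
  proof (intro sum.cong refl)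
    fix i j
    have "c i * c j * ip n (X i) (X j) ^ Suc k = (\<Sum>l<n. X i l * X j l) * (c i * c j * ip n (X i) (X j) ^ k)"
      by (simp add: ip_def)
    also have "\<dots> = (\<Sum>l<n. c i * X i l * (c j * X j l) * ip n (X i) (X j) ^ k)"
      unfolding sum_distrib_right by (intro sum.cong) auto
    finally show "c i * c j * ip n (X i) (X j) ^ Suc k
      = (\<Sum>l<n. c i * X i l * (c j * X j l) * ip n (X i) (X j) ^ k)" .
  qed
  also have "\<dots> = (\<Sum>i<J. \<Sum>l<n. \<Sum>j<J. (c i * X i l) * (c j * X j l) * ip n (X i) (X j) ^ k)"
    by (rule sum.cong[OF refl], rule sum.swap)
  also have "\<dots> = (\<Sum>l<n. gram J (\<lambda>i. c i * X i l) (\<lambda>i j. (ip n (X i) (X j)) ^ k))"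
    unfolding gram_def by (rule sum.swap)
  also have "\<dots> \<ge> 0" by (intro sum_nonneg Suc)
  finally show ?case .
qed

text \<open>Bordering by one point. It serves the discriminant arguments, where the last coefficient
  is free, and the one-step expansion of the potential.\<close>

lemma gram_Suc:
  assumes "\<And>i. G i J = G J i"
  shows "gram (Suc J) c G = gram J c G + 2 * c J * (\<Sum>i<J. c i * G i J) + (c J)\<^sup>2 * G J J"
proof -
  have "gram (Suc J) c G
      = gram J c G + (\<Sum>i<J. c i * c J * G i J) + (\<Sum>j<J. c J * c j * G J j) + c J * c J * G J J"
    by (simp add: gram_def sum.distrib)
  also have "(\<Sum>j<J. c J * c j * G J j) = (\<Sum>i<J. c i * c J * G i J)"
    by (intro sum.cong refl) (simp add: assms[symmetric] mult_ac)
  also have "(\<Sum>i<J. c i * c J * G i J) = c J * (\<Sum>i<J. c i * G i J)"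
    by (simp add: sum_distrib_left mult_ac)
  finally show ?thesis by (simp add: power2_eq_square)
qed

lemma gram_cong:
  "(\<And>i. i < J \<Longrightarrow> c i = d i) \<Longrightarrow> (\<And>i j. i < J \<Longrightarrow> j < J \<Longrightarrow> G i j = H i j) \<Longrightarrow> gram J c G = gram J d H"
  unfolding gram_def by (intro sum.cong) auto

text \<open>Discriminant trick: adjoin \<open>w\<close> to the family with a free coefficient \<open>t\<close>.\<close>

lemma sum_power_ip_le_gram:
  assumes "w \<in> unit_sphere n"
  shows "(\<Sum>i<J. c i * (ip n w (X i)) ^ k)\<^sup>2 \<le> gram J c (\<lambda>i j. (ip n (X i) (X j)) ^ k)"
proof -
  define s where "s = (\<Sum>i<J. c i * (ip n w (X i)) ^ k)"
  \<comment> \<open>Since ip n w w = 1, the form is gram + 2 t s + t^2 in the new coefficient t,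
    minimal at t = -s.\<close>
  define c' where "c' = c(J := - s)"
  define Y where "Y = X(J := w)"
  have "0 \<le> gram (Suc J) c' (\<lambda>i j. (ip n (Y i) (Y j)) ^ k)" by (rule gram_power_nonneg)
  also have "\<dots> = gram J c' (\<lambda>i j. (ip n (Y i) (Y j)) ^ k)
      + 2 * c' J * (\<Sum>i<J. c' i * (ip n (Y i) (Y J)) ^ k) + (c' J)\<^sup>2 * (ip n (Y J) (Y J)) ^ k"
    by (rule gram_Suc) (simp add: ip_commute)
  also have "gram J c' (\<lambda>i j. (ip n (Y i) (Y j)) ^ k) = gram J c (\<lambda>i j. (ip n (X i) (X j)) ^ k)"
    by (rule gram_cong) (auto simp: c'_def Y_def)
  also have "(\<Sum>i<J. c' i * (ip n (Y i) (Y J)) ^ k) = s"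
    unfolding s_def by (intro sum.cong) (auto simp: c'_def Y_def ip_commute)
  finally show ?thesis
    using assms by (simp add: c'_def Y_def ip_self s_def[symmetric] power2_eq_square)
qed

lemma gram_ker_sums:
  assumes "\<And>i. i < J \<Longrightarrow> X i \<in> unit_sphere n"
  shows "(\<lambda>k. gram J c (\<lambda>i j. (ip n (X i) (X j)) ^ k) / 2 ^ Suc k) sums gram J c (\<lambda>i j. ker n (X i) (X j))"
proof -
  have "(\<lambda>k. \<Sum>i<J. \<Sum>j<J. c i * c j * ((ip n (X i) (X j)) ^ k / 2 ^ Suc k))
      sums gram J c (\<lambda>i j. ker n (X i) (X j))"
    unfolding gram_def by (intro sums_sum sums_mult ker_sums assms) auto
  also have "(\<lambda>k. \<Sum>i<J. \<Sum>j<J. c i * c j * ((ip n (X i) (X j)) ^ k / 2 ^ Suc k))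
      = (\<lambda>k. gram J c (\<lambda>i j. (ip n (X i) (X j)) ^ k) / 2 ^ Suc k)"
    by (simp add: gram_def sum_divide_distrib)
  finally show ?thesis .
qed

lemma gram_ker_nonneg:
  assumes "\<And>i. i < J \<Longrightarrow> X i \<in> unit_sphere n"
  shows "0 \<le> gram J c (\<lambda>i j. ker n (X i) (X j))"
proof -
  have "0 \<le> (\<Sum>k. gram J c (\<lambda>i j. (ip n (X i) (X j)) ^ k) / 2 ^ Suc k)"
    by (rule suminf_nonneg) (use gram_ker_sums[where J=J and c=c, OF assms] gram_power_nonneg in \<open>auto simp: sums_iff\<close>)
  then show ?thesis using gram_ker_sums[where J=J and c=c, OF assms] by (simp add: sums_iff)
qed

text \<open>A single term of a series of nonnegative terms is at most the sum; the factor undoes the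
  weight of that term.\<close>

lemma gram_power_le_gram_ker:
  assumes "\<And>i. i < J \<Longrightarrow> X i \<in> unit_sphere n"
  shows "gram J c (\<lambda>i j. (ip n (X i) (X j)) ^ k) \<le> 2 ^ Suc k * gram J c (\<lambda>i j. ker n (X i) (X j))"
proof -
  have "(\<Sum>k\<in>{k}. gram J c (\<lambda>i j. (ip n (X i) (X j)) ^ k) / 2 ^ Suc k)
      \<le> (\<Sum>k. gram J c (\<lambda>i j. (ip n (X i) (X j)) ^ k) / 2 ^ Suc k)"
    by (rule sum_le_suminf) (use gram_ker_sums[where J=J and c=c, OF assms] gram_power_nonneg in \<open>auto simp: sums_iff\<close>)
  then show ?thesis using gram_ker_sums[where J=J and c=c, OF assms]
    by (simp add: sums_iff divide_simps mult_ac)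
qed

text \<open>
  The bound \<open>\<parallel>f\<parallel> \<le> B\<close> in the reproducing kernel Hilbert space of \<open>ker\<close>, tested against finite
  combinations of kernel functions so that the Hilbert space need not be constructed.
\<close>

definition rkhs_bound :: "nat \<Rightarrow> (point \<Rightarrow> real) \<Rightarrow> real \<Rightarrow> bool" where
  "rkhs_bound n f B \<longleftrightarrow> 0 \<le> B \<and> (\<forall>J c X. (\<forall>i<J. X i \<in> unit_sphere n) \<longrightarrow>
     \<bar>\<Sum>i<J. c i * f (X i)\<bar> \<le> B * sqrt (gram J c (\<lambda>i j. ker n (X i) (X j))))"

lemma rkhs_bound_zero: "rkhs_bound n (\<lambda>_. 0) 0"
  by (simp add: rkhs_bound_def)

lemma rkhs_bound_add:
  assumes "rkhs_bound n f B" "rkhs_bound n g C"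
  shows "rkhs_bound n (\<lambda>x. f x + g x) (B + C)"
  unfolding rkhs_bound_def
proof (intro conjI allI impI)
  show "0 \<le> B + C" using assms by (simp add: rkhs_bound_def)
next
  fix J :: nat and c :: "nat \<Rightarrow> real" and X :: "nat \<Rightarrow> point"
  assume X: "\<forall>i<J. X i \<in> unit_sphere n"
  let ?q = "sqrt (gram J c (\<lambda>i j. ker n (X i) (X j)))"
  have "\<bar>\<Sum>i<J. c i * (f (X i) + g (X i))\<bar> \<le> \<bar>\<Sum>i<J. c i * f (X i)\<bar> + \<bar>\<Sum>i<J. c i * g (X i)\<bar>"
    by (simp add: distrib_left sum.distrib abs_triangle_ineq)
  also have "\<dots> \<le> B * ?q + C * ?q"
    by (rule add_mono) (use assms X in \<open>auto simp: rkhs_bound_def\<close>)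
  finally show "\<bar>\<Sum>i<J. c i * (f (X i) + g (X i))\<bar> \<le> (B + C) * ?q" by (simp add: algebra_simps)
qed

lemma rkhs_bound_scale:
  assumes "rkhs_bound n f B"
  shows "rkhs_bound n (\<lambda>x. a * f x) (\<bar>a\<bar> * B)"
  unfolding rkhs_bound_def
proof (intro conjI allI impI)
  show "0 \<le> \<bar>a\<bar> * B" using assms by (simp add: rkhs_bound_def)
next
  fix J :: nat and c :: "nat \<Rightarrow> real" and X :: "nat \<Rightarrow> point"
  assume X: "\<forall>i<J. X i \<in> unit_sphere n"
  have "\<bar>\<Sum>i<J. c i * (a * f (X i))\<bar> = \<bar>a\<bar> * \<bar>\<Sum>i<J. c i * f (X i)\<bar>"
    by (simp add: abs_mult[symmetric] sum_distrib_left mult_ac)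
  also have "\<dots> \<le> \<bar>a\<bar> * (B * sqrt (gram J c (\<lambda>i j. ker n (X i) (X j))))"
    by (rule mult_left_mono) (use assms X in \<open>auto simp: rkhs_bound_def\<close>)
  finally show "\<bar>\<Sum>i<J. c i * (a * f (X i))\<bar> \<le> \<bar>a\<bar> * B * sqrt (gram J c (\<lambda>i j. ker n (X i) (X j)))"
    by simp
qed

lemma rkhs_bound_sum:
  fixes T :: nat
  assumes "\<And>i. i < T \<Longrightarrow> rkhs_bound n (f i) (B i)"
  shows "rkhs_bound n (\<lambda>x. \<Sum>i<T. f i x) (\<Sum>i<T. B i)"
  using assms by (induction T) (auto intro: rkhs_bound_zero rkhs_bound_add)

lemma rkhs_bound_mono:
  assumes "rkhs_bound n f B" "B \<le> C"
  shows "rkhs_bound n f C"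
  unfolding rkhs_bound_def
proof (intro conjI allI impI)
  show "0 \<le> C" using assms by (simp add: rkhs_bound_def)
next
  fix J :: nat and c :: "nat \<Rightarrow> real" and X :: "nat \<Rightarrow> point"
  assume X: "\<forall>i<J. X i \<in> unit_sphere n"
  have "\<bar>\<Sum>i<J. c i * f (X i)\<bar> \<le> B * sqrt (gram J c (\<lambda>i j. ker n (X i) (X j)))"
    using assms X by (auto simp: rkhs_bound_def)
  also have "\<dots> \<le> C * sqrt (gram J c (\<lambda>i j. ker n (X i) (X j)))"
    using assms X by (intro mult_right_mono) (auto intro!: gram_ker_nonneg)
  finally show "\<bar>\<Sum>i<J. c i * f (X i)\<bar> \<le> C * sqrt (gram J c (\<lambda>i j. ker n (X i) (X j)))" .
qed

lemma rkhs_bound_power: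
  assumes "w \<in> unit_sphere n"
  shows "rkhs_bound n (\<lambda>x. (ip n w x) ^ k) (2 * 2 ^ k)"
  unfolding rkhs_bound_def
proof (intro conjI allI impI)
  fix J :: nat and c :: "nat \<Rightarrow> real" and X :: "nat \<Rightarrow> point"
  assume X: "\<forall>i<J. X i \<in> unit_sphere n"
  let ?q = "gram J c (\<lambda>i j. ker n (X i) (X j))"
  have q: "0 \<le> ?q" using X by (intro gram_ker_nonneg) auto
  have "(\<Sum>i<J. c i * (ip n w (X i)) ^ k)\<^sup>2 \<le> 2 ^ Suc k * ?q"
    by (rule order_trans[OF sum_power_ip_le_gram[OF assms] gram_power_le_gram_ker]) (use X in auto)
  \<comment> \<open>The norm bound obtained so far is sqrt (2 ^ Suc k). Squaring the factor avoids
    the root and only affects constants in the exponent.\<close>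
  also have "\<dots> \<le> (2 ^ Suc k)\<^sup>2 * ?q"
    by (rule mult_right_mono[OF _ q]) (rule self_le_power, auto simp del: power_Suc)
  also have "\<dots> = (2 * 2 ^ k * sqrt ?q)\<^sup>2" using q by (simp add: power_mult_distrib)
  finally show "\<bar>\<Sum>i<J. c i * (ip n w (X i)) ^ k\<bar> \<le> 2 * 2 ^ k * sqrt ?q"
    using q by (simp add: abs_le_square_iff[symmetric])
qed auto

text \<open>Each instance of the bound involves finitely many points, so pointwise convergence
  suffices and no completeness is involved.\<close>

lemma rkhs_bound_limit:
  assumes lim: "\<And>x. x \<in> unit_sphere n \<Longrightarrow> (\<lambda>N. f N x) \<longlonglongrightarrow> g x"
    and bd: "\<And>N. rkhs_bound n (f N) B"
  shows "rkhs_bound n g B"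
  unfolding rkhs_bound_def
proof (intro conjI allI impI)
  show "0 \<le> B" using bd[of 0] by (simp add: rkhs_bound_def)
next
  fix J :: nat and c :: "nat \<Rightarrow> real" and X :: "nat \<Rightarrow> point"
  assume X: "\<forall>i<J. X i \<in> unit_sphere n"
  have "(\<lambda>N. \<bar>\<Sum>i<J. c i * f N (X i)\<bar>) \<longlonglongrightarrow> \<bar>\<Sum>i<J. c i * g (X i)\<bar>"
    by (intro tendsto_intros lim) (use X in auto)
  then show "\<bar>\<Sum>i<J. c i * g (X i)\<bar> \<le> B * sqrt (gram J c (\<lambda>i j. ker n (X i) (X j)))"
    by (rule LIMSEQ_le_const2) (use bd X in \<open>auto simp: rkhs_bound_def\<close>)
qed

section \<open>Power series with weighted absolutely summable coefficients\<close>

definition wiener_bound :: "(real \<Rightarrow> real) \<Rightarrow> real \<Rightarrow> bool" where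
  "wiener_bound f M \<longleftrightarrow> (\<exists>b. summable (\<lambda>k. \<bar>b k\<bar> * 2 ^ k) \<and> (\<Sum>k. \<bar>b k\<bar> * 2 ^ k) \<le> M \<and>
     (\<forall>s. \<bar>s\<bar> \<le> 1 \<longrightarrow> (\<lambda>k. b k * s ^ k) sums f s))"

text \<open>Partial sums are bounded term by term with \<open>rkhs_bound_power\<close>, whose growth
  2 ^ k is the weight in \<open>wiener_bound\<close>; \<open>rkhs_bound_limit\<close> passes to the
  full series.\<close>

lemma rkhs_bound_wiener:
  assumes "wiener_bound f M" "w \<in> unit_sphere n"
  shows "rkhs_bound n (\<lambda>x. f (ip n w x)) (2 * M)"
proof -
  obtain b where b: "summable (\<lambda>k. \<bar>b k\<bar> * 2 ^ k)" "(\<Sum>k. \<bar>b k\<bar> * 2 ^ k) \<le> M"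
    "\<And>s. \<bar>s\<bar> \<le> 1 \<Longrightarrow> (\<lambda>k. b k * s ^ k) sums f s"
    using assms unfolding wiener_bound_def by blast
  show ?thesis
  proof (rule rkhs_bound_limit)
    fix x assume "x \<in> unit_sphere n"
    then show "(\<lambda>N. \<Sum>k<N. b k * (ip n w x) ^ k) \<longlonglongrightarrow> f (ip n w x)"
      using b(3)[of "ip n w x"] abs_ip_le_1 assms by (simp add: sums_def)
  next
    fix N
    have "rkhs_bound n (\<lambda>x. \<Sum>k<N. b k * (ip n w x) ^ k) (\<Sum>k<N. \<bar>b k\<bar> * (2 * 2 ^ k))"
      by (intro rkhs_bound_sum rkhs_bound_scale rkhs_bound_power assms)
    moreover have "(\<Sum>k<N. \<bar>b k\<bar> * (2 * 2 ^ k)) \<le> 2 * M"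
    proof -
      have "(\<Sum>k<N. \<bar>b k\<bar> * (2 * 2 ^ k)) = 2 * (\<Sum>k<N. \<bar>b k\<bar> * 2 ^ k)"
        by (simp add: sum_distrib_left mult_ac)
      also have "\<dots> \<le> 2 * (\<Sum>k. \<bar>b k\<bar> * 2 ^ k)"
        by (intro mult_left_mono sum_le_suminf b) auto
      finally show ?thesis using b(2) by simp
    qed
    ultimately show "rkhs_bound n (\<lambda>x. \<Sum>k<N. b k * (ip n w x) ^ k) (2 * M)"
      by (rule rkhs_bound_mono)
  qed
qed

lemma wiener_bound_const: "wiener_bound (\<lambda>_. a) \<bar>a\<bar>"
proof -
  let ?b = "\<lambda>k::nat. if k = 0 then a else 0"
  have "(\<lambda>k. \<bar>?b k\<bar> * 2 ^ k) = (\<lambda>k. if k = 0 then \<bar>a\<bar> else 0)" by auto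
  moreover have "(\<lambda>k. ?b k * s ^ k) = (\<lambda>k. if k = 0 then a else 0)" for s by auto
  ultimately show ?thesis unfolding wiener_bound_def
    by (intro exI[of _ ?b]) (use sums_single[of 0 "\<lambda>_. \<bar>a\<bar>"] sums_single[of 0 "\<lambda>_. a"] in \<open>auto simp: sums_iff\<close>)
qed

lemma wiener_bound_add:
  assumes "wiener_bound f M" "wiener_bound g N"
  shows "wiener_bound (\<lambda>s. f s + g s) (M + N)"
proof -
  obtain b where b: "summable (\<lambda>k. \<bar>b k\<bar> * 2 ^ k)" "(\<Sum>k. \<bar>b k\<bar> * 2 ^ k) \<le> M"
    "\<And>s. \<bar>s\<bar> \<le> 1 \<Longrightarrow> (\<lambda>k. b k * s ^ k) sums f s"
    using assms unfolding wiener_bound_def by blast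
  obtain d where d: "summable (\<lambda>k. \<bar>d k\<bar> * 2 ^ k)" "(\<Sum>k. \<bar>d k\<bar> * 2 ^ k) \<le> N"
    "\<And>s. \<bar>s\<bar> \<le> 1 \<Longrightarrow> (\<lambda>k. d k * s ^ k) sums g s"
    using assms unfolding wiener_bound_def by blast
  have le: "\<bar>b k + d k\<bar> * 2 ^ k \<le> \<bar>b k\<bar> * 2 ^ k + \<bar>d k\<bar> * 2 ^ k" for k
    by (simp add: abs_triangle_ineq flip: distrib_right)
  have s: "summable (\<lambda>k. \<bar>b k\<bar> * 2 ^ k + \<bar>d k\<bar> * 2 ^ k)" by (intro summable_add b d)
  have s': "summable (\<lambda>k. \<bar>b k + d k\<bar> * 2 ^ k)"
    by (rule summable_comparison_test[OF _ s]) (use le in auto)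
  have "(\<Sum>k. \<bar>b k + d k\<bar> * 2 ^ k) \<le> (\<Sum>k. \<bar>b k\<bar> * 2 ^ k + \<bar>d k\<bar> * 2 ^ k)"
    by (intro suminf_le le s s')
  also have "\<dots> \<le> M + N" using b d by (simp add: suminf_add[symmetric])
  finally show ?thesis unfolding wiener_bound_def
    using s' sums_add[OF b(3) d(3)] by (intro exI[of _ "\<lambda>k. b k + d k"]) (auto simp: distrib_right)
qed

text \<open>The Cauchy product: the weight 2 ^ k is multiplicative along a convolution. This is the
  reason to measure univariate functions by their coefficients, since polynomials in an approximant
  can then be bounded.\<close>

lemma wiener_bound_mult:
  assumes "wiener_bound f M" "wiener_bound g N"
  shows "wiener_bound (\<lambda>s. f s * g s) (M * N)"
proof -
  obtain b where b: "summable (\<lambda>k. \<bar>b k\<bar> * 2 ^ k)" "(\<Sum>k. \<bar>b k\<bar> * 2 ^ k) \<le> M"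
    "\<And>s. \<bar>s\<bar> \<le> 1 \<Longrightarrow> (\<lambda>k. b k * s ^ k) sums f s"
    using assms unfolding wiener_bound_def by blast
  obtain d where d: "summable (\<lambda>k. \<bar>d k\<bar> * 2 ^ k)" "(\<Sum>k. \<bar>d k\<bar> * 2 ^ k) \<le> N"
    "\<And>s. \<bar>s\<bar> \<le> 1 \<Longrightarrow> (\<lambda>k. d k * s ^ k) sums g s"
    using assms unfolding wiener_bound_def by blast
  define e where "e k = (\<Sum>i\<le>k. b i * d (k - i))" for k
  \<comment> \<open>Used twice: for the absolute values at z = 2, which gives the norm, and for the
    coefficients at z = s, which gives the value.\<close>
  have conv: "(\<Sum>i\<le>k. (x i * z ^ i) * (y (k - i) * z ^ (k - i))) = (\<Sum>i\<le>k. x i * y (k - i)) * z ^ k"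
    for x y :: "nat \<Rightarrow> real" and z k
    unfolding sum_distrib_right
    by (intro sum.cong refl) (simp add: power_add[symmetric])
  have abs: "summable (\<lambda>k. norm (\<bar>x k\<bar> * 2 ^ k))" if "summable (\<lambda>k. \<bar>x k\<bar> * 2 ^ k)" for x :: "nat \<Rightarrow> real"
    using that by simp
  have P: "(\<lambda>k. (\<Sum>i\<le>k. \<bar>b i\<bar> * \<bar>d (k - i)\<bar>) * 2 ^ k) sums ((\<Sum>k. \<bar>b k\<bar> * 2 ^ k) * (\<Sum>k. \<bar>d k\<bar> * 2 ^ k))"
    using Cauchy_product_sums[OF abs[OF b(1)] abs[OF d(1)]] unfolding conv[where x="\<lambda>k. \<bar>b k\<bar>" and z=2 and y="\<lambda>k. \<bar>d k\<bar>"] .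
  have le: "\<bar>e k\<bar> * 2 ^ k \<le> (\<Sum>i\<le>k. \<bar>b i\<bar> * \<bar>d (k - i)\<bar>) * 2 ^ k" for k
    unfolding e_def by (intro mult_right_mono order_trans[OF sum_abs]) (auto simp: abs_mult)
  have s: "summable (\<lambda>k. \<bar>e k\<bar> * 2 ^ k)"
    by (rule summable_comparison_test[OF _ sums_summable[OF P]]) (use le in auto)
  have "(\<Sum>k. \<bar>e k\<bar> * 2 ^ k) \<le> (\<Sum>k. \<bar>b k\<bar> * 2 ^ k) * (\<Sum>k. \<bar>d k\<bar> * 2 ^ k)"
    using suminf_le[OF le s sums_summable[OF P]] P by (simp add: sums_iff)
  also have "\<dots> \<le> M * N"
    by (intro mult_mono b d suminf_nonneg order_trans[OF _ b(2)]) auto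
  finally have le': "(\<Sum>k. \<bar>e k\<bar> * 2 ^ k) \<le> M * N" .
  have ser: "(\<lambda>k. e k * s ^ k) sums (f s * g s)" if "\<bar>s\<bar> \<le> 1" for s
  proof -
    have n: "summable (\<lambda>k. norm (x k * s ^ k))" if x: "summable (\<lambda>k. \<bar>x k\<bar> * 2 ^ k)" for x :: "nat \<Rightarrow> real"
    proof (rule summable_comparison_test[OF _ x], intro exI allI impI)
      fix k :: nat
      have "\<bar>s\<bar> ^ k \<le> 2 ^ k" using \<open>\<bar>s\<bar> \<le> 1\<close> by (intro power_mono) auto
      then show "norm (norm (x k * s ^ k)) \<le> \<bar>x k\<bar> * 2 ^ k"
        by (simp add: abs_mult power_abs mult_left_mono)
    qed
    show ?thesis
      using Cauchy_product_sums[OF n[OF b(1)] n[OF d(1)]] b(3)[OF that] d(3)[OF that]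
      unfolding conv[where x=b and z=s and y=d] e_def by (simp add: sums_iff)
  qed
  show ?thesis unfolding wiener_bound_def using s le' ser by blast
qed

lemma wiener_bound_mono: "wiener_bound f M \<Longrightarrow> M \<le> N \<Longrightarrow> wiener_bound f N"
  unfolding wiener_bound_def by (meson order_trans)

lemma wiener_bound_power:
  assumes "wiener_bound f M"
  shows "wiener_bound (\<lambda>s. f s ^ k) (M ^ k)"
proof (induction k)
  case 0
  then show ?case using wiener_bound_const[of 1] by simp
next
  case (Suc k)
  then show ?case using wiener_bound_mult[OF assms] by simp
qed

lemma wiener_bound_sum:
  assumes "finite I" "\<And>i. i \<in> I \<Longrightarrow> wiener_bound (f i) (M i)"
  shows "wiener_bound (\<lambda>s. \<Sum>i\<in>I. f i s) (\<Sum>i\<in>I. M i)"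
  using assms
proof (induction I rule: finite_induct)
  case empty
  then show ?case using wiener_bound_const[of 0] by simp
qed (auto intro: wiener_bound_add)

section \<open>Approximating the step function outside the margin\<close>

lemma Si_sums: "(\<lambda>k. sin_coeff k / real k * x ^ k) sums Si x"
proof -
  \<comment> \<open>At k = 0 this is 0 / 0, hence 0, which is the correct constant term.\<close>
  define c where "c k = sin_coeff k / real k" for k
  have dom: "\<bar>c k * y ^ k\<bar> \<le> inverse (fact k) * \<bar>y\<bar> ^ k" for k y
  proof -
    have "\<bar>c k\<bar> \<le> inverse (fact k)"
    proof (cases "k = 0")
      case False
      then have "real k * fact k \<ge> fact k" by (simp add: mult_le_cancel_right1)
      then show ?thesis using False
        by (simp add: c_def sin_coeff_def abs_mult power_abs divide_simps)
    qed (simp add: c_def)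
    then show ?thesis by (simp add: abs_mult power_abs mult_right_mono)
  qed
  have summ: "summable (\<lambda>k. c k * y ^ k)" for y
    by (rule summable_comparison_test[OF _ summable_exp[of "\<bar>y\<bar>"]]) (use dom in auto)
  \<comment> \<open>Formal differentiation yields the sine series shifted by one index, that is the
    series of \<open>sinc\<close>, the derivative of \<open>Si\<close>.\<close>
  have diffs: "diffs c k = sin_coeff (Suc k)" for k
    by (simp add: diffs_def c_def)
  have D: "(\<Sum>k. diffs c k * y ^ k) = sinc y" for y
  proof (cases "y = 0")
    case True
    then show ?thesis unfolding diffs by (simp add: powser_zero sin_coeff_def)
  next
    case False
    have "(\<lambda>k. sin_coeff (Suc k) * y ^ Suc k) sums sin y"
      using sin_converges[of y] sin_coeff_0 by (subst sums_Suc_iff) simp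
    from sums_divide[OF this, of y] have "(\<lambda>k. sin_coeff (Suc k) * y ^ k) sums (sin y / y)"
      using False by simp
    then show ?thesis using False unfolding diffs by (simp add: sums_iff)
  qed
  have "((\<lambda>x. Si x - (\<Sum>k. c k * x ^ k)) has_field_derivative 0) (at y)" for y
    using DERIV_diff[OF DERIV_Si[of y] termdiffs_strong_converges_everywhere[OF summ, of y]]
    unfolding D by simp
  then have "Si x - (\<Sum>k. c k * x ^ k) = Si 0 - (\<Sum>k. c k * 0 ^ k)"
    by (intro DERIV_isconst_all) auto
  \<comment> \<open>\<open>Si_neg\<close> at 0 reads Si 0 = - Si 0.\<close>
  also have "\<dots> = 0" using Si_neg[of 0] powser_zero[of c] by (simp add: c_def)
  finally show ?thesis using summ[of x] by (simp add: sums_iff c_def)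
qed

text \<open>The coefficients are at most 1 / fact k in absolute value, so the weighted sum is
  dominated by the exponential series at 2 * \<open>\<tau>\<close>.\<close>

lemma wiener_bound_Si:
  assumes "0 \<le> \<tau>"
  shows "wiener_bound (\<lambda>s. Si (\<tau> * s)) (exp (2 * \<tau>))"
proof -
  define b where "b k = sin_coeff k / real k * \<tau> ^ k" for k
  have dom: "\<bar>b k\<bar> * 2 ^ k \<le> (2 * \<tau>) ^ k /\<^sub>R fact k" for k
  proof (cases "k = 0")
    case False
    then have "real k * fact k \<ge> fact k" by (simp add: mult_le_cancel_right1)
    then have "\<bar>sin_coeff k / real k\<bar> \<le> inverse (fact k)" using False
      by (simp add: sin_coeff_def abs_mult power_abs divide_simps)
    then have "\<bar>sin_coeff k / real k\<bar> * (2 * \<tau>) ^ k \<le> inverse (fact k) * (2 * \<tau>) ^ k"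
      using assms by (intro mult_right_mono) auto
    then show ?thesis using assms
      by (simp add: b_def abs_mult power_mult_distrib mult_ac)
  qed (simp add: b_def)
  have s: "summable (\<lambda>k. \<bar>b k\<bar> * 2 ^ k)"
    by (rule summable_comparison_test[OF _ summable_exp_generic[of "2 * \<tau>"]]) (use dom in auto)
  have "(\<Sum>k. \<bar>b k\<bar> * 2 ^ k) \<le> (\<Sum>k. (2 * \<tau>) ^ k /\<^sub>R fact k)"
    by (rule suminf_le[OF dom s summable_exp_generic])
  also have "\<dots> = exp (2 * \<tau>)" by (simp add: exp_def)
  finally show ?thesis unfolding wiener_bound_def
    using s Si_sums[of "\<tau> * _"] by (intro exI[of _ b]) (auto simp: b_def power_mult_distrib mult_ac)
qed

text \<open>The probability that a binomial variable with 2 * r trials and success probability p is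
  at least r: the majority polynomial, with ties counted as success.\<close>

definition amplify :: "nat \<Rightarrow> real \<Rightarrow> real" where
  "amplify r p = (\<Sum>j\<in>{r..2*r}. real ((2*r) choose j) * (p ^ j * (1 - p) ^ (2*r - j)))"

text \<open>As p \<le> 1 - p, trading j - r factors p for factors 1 - p only increases the product
  and leaves (p (1 - p)) ^ r. On [0, 1/4] the factor p (1 - p) is at most 3/16.\<close>

lemma amplify_summand_le:
  fixes p :: real
  assumes "0 \<le> p" "p \<le> 1/4" "r \<le> j" "j \<le> 2 * r"
  shows "p ^ j * (1 - p) ^ (2*r - j) \<le> (3/16) ^ r"
proof -
  have "p ^ j = p ^ (j - r) * p ^ r" using assms by (simp flip: power_add)
  then have "p ^ j * (1 - p) ^ (2*r - j) = p ^ (j - r) * (p ^ r * (1 - p) ^ (2*r - j))" by simp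
  also have "\<dots> \<le> (1 - p) ^ (j - r) * (p ^ r * (1 - p) ^ (2*r - j))"
    using assms by (intro mult_right_mono power_mono) auto
  also have "\<dots> = p ^ r * ((1 - p) ^ (j - r) * (1 - p) ^ (2*r - j))" by simp
  also have "(1 - p) ^ (j - r) * (1 - p) ^ (2*r - j) = (1 - p) ^ r"
    using assms by (simp flip: power_add)
  also have "p ^ r * (1 - p) ^ r = (p * (1 - p)) ^ r" by (simp add: power_mult_distrib)
  also have "\<dots> \<le> (3/16) ^ r"
  proof (rule power_mono)
    have "0 \<le> (1/4 - p) * (3/4 - p)" using assms by (intro mult_nonneg_nonneg) auto
    then show "p * (1 - p) \<le> 3/16" by (simp add: field_simps)
  qed (use assms in auto)
  finally show ?thesis .
qed

lemma sum_choose_le_four_power: "I \<subseteq> {..2*r} \<Longrightarrow> (\<Sum>j\<in>I. real ((2*r) choose j)) \<le> 4 ^ r"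
proof -
  assume "I \<subseteq> {..2*r}"
  then have "(\<Sum>j\<in>I. real ((2*r) choose j)) \<le> (\<Sum>j\<le>2*r. real ((2*r) choose j))"
    by (intro sum_mono2) auto
  also have "\<dots> = 2 ^ (2*r)" by (metis choose_row_sum of_nat_sum of_nat_power of_nat_numeral)
  finally show ?thesis by (simp add: power_mult)
qed

text \<open>The binomial coefficients sum to at most 4 ^ r and each remaining factor is at most
  (3/16) ^ r.\<close>

lemma amplify_low:
  assumes "0 \<le> p" "p \<le> 1/4"
  shows "\<bar>amplify r p\<bar> \<le> (3/4) ^ r"
proof -
  have "0 \<le> amplify r p" unfolding amplify_def using assms by (intro sum_nonneg) auto
  moreover have "amplify r p \<le> (\<Sum>j\<in>{r..2*r}. real ((2*r) choose j) * (3/16) ^ r)"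
    unfolding amplify_def using assms by (intro sum_mono mult_left_mono amplify_summand_le) auto
  moreover have "\<dots> \<le> 4 ^ r * (3/16) ^ r"
    unfolding sum_distrib_right[symmetric] by (intro mult_right_mono sum_choose_le_four_power) auto
  moreover have "\<dots> = (3/4 :: real) ^ r" by (simp flip: power_mult_distrib)
  ultimately show ?thesis by simp
qed

text \<open>By the binomial theorem 1 - amplify is the lower tail, which is an upper tail after
  exchanging p with 1 - p and j with 2 * r - j.\<close>

lemma amplify_high:
  assumes "3/4 \<le> p" "p \<le> 1"
  shows "\<bar>amplify r p - 1\<bar> \<le> (3/4) ^ r"
proof -
  let ?t = "\<lambda>j. real ((2*r) choose j) * (p ^ j * (1 - p) ^ (2*r - j))"
  have "1 = (\<Sum>j\<le>2*r. ?t j)"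
    using binomial_ring[of p "1 - p" "2*r"] by (simp add: mult_ac)
  also have "{..2*r} = {..<r} \<union> {r..2*r}" by auto
  also have "(\<Sum>j\<in>{..<r} \<union> {r..2*r}. ?t j) = (\<Sum>j<r. ?t j) + amplify r p"
    unfolding amplify_def by (intro sum.union_disjoint) auto
  finally have eq: "1 - amplify r p = (\<Sum>j<r. ?t j)" by simp
  have "0 \<le> (\<Sum>j<r. ?t j)" using assms by (intro sum_nonneg) auto
  moreover have "(\<Sum>j<r. ?t j) \<le> (\<Sum>j<r. real ((2*r) choose j) * (3/16) ^ r)"
  proof (intro sum_mono mult_left_mono)
    fix j assume "j \<in> {..<r}"
    then have "(1 - p) ^ (2*r - j) * (1 - (1 - p)) ^ (2*r - (2*r - j)) \<le> (3/16) ^ r"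
      using assms by (intro amplify_summand_le) auto
    then show "p ^ j * (1 - p) ^ (2*r - j) \<le> (3/16) ^ r" using \<open>j \<in> {..<r}\<close> by (simp add: mult_ac)
  qed auto
  moreover have "\<dots> \<le> 4 ^ r * (3/16) ^ r"
    unfolding sum_distrib_right[symmetric] by (intro mult_right_mono sum_choose_le_four_power) auto
  moreover have "\<dots> = (3/4 :: real) ^ r" by (simp flip: power_mult_distrib)
  ultimately show ?thesis using eq by (simp add: abs_if)
qed

text \<open>With M bounding f and 1 + M bounding 1 - f, the summands bound those of the binomial
  expansion of (M + (1 + M)) ^ (2*r).\<close>

lemma wiener_bound_amplify:
  assumes "wiener_bound f M"
  shows "wiener_bound (\<lambda>s. amplify r (f s)) ((1 + 2 * M) ^ (2*r))"
proof -
  have M: "0 \<le> M" using assms unfolding wiener_bound_def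
    by (auto intro: order_trans[OF suminf_nonneg])
  have m: "wiener_bound (\<lambda>s. 1 - f s) (1 + M)"
    using wiener_bound_add[OF wiener_bound_const[of 1] wiener_bound_mult[OF wiener_bound_const[of "-1"] assms]]
    by simp
  have "wiener_bound (\<lambda>s. amplify r (f s))
      (\<Sum>j\<in>{r..2*r}. \<bar>real ((2*r) choose j)\<bar> * (M ^ j * (1 + M) ^ (2*r - j)))"
    unfolding amplify_def
    by (intro wiener_bound_sum wiener_bound_mult wiener_bound_power wiener_bound_const assms m) auto
  moreover have "(\<Sum>j\<in>{r..2*r}. \<bar>real ((2*r) choose j)\<bar> * (M ^ j * (1 + M) ^ (2*r - j)))
      \<le> (\<Sum>j\<le>2*r. real ((2*r) choose j) * M ^ j * (1 + M) ^ (2*r - j))"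
    using M by (simp only: abs_of_nat mult.assoc) (intro sum_mono2, auto)
  moreover have "\<dots> = (1 + 2 * M) ^ (2*r)"
    using binomial_ring[of M "1 + M" "2*r"] by (simp add: add_ac)
  ultimately show ?thesis using wiener_bound_mono by simp
qed

text \<open>The scale \<open>\<tau>\<close> = X / \<rho> moves every s with \<rho> \<le>
  \<bar>s\<bar> to where \<open>Si\<close> is close to its limits pi/2 and -pi/2. Then 1/2 + Si/4 is
  within [3/4, 1] or [0, 1/4], as \<open>amplify\<close> requires. Nothing is claimed inside the
  margin.\<close>

lemma step_approximation:
  "\<exists>Y>0. \<forall>\<rho> r. 0 < \<rho> \<longrightarrow> \<rho> \<le> 1 \<longrightarrow> (\<exists>f. wiener_bound f (exp (Y * real r / \<rho>)) \<and>
     (\<forall>s. \<bar>s\<bar> \<le> 1 \<longrightarrow> \<rho> \<le> \<bar>s\<bar> \<longrightarrow> \<bar>f s - (if 0 \<le> s then 1 else 0)\<bar> \<le> (3/4) ^ r))"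
proof -
  \<comment> \<open>Tolerance 2/5 places 1/2 + Si/4 within 1/10 of 1/2 + pi/8, hence between 3/4 and
    1.\<close>
  have "eventually (\<lambda>T. dist (Si T) (pi / 2) < 2/5) at_top"
    using tendstoD[OF Si_at_top, of "2/5"] by simp
  then obtain X0 where X0: "\<And>T. T \<ge> X0 \<Longrightarrow> \<bar>Si T - pi / 2\<bar> < 2/5"
    unfolding eventually_at_top_linorder dist_real_def by blast
  define X where "X = max 1 X0"
  have X: "X \<ge> 1" "\<And>T. T \<ge> X \<Longrightarrow> \<bar>Si T - pi / 2\<bar> < 2/5" using X0 by (auto simp: X_def)
  have pi: "157/50 < pi" "pi < 79/25" using pi_approx by auto
  show ?thesis
  \<comment> \<open>One factor of the amplified polynomial costs at most exp (2 *
    \<open>\<tau>\<close> + 2), there are 2 * r factors, and 2 * \<open>\<tau>\<close> + 2 \<le> (2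
    * X + 2) / \<rho> because \<rho> \<le> 1.\<close>
  proof (intro exI[of _ "2 * (2 * X + 2)"] conjI allI impI)
    show "0 < 2 * (2 * X + 2)" using X by simp
  next
    fix \<rho> :: real and r :: nat assume \<rho>: "0 < \<rho>" "\<rho> \<le> 1"
    define \<tau> where "\<tau> = X / \<rho>"
    define p where "p s = 1/2 + 1/4 * Si (\<tau> * s)" for s
    have \<tau>: "0 \<le> \<tau>" using X \<rho> by (simp add: \<tau>_def)
    have wp: "wiener_bound p (\<bar>1/2\<bar> + \<bar>1/4\<bar> * exp (2 * \<tau>))"
      unfolding p_def by (intro wiener_bound_add wiener_bound_mult wiener_bound_const wiener_bound_Si \<tau>)
    have e1: "1 \<le> exp (2 * \<tau>)" using \<tau> by simp
    have "1 + 2 * (\<bar>1/2\<bar> + \<bar>1/4\<bar> * exp (2 * \<tau>)) \<le> 3 * exp (2 * \<tau>)"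
      by (simp, insert e1, linarith)
    also have "\<dots> \<le> exp 2 * exp (2 * \<tau>)" using exp_ge_add_one_self[of 2] by simp
    also have "\<dots> = exp (2 * \<tau> + 2)" by (simp add: exp_add)
    finally have "(1 + 2 * (\<bar>1/2\<bar> + \<bar>1/4\<bar> * exp (2 * \<tau>))) ^ (2*r) \<le> exp (2 * \<tau> + 2) ^ (2 * r)"
      by (intro power_mono) auto
    also have "\<dots> = exp (2 * real r * (2 * \<tau> + 2))" 
      using exp_of_nat_mult[of "2 * r" "2 * \<tau> + 2"] by simp
    also have "\<dots> \<le> exp (2 * (2 * X + 2) * real r / \<rho>)"
    proof -
      have "2 * \<tau> + 2 \<le> (2 * X + 2) / \<rho>" using \<rho> by (simp add: \<tau>_def field_simps)
      then have "2 * real r * (2 * \<tau> + 2) \<le> 2 * real r * ((2 * X + 2) / \<rho>)"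
        by (intro mult_left_mono) auto
      then show ?thesis by (simp add: mult_ac)
    qed
    finally have w: "wiener_bound (\<lambda>s. amplify r (p s)) (exp (2 * (2 * X + 2) * real r / \<rho>))"
      by (rule wiener_bound_mono[OF wiener_bound_amplify[OF wp]])
    have Xs: "X \<le> \<tau> * s" if "\<rho> \<le> s" for s
      using mult_left_mono[OF that, of X] X(1) \<rho> by (simp add: \<tau>_def pos_le_divide_eq)
    have "\<bar>amplify r (p s) - (if 0 \<le> s then 1 else 0)\<bar> \<le> (3/4) ^ r"
      if s: "\<rho> \<le> \<bar>s\<bar>" for s
    proof (cases "0 \<le> s")
      case True
      then have "X \<le> \<tau> * s" using s Xs[of s] by simp
      from X(2)[OF this] have "3/4 \<le> p s" "p s \<le> 1"
        using pi unfolding p_def by linarith+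
      then show ?thesis using amplify_high True by simp
    next
      case False
      then have X': "X \<le> \<tau> * (-s)" using s by (intro Xs) simp
      moreover have "Si (\<tau> * s) = - Si (\<tau> * (-s))" using Si_neg[of "\<tau> * (-s)"] X' X by simp
      ultimately have "0 \<le> p s" "p s \<le> 1/4"
        using X(2)[of "\<tau> * (-s)"] pi unfolding p_def by linarith+
      then show ?thesis using amplify_low False by simp
    qed
    with w show "\<exists>f. wiener_bound f (exp (2 * (2 * X + 2) * real r / \<rho>)) \<and>
       (\<forall>s. \<bar>s\<bar> \<le> 1 \<longrightarrow> \<rho> \<le> \<bar>s\<bar> \<longrightarrow> \<bar>f s - (if 0 \<le> s then 1 else 0)\<bar> \<le> (3/4) ^ r)"
      by blast
  qed
qed

section \<open>Programs\<close>

fun loop_free :: "com \<Rightarrow> bool" where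
  "loop_free (Seq c1 c2) = (loop_free c1 \<and> loop_free c2)"
| "loop_free (Cond b c1 c2) = False"
| "loop_free (Loop b c) = False"
| "loop_free c = True"

fun cost :: "com \<Rightarrow> nat" where
  "cost (Seq c1 c2) = cost c1 + cost c2"
| "cost c = 1"

text \<open>Meaningful for \<open>loop_free\<close> programs: the last equation is a default that
  also catches \<open>Cond\<close> and \<open>Loop\<close>. Straight-line code can thus be verified
  by simplification.\<close>

fun denote :: "(real \<Rightarrow> real) \<Rightarrow> com \<Rightarrow> state \<Rightarrow> state" where
  "denote u (IConst i c) (r, M) = (r(i := c), M)"
| "denote u (IAdd i j k) (r, M) = (r(i := r j + r k), M)"
| "denote u (ISub i j k) (r, M) = (r(i := r j - r k), M)"
| "denote u (RConst i c) (r, M) = (r, M(r i := of_rat c))"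
| "denote u (RCopy i j) (r, M) = (r, M(r i := M (r j)))"
| "denote u (RArith f i j k) (r, M) = (r, M(r i := arith_op f (M (r j)) (M (r k))))"
| "denote u (Oracle i j) (r, M) = (r, M(r i := u (M (r j))))"
| "denote u (Seq c1 c2) s = denote u c2 (denote u c1 s)"
| "denote u c s = s"

lemmas exec_basic = exec.Skip exec.IConst exec.IAdd exec.ISub exec.RConst exec.RCopy exec.RArith exec.Oracle

lemma exec_loop_free: "loop_free c \<Longrightarrow> exec u c (r, M) (cost c) (denote u c (r, M))"
proof (induction c arbitrary: r M)
  case (Seq c1 c2)
  obtain r' M' where d: "denote u c1 (r, M) = (r', M')" by fastforce
  have "exec u c1 (r, M) (cost c1) (r', M')" using Seq d by (metis loop_free.simps(1))
  moreover have "exec u c2 (r', M') (cost c2) (denote u c2 (r', M'))" using Seq by simp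
  ultimately show ?case by (simp add: d exec.Seq)
qed (simp_all add: exec_basic[unfolded One_nat_def])

text \<open>A Hoare triple for total correctness with a step budget.\<close>

definition triple :: "(real \<Rightarrow> real) \<Rightarrow> (state \<Rightarrow> bool) \<Rightarrow> com \<Rightarrow> nat \<Rightarrow> (state \<Rightarrow> bool) \<Rightarrow> bool" where
  "triple u P c T Q \<longleftrightarrow> (\<forall>s. P s \<longrightarrow> (\<exists>s'. halts_within u c s T s' \<and> Q s'))"

lemma triple_weaken:
  "triple u P c T Q \<Longrightarrow> (\<And>s. P' s \<Longrightarrow> P s) \<Longrightarrow> (\<And>s. Q s \<Longrightarrow> Q' s) \<Longrightarrow> T \<le> T' \<Longrightarrow> triple u P' c T' Q'"
  unfolding triple_def halts_within_def by (meson order_trans)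

lemma triple_loop_free:
  assumes "loop_free c" "\<And>r M. P (r, M) \<Longrightarrow> Q (denote u c (r, M))" "cost c \<le> T"
  shows "triple u P c T Q"
  unfolding triple_def halts_within_def using assms exec_loop_free by (metis surj_pair)

lemma triple_Seq:
  assumes "triple u P c1 T1 Q" "triple u Q c2 T2 R"
  shows "triple u P (Seq c1 c2) (T1 + T2) R"
  using assms unfolding triple_def halts_within_def
  by (meson exec.Seq add_mono)

lemma triple_Cond:
  assumes "triple u (\<lambda>s. P s \<and> holds b s) c1 T Q" "triple u (\<lambda>s. P s \<and> \<not> holds b s) c2 T Q"
  shows "triple u P (Cond b c1 c2) (Suc T) Q"
  unfolding triple_def
proof (intro allI impI)
  fix s assume "P s"
  show "\<exists>s'. halts_within u (Cond b c1 c2) s (Suc T) s' \<and> Q s'"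
  proof (cases "holds b s")
    case True
    then show ?thesis using assms(1) \<open>P s\<close> unfolding triple_def halts_within_def
      by (meson exec.CondTrue Suc_le_mono)
  next
    case False
    then show ?thesis using assms(2) \<open>P s\<close> unfolding triple_def halts_within_def
      by (meson exec.CondFalse Suc_le_mono)
  qed
qed

text \<open>The invariant is indexed by the completed rounds and decides the guard, so exactly k
  rounds are run. Each costs one test and the body; the final failing test gives the
  \<open>+ 1\<close>.\<close>

lemma triple_Loop:
  assumes body: "\<And>i. i < k \<Longrightarrow> triple u (I i) c T (I (Suc i))"
    and guard: "\<And>i s. i \<le> k \<Longrightarrow> I i s \<Longrightarrow> holds b s \<longleftrightarrow> i < k"
  shows "triple u (I 0) (Loop b c) (k * Suc T + 1) (I k)"
proof -
  have run: "\<exists>t s'. t \<le> d * Suc T + 1 \<and> exec u (Loop b c) s t s' \<and> I k s'"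
    if "I i s" "i + d = k" for i d s
    using that
  proof (induction d arbitrary: i s)
    case 0
    then show ?case using guard[of i s] exec.LoopFalse[of b s u c] by (intro exI[of _ 1] exI[of _ s]) auto
  next
    case (Suc d)
    have "i < k" using Suc.prems by simp
    then obtain t1 s1 where 1: "t1 \<le> T" "exec u c s t1 s1" "I (Suc i) s1"
      using body[of i] Suc.prems(1) unfolding triple_def halts_within_def by blast
    obtain t2 s2 where 2: "t2 \<le> d * Suc T + 1" "exec u (Loop b c) s1 t2 s2" "I k s2"
      using Suc.IH[OF 1(3)] Suc.prems by auto
    show ?case using exec.LoopTrue[OF _ 1(2) 2(2)] guard[of i s] Suc.prems 1 2
      by (intro exI[of _ "Suc (t1 + t2)"] exI[of _ s2]) auto
  qed
  show ?thesis unfolding triple_def halts_within_def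
  proof (intro allI impI)
    fix s assume "I 0 s"
    from run[OF this, of k] show "\<exists>s'. (\<exists>t\<le>k * Suc T + 1. exec u (Loop b c) s t s') \<and> I k s'" by auto
  qed
qed

text \<open>The address of record j in a table that starts at b. A record has n coordinates and one
  cell for a label or coefficient, hence the stride \<open>Suc n\<close>.\<close>

definition block :: "nat \<Rightarrow> nat \<Rightarrow> nat \<Rightarrow> nat" where
  "block b n j = b + j * Suc n"

lemma block_0: "block b n 0 = b"
  and block_Suc: "block b n (Suc j) = Suc (block b n j + n)"
  and block_ge: "b \<le> block b n j"
  and block_shift: "block (n + b) n j = n + block b n j"
  by (simp_all add: block_def)

lemma block_less:
  assumes "i < j" "k \<le> n"
  shows "block b n i + k < block b n j"
proof -
  have "block b n i + k < block b n (Suc i)" using assms by (simp add: block_Suc)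
  also have "\<dots> \<le> block b n j"
    unfolding block_def using assms by (intro add_left_mono mult_right_mono) auto
  finally show ?thesis .
qed

lemma block_less_iff: "block b n i < block b n j \<longleftrightarrow> i < j"
  using block_less[of i j 0 n b] block_less[of j i 0 n b] by (cases i j rule: linorder_cases) auto

lemma block_eq_iff:
  assumes "k \<le> n" "l \<le> n"
  shows "block b n i + k = block b n j + l \<longleftrightarrow> i = j \<and> k = l"
  using block_less[of i j k n b] block_less[of j i l n b] assms
  by (cases i j rule: linorder_cases) auto

lemma nth_concat_uniform:
  assumes "\<And>j. length (f j) = N" "j < m" "i < N"
  shows "concat (map f [0..<m]) ! (j * N + i) = f j ! i"
  using assms(2)
proof (induction m)
  case (Suc m)
  have len: "length (concat (map f [0..<m])) = m * N"
    by (induction m) (simp_all add: assms(1))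
  show ?case
  proof (cases "j < m")
    case True
    have "j * N + i < Suc j * N" using assms(3) by simp
    also have "\<dots> \<le> m * N" using True by (intro mult_right_mono) auto
    finally show ?thesis using Suc.IH[OF True] len by (simp add: nth_append)
  next
    case False
    then show ?thesis using Suc.prems len by (simp add: nth_append less_Suc_eq)
  qed
qed simp

section \<open>The predictor\<close>

definition comb :: "nat \<Rightarrow> (nat \<Rightarrow> point) \<Rightarrow> (nat \<Rightarrow> real) \<Rightarrow> nat \<Rightarrow> point \<Rightarrow> real" where
  "comb n X al j x = (\<Sum>i<j. al i / (2 - ip n (X i) x))"

lemma comb_simps:
  "comb n X al 0 x = 0"
  "comb n X al (Suc j) x = comb n X al j x + al j / (2 - ip n (X j) x)"
  by (simp_all add: comb_def)

primrec seq :: "com list \<Rightarrow> com" where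
  "seq [] = Skip"
| "seq (c # cs) = Seq c (seq cs)"

text \<open>
  The representation of a hypothesis starts with a sum and a count and continues with the blocks
  \<open>x\<^sub>j, \<alpha>\<^sub>j\<close> from cell 5 on. The predictor adds \<open>u\<close> of each partial kernel expansion to the sum and
  returns the mean. Cells 2 to 4 of the representation are its work space.
  Index registers 0, 2, 4, 5, 6 hold the addresses \<open>n\<close> to \<open>n + 4\<close> of its first five cells.
\<close>

definition predictor_dot_body :: com where
  "predictor_dot_body = seq [RArith Times 6 7 9, RArith Minus 5 5 6, IAdd 7 7 3, IAdd 9 9 3]"

definition predictor_head :: com where
  "predictor_head = seq [RCopy 6 4, Oracle 6 6, RArith Plus 0 0 6, RConst 6 1, RArith Plus 2 2 6,
     RConst 5 2, IConst 9 0]"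

definition predictor_tail :: com where
  "predictor_tail = seq [RArith Divide 5 7 5, RArith Plus 4 4 5, IAdd 7 7 3]"

definition predictor_body :: com where
  "predictor_body = Seq predictor_head (Seq (Loop (ILess 9 0) predictor_dot_body) predictor_tail)"

definition predictor_init :: com where
  "predictor_init = seq [IConst 3 1, IAdd 2 0 3, IAdd 4 2 3, IAdd 5 4 3, IAdd 6 5 3, IAdd 7 6 3,
     IAdd 8 0 1, RConst 4 0]"

definition predictor_prog :: com where
  "predictor_prog = Seq predictor_init (Seq (Loop (ILess 7 8) predictor_body) (RArith Divide 10 0 2))"

text \<open>\<open>I\<close> describes the state between blocks and \<open>J\<close> the state after
  i coordinates of a dot product. \<open>frame\<close> collects what survives all writes to the five
  cells from n on and to registers 7 and 9.\<close>

lemma predictor_spec: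
  fixes X :: "nat \<Rightarrow> point" and al :: "nat \<Rightarrow> real" and x :: point
  assumes len: "length c = block 5 n m"
    and c0: "c ! 0 = T0" "c ! 1 = N0"
    and cX: "\<And>j i. j < m \<Longrightarrow> i < n \<Longrightarrow> c ! (block 5 n j + i) = X j i"
    and cal: "\<And>j. j < m \<Longrightarrow> c ! (block 5 n j + n) = al j"
  shows "\<exists>s'. halts_within u predictor_prog (predictor_input c n x) (11 + m * (14 + 6 * n)) s' \<and>
    predictor_output s' = (T0 + (\<Sum>j<m. u (comb n X al j x))) / (N0 + real m)"
proof -
  define frame where "frame r M \<longleftrightarrow> r 0 = n \<and> r 2 = n + 1 \<and> r 3 = 1 \<and> r 4 = n + 2 \<and> r 5 = n + 3 \<and> r 6 = n + 4
     \<and> r 8 = block (n + 5) n m \<and> r 10 = 0 \<and> (\<forall>i<n. M i = x i)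
     \<and> (\<forall>j<m. \<forall>i<n. M (block (n + 5) n j + i) = X j i) \<and> (\<forall>j<m. M (block (n + 5) n j + n) = al j)"
    for r :: "nat \<Rightarrow> nat" and M :: "nat \<Rightarrow> real"
  have frame_cell: "frame r (M(a := v))" if "frame r M" "n \<le> a" "a < n + 5" for r M a v
  proof -
    have "(M(a := v)) (block (n + 5) n j + i) = M (block (n + 5) n j + i)" for j i
      using block_ge[of "n + 5" n j] that by auto
    moreover have "(M(a := v)) i = M i" if "i < n" for i using that \<open>n \<le> a\<close> by auto
    ultimately show ?thesis using that(1) unfolding frame_def by (simp del: fun_upd_apply)
  qed
  have frame_reg: "frame (r(a := v)) M" if "frame r M" "a = 7 \<or> a = 9" for r M a v
    using that unfolding frame_def by auto
  define I where "I j s \<longleftrightarrow> (case s of (r, M) \<Rightarrow> frame r M \<and> r 7 = block (n + 5) n j \<and>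
     M n = T0 + (\<Sum>i<j. u (comb n X al i x)) \<and> M (n + 1) = N0 + real j \<and> M (n + 2) = comb n X al j x)"
    for j and s :: state
  define J where "J j i s \<longleftrightarrow> (case s of (r, M) \<Rightarrow> frame r M \<and> r 7 = block (n + 5) n j + i \<and> r 9 = i \<and>
     M n = T0 + (\<Sum>i<Suc j. u (comb n X al i x)) \<and> M (n + 1) = N0 + real (Suc j) \<and> M (n + 2) = comb n X al j x \<and>
     M (n + 3) = 2 - (\<Sum>l<i. X j l * x l))"
    for j i and s :: state
  have regs: "r 0 = n" "r 2 = n + 1" "r 3 = 1" "r 4 = n + 2" "r 5 = n + 3" "r 6 = n + 4"
     "r 8 = block (n + 5) n m" "r 10 = 0" "\<And>i. i < n \<Longrightarrow> M i = x i"
     "\<And>j i. j < m \<Longrightarrow> i < n \<Longrightarrow> M (block (n + 5) n j + i) = X j i"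
     "\<And>j. j < m \<Longrightarrow> M (block (n + 5) n j + n) = al j" if "frame r M" for r M
    using that by (auto simp: frame_def)
  have dot: "triple u (J j i) predictor_dot_body 5 (J j (Suc i))" if "j < m" "i < n" for j i
  proof (rule triple_loop_free)
    fix r :: "nat \<Rightarrow> nat" and M :: "nat \<Rightarrow> real" assume *: "J j i (r, M)"
    then have f: "frame r M" by (simp add: J_def)
    show "J j (Suc i) (denote u predictor_dot_body (r, M))"
      using * that regs[OF f] unfolding J_def predictor_dot_body_def
      by (auto intro!: frame_cell frame_reg f simp: algebra_simps)
  qed (simp_all add: predictor_dot_body_def)
  have head: "triple u (I j) predictor_head 8 (J j 0)" if "j < m" for j
  proof (rule triple_loop_free)
    fix r :: "nat \<Rightarrow> nat" and M :: "nat \<Rightarrow> real" assume *: "I j (r, M)"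
    then have f: "frame r M" by (simp add: I_def)
    show "J j 0 (denote u predictor_head (r, M))"
      using * that regs[OF f] unfolding I_def J_def predictor_head_def
      by (auto intro!: frame_cell frame_reg f simp: algebra_simps)
  qed (simp_all add: predictor_head_def)
  have tail: "triple u (J j n) predictor_tail 4 (I (Suc j))" if "j < m" for j
  proof (rule triple_loop_free)
    fix r :: "nat \<Rightarrow> nat" and M :: "nat \<Rightarrow> real" assume *: "J j n (r, M)"
    then have f: "frame r M" by (simp add: J_def)
    show "I (Suc j) (denote u predictor_tail (r, M))"
      using * that regs[OF f] block_ge[of "n + 5" n j] unfolding I_def J_def predictor_tail_def
      by (auto intro!: frame_cell frame_reg f simp: comb_simps ip_def block_Suc)
  qed (simp_all add: predictor_tail_def)
  have body: "triple u (I j) predictor_body (8 + ((n * Suc 5 + 1) + 4)) (I (Suc j))" if "j < m" for j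
    unfolding predictor_body_def
    by (intro triple_Seq[OF head] triple_Seq[OF _ tail] triple_Loop[where I = "J j"] dot that)
       (auto simp: J_def frame_def split: prod.splits)
  have init: "triple u ((=) (predictor_input c n x)) predictor_init 9 (I 0)"
  proof (rule triple_loop_free)
    fix r :: "nat \<Rightarrow> nat" and M :: "nat \<Rightarrow> real" assume "predictor_input c n x = (r, M)"
    then have r: "r = (\<lambda>_. 0)(0 := n, 1 := length c)" and M: "M = memory (map x [0..<n] @ c)"
      by (simp_all add: predictor_input_def)
    have Mc: "M (n + k) = c ! k" if "k < block 5 n m" for k
      using that len by (simp add: M memory_def nth_append)
    have Mx: "M i = x i" if "i < n" for i
      using that by (simp add: M memory_def nth_append)
    have "5 \<le> block 5 n m" by (rule block_ge)
    then have M0: "M n = T0" "M (n + 1) = N0" using Mc[of 0] Mc[of 1] c0 by simp_all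
    have MX: "M (block (n + 5) n j + i) = X j i" if "j < m" "i < n" for j i
      using Mc[of "block 5 n j + i"] cX[OF that] block_less[OF that(1), of i n 5] that
      by (simp add: block_shift add.assoc)
    have Mal: "M (block (n + 5) n j + n) = al j" if "j < m" for j
      using Mc[of "block 5 n j + n"] cal[OF that] block_less[OF that, of n n 5]
      by (simp add: block_shift add.assoc)
    have f: "frame (r(3 := 1, 2 := n + 1, 4 := n + 2, 5 := n + 1 + 1 + 1, 6 := n + 1 + 1 + 1 + 1,
       7 := n + 1 + 1 + 1 + 1 + 1, 8 := block (n + 5) n m)) M"
      unfolding frame_def using Mx MX Mal by (auto simp: r)
    show "I 0 (denote u predictor_init (r, M))"
      using frame_cell[OF f, of "n + 2" 0] M0
      by (simp add: predictor_init_def I_def r len comb_simps block_0 block_shift)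
  qed (simp_all add: predictor_init_def)
  \<comment> \<open>Register 10 is still 0 and addresses the output cell. Register 0 holds n, which
    is both the dimension and the address of the sum.\<close>
  have finish: "triple u (I m) (RArith Divide 10 0 2) 1
    (\<lambda>s. predictor_output s = (T0 + (\<Sum>j<m. u (comb n X al j x))) / (N0 + real m))"
    by (rule triple_loop_free) (auto simp: I_def frame_def predictor_output_def)
  have "triple u ((=) (predictor_input c n x)) predictor_prog
     (9 + ((m * Suc (8 + ((n * Suc 5 + 1) + 4)) + 1) + 1))
     (\<lambda>s. predictor_output s = (T0 + (\<Sum>j<m. u (comb n X al j x))) / (N0 + real m))"
    unfolding predictor_prog_def
    by (intro triple_Seq[OF init] triple_Seq[OF _ finish] triple_Loop[where I = I] body)
       (auto simp: I_def frame_def block_less_iff split: prod.splits)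
  then show ?thesis unfolding triple_def by (simp add: algebra_simps)
qed

section \<open>The gradient iteration and the learner\<close>

primrec glm :: "nat \<Rightarrow> (real \<Rightarrow> real) \<Rightarrow> real \<Rightarrow> sample \<Rightarrow> nat \<Rightarrow> point \<Rightarrow> real" where
  "glm n u lam S 0 = (\<lambda>_. 0)"
| "glm n u lam S (Suc j) = (\<lambda>x. glm n u lam S j x
     + lam * (snd (S j) - u (glm n u lam S j (fst (S j)))) * ker n (fst (S j)) x)"

definition glm_coef :: "nat \<Rightarrow> (real \<Rightarrow> real) \<Rightarrow> real \<Rightarrow> sample \<Rightarrow> nat \<Rightarrow> real" where
  "glm_coef n u lam S j = lam * (snd (S j) - u (glm n u lam S j (fst (S j))))"

text \<open>The bridge between the coefficients stored by the machine and the functions of the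
  analysis.\<close>

lemma comb_glm_coef: "comb n (\<lambda>j. fst (S j)) (glm_coef n u lam S) j x = glm n u lam S j x"
  by (induction j) (simp_all add: comb_simps glm_coef_def ker_def)

text \<open>
  The learner replaces each label \<open>y\<^sub>j\<close> in place by the coefficient \<open>\<alpha>\<^sub>j\<close>. Index registers 2 to 6 hold
  the addresses 0 to 4 of the former parameter cells, which become work space; cell 0 keeps the step size.
\<close>

definition learner_dot_body :: com where
  "learner_dot_body = seq [RArith Times 5 10 11, RArith Minus 4 4 5, IAdd 10 10 3, IAdd 11 11 3]"

definition learner_pair_head :: com where
  "learner_pair_head = seq [RConst 4 2, IAdd 11 7 2, IAdd 12 10 0]"

definition learner_pair_tail :: com where
  "learner_pair_tail = seq [RArith Divide 4 10 4, RArith Plus 3 3 4, IAdd 10 10 3]"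

definition learner_pair :: com where
  "learner_pair = Seq learner_pair_head (Seq (Loop (ILess 10 12) learner_dot_body) learner_pair_tail)"

definition learner_row_head :: com where
  "learner_row_head = seq [RConst 3 0, IConst 10 5]"

definition learner_row_tail :: com where
  "learner_row_tail = seq [Oracle 3 3, IAdd 7 7 0, RArith Minus 7 7 3, RArith Times 7 7 2, IAdd 7 7 3, IAdd 8 8 3]"

definition learner_row :: com where
  "learner_row = Seq learner_row_head (Seq (Loop (ILess 10 7) learner_pair) learner_row_tail)"

definition learner_finish :: com where
  "learner_finish = seq [RConst 2 0, RConst 3 0, IAdd 0 7 2]"

definition learner_main :: com where
  "learner_main = Seq (Loop (ILess 8 1) learner_row) learner_finish"

text \<open>In-place replacement is sound because row j reads only its own label and the
  coefficients of rows below j, and overwrites that label after its kernel sum is complete.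
  \<open>I\<close>, \<open>J\<close> and \<open>K\<close> are the invariants for rows, pairs of rows
  and coordinates.\<close>

lemma learner_main_spec:
  fixes n m :: nat and u :: "real \<Rightarrow> real" and lam :: real and S :: sample
  defines "al \<equiv> glm_coef n u lam S"
  shows "triple u
    (\<lambda>(r, M). r 0 = n \<and> r 1 = m \<and> r 2 = 0 \<and> r 3 = 1 \<and> r 4 = 2 \<and> r 5 = 3 \<and> r 6 = 4 \<and> r 7 = 5 \<and> r 8 = 0 \<and>
       M 0 = lam \<and> (\<forall>j<m. (\<forall>i<n. M (block 5 n j + i) = fst (S j) i) \<and> M (block 5 n j + n) = snd (S j)))
    learner_main (m * (12 + m * (10 + 6 * n)) + 5)
    (\<lambda>(r, M). r 0 = block 5 n m \<and> M 0 = 0 \<and> M 1 = 0 \<and>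
       (\<forall>j<m. (\<forall>i<n. M (block 5 n j + i) = fst (S j) i) \<and> M (block 5 n j + n) = al j))"
proof -
  define X where "X j = fst (S j)" for j
  have al: "al j = lam * (snd (S j) - u (comb n X al j (X j)))" for j
    unfolding al_def X_def comb_glm_coef by (simp add: glm_coef_def)
  define frame where "frame j r M \<longleftrightarrow> r 0 = n \<and> r 1 = m \<and> r 2 = 0 \<and> r 3 = 1 \<and> r 4 = 2 \<and> r 5 = 3 \<and> r 6 = 4
     \<and> r 8 = j \<and> M 0 = lam
     \<and> (\<forall>k<m. \<forall>i<n. M (block 5 n k + i) = X k i) \<and> (\<forall>k<j. M (block 5 n k + n) = al k)
     \<and> (\<forall>k<m. j \<le> k \<longrightarrow> M (block 5 n k + n) = snd (S k))"
    for j and r :: "nat \<Rightarrow> nat" and M :: "nat \<Rightarrow> real"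
  have frame_cell: "frame j r (M(a := v))" if "frame j r M" "0 < a" "a < 5" for j r M a v
  proof -
    have "(M(a := v)) (block 5 n j + i) = M (block 5 n j + i)" for j i
      using block_ge[of 5 n j] that by auto
    moreover have "(M(a := v)) 0 = M 0" using \<open>0 < a\<close> by auto
    ultimately show ?thesis using that(1) unfolding frame_def by (simp del: fun_upd_apply)
  qed
  have frame_reg: "frame j (r(a := v)) M" if "frame j r M" "a = 7 \<or> a = 10 \<or> a = 11 \<or> a = 12" for j r M a v
    using that unfolding frame_def by auto
  \<comment> \<open>The one write that reaches the table; by \<open>block_eq_iff\<close> no other
    entry shares the cell.\<close>
  have frame_next: "frame (Suc j) (r(8 := Suc j)) (M(block 5 n j + n := al j))" if "frame j r M" "j < m" for j r M
  proof -
    let ?M = "M(block 5 n j + n := al j)"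
    have "?M (block 5 n k + i) = M (block 5 n k + i)" if "i < n" for k i
      using that block_eq_iff[of i n n 5 k j] by auto
    moreover have "?M (block 5 n k + n) = M (block 5 n k + n)" if "k \<noteq> j" for k
      using that block_eq_iff[of n n n 5 k j] by auto
    moreover have "?M (block 5 n j + n) = al j" by simp
    moreover have "?M 0 = M 0" using block_ge[of 5 n j] by auto
    ultimately show ?thesis using that unfolding frame_def
      by (auto simp del: fun_upd_apply simp: fun_upd_same fun_upd_other less_Suc_eq Suc_le_eq)
  qed
  have regs: "r 0 = n" "r 1 = m" "r 2 = 0" "r 3 = 1" "r 4 = 2" "r 5 = 3" "r 6 = 4" "r 8 = j" "M 0 = lam"
     "\<And>k i. k < m \<Longrightarrow> i < n \<Longrightarrow> M (block 5 n k + i) = X k i"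
     "\<And>k. k < j \<Longrightarrow> M (block 5 n k + n) = al k"
     "\<And>k. k < m \<Longrightarrow> j \<le> k \<Longrightarrow> M (block 5 n k + n) = snd (S k)" if "frame j r M" for j r M
    using that by (auto simp: frame_def)
  define I where "I j s \<longleftrightarrow> (case s of (r, M) \<Rightarrow> frame j r M \<and> r 7 = block 5 n j)" for j and s :: state
  define J where "J j i s \<longleftrightarrow> (case s of (r, M) \<Rightarrow> frame j r M \<and> r 7 = block 5 n j \<and> r 10 = block 5 n i \<and>
     M 1 = comb n X al i (X j))" for j i and s :: state
  define K where "K j i l s \<longleftrightarrow> (case s of (r, M) \<Rightarrow> frame j r M \<and> r 7 = block 5 n j \<and> r 10 = block 5 n i + l \<and>
     r 11 = block 5 n j + l \<and> r 12 = block 5 n i + n \<and> M 1 = comb n X al i (X j) \<and>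
     M 2 = 2 - (\<Sum>k<l. X i k * X j k))" for j i l and s :: state
  have dot: "triple u (K j i l) learner_dot_body 5 (K j i (Suc l))" if "j < m" "i < j" "l < n" for j i l
  proof (rule triple_loop_free)
    fix r :: "nat \<Rightarrow> nat" and M :: "nat \<Rightarrow> real" assume *: "K j i l (r, M)"
    then have f: "frame j r M" by (simp add: K_def)
    show "K j i (Suc l) (denote u learner_dot_body (r, M))"
      using * that regs[OF f] unfolding K_def learner_dot_body_def
      by (auto intro!: frame_cell frame_reg f simp: algebra_simps)
  qed (simp_all add: learner_dot_body_def)
  have pair_head: "triple u (J j i) learner_pair_head 4 (K j i 0)" if "j < m" "i < j" for j i
  proof (rule triple_loop_free)
    fix r :: "nat \<Rightarrow> nat" and M :: "nat \<Rightarrow> real" assume *: "J j i (r, M)"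
    then have f: "frame j r M" by (simp add: J_def)
    show "K j i 0 (denote u learner_pair_head (r, M))"
      using * that regs[OF f] unfolding J_def K_def learner_pair_head_def
      by (auto intro!: frame_cell frame_reg f)
  qed (simp_all add: learner_pair_head_def)
  have pair_tail: "triple u (K j i n) learner_pair_tail 4 (J j (Suc i))" if "j < m" "i < j" for j i
  proof (rule triple_loop_free)
    fix r :: "nat \<Rightarrow> nat" and M :: "nat \<Rightarrow> real" assume *: "K j i n (r, M)"
    then have f: "frame j r M" by (simp add: K_def)
    show "J j (Suc i) (denote u learner_pair_tail (r, M))"
      using * that regs[OF f] unfolding J_def K_def learner_pair_tail_def
      by (auto intro!: frame_cell frame_reg f simp: comb_simps ip_def block_Suc)
  qed (simp_all add: learner_pair_tail_def)
  have pair: "triple u (J j i) learner_pair (4 + ((n * Suc 5 + 1) + 4)) (J j (Suc i))" if "j < m" "i < j" for j i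
    unfolding learner_pair_def
    by (intro triple_Seq[OF pair_head] triple_Seq[OF _ pair_tail] triple_Loop[where I = "K j i"] dot that)
       (auto simp: K_def split: prod.splits)
  have row_head: "triple u (I j) learner_row_head 3 (J j 0)" if "j < m" for j
  proof (rule triple_loop_free)
    fix r :: "nat \<Rightarrow> nat" and M :: "nat \<Rightarrow> real" assume *: "I j (r, M)"
    then have f: "frame j r M" by (simp add: I_def)
    show "J j 0 (denote u learner_row_head (r, M))"
      using * that regs[OF f] unfolding I_def J_def learner_row_head_def
      by (auto intro!: frame_cell frame_reg f simp: comb_simps block_0)
  qed (simp_all add: learner_row_head_def)
  have row_tail: "triple u (J j j) learner_row_tail 7 (I (Suc j))" if "j < m" for j
  proof (rule triple_loop_free)
    fix r :: "nat \<Rightarrow> nat" and M :: "nat \<Rightarrow> real" assume *: "J j j (r, M)"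
    then have f: "frame j r M" by (simp add: J_def)
    define M' where "M' = M(1 := u (comb n X al j (X j)))"
    have "frame j (r(7 := block 5 n j + n + 1)) M'" unfolding M'_def
      by (intro frame_cell frame_reg f) auto
    from frame_next[OF this that] have g: "frame (Suc j)
       (r(7 := block 5 n j + n + 1, 8 := Suc j)) (M'(block 5 n j + n := al j))" .
    have "denote u learner_row_tail (r, M)
      = (r(7 := block 5 n j + n + 1, 8 := Suc j), M'(block 5 n j + n := al j))"
      using * that regs[OF f] block_ge[of 5 n j] unfolding J_def learner_row_tail_def
      by (auto simp: M'_def al[of j] fun_eq_iff)
    then show "I (Suc j) (denote u learner_row_tail (r, M))"
      using g unfolding I_def by (simp add: block_Suc)
  qed (simp_all add: learner_row_tail_def)
  have row: "triple u (I j) learner_row (3 + ((m * Suc (4 + ((n * Suc 5 + 1) + 4)) + 1) + 7)) (I (Suc j))"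
    if "j < m" for j
  proof -
    \<comment> \<open>The inner loop runs j rounds. Rounding j up to m gives all rows the same
      budget, as \<open>triple_Loop\<close> demands of the outer loop.\<close>
    have "triple u (J j 0) (Loop (ILess 10 7) learner_pair) (j * Suc (4 + ((n * Suc 5 + 1) + 4)) + 1) (J j j)"
      using that by (intro triple_Loop pair) (auto simp: J_def block_less_iff split: prod.splits)
    from triple_Seq[OF row_head[OF that] triple_Seq[OF this row_tail[OF that]]] show ?thesis
      unfolding learner_row_def
      by (rule triple_weaken) (use that in \<open>auto intro!: add_mono mult_mono\<close>)
  qed
  \<comment> \<open>The predictor accumulates into cells 0 and 1, so they must start at zero;
    register 0 now delimits the output.\<close>
  have finish: "triple u (I m) learner_finish 4 (\<lambda>(r, M). r 0 = block 5 n m \<and> M 0 = 0 \<and> M 1 = 0 \<and>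
       (\<forall>j<m. (\<forall>i<n. M (block 5 n j + i) = fst (S j) i) \<and> M (block 5 n j + n) = al j))"
  proof (rule triple_loop_free)
    fix r :: "nat \<Rightarrow> nat" and M :: "nat \<Rightarrow> real" assume *: "I m (r, M)"
    then have f: "frame m r M" by (simp add: I_def)
    have "(M(0 := 0, 1 := 0)) (block 5 n j + i) = M (block 5 n j + i)" for i j
      using block_ge[of 5 n j] by auto
    then show "(\<lambda>(r, M). r 0 = block 5 n m \<and> M 0 = 0 \<and> M 1 = 0 \<and>
       (\<forall>j<m. (\<forall>i<n. M (block 5 n j + i) = fst (S j) i) \<and> M (block 5 n j + n) = al j))
       (denote u learner_finish (r, M))"
      using * regs[OF f] unfolding I_def learner_finish_def X_def by simp
  qed (simp_all add: learner_finish_def)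
  have "triple u (I 0) learner_main ((m * Suc (3 + ((m * Suc (4 + ((n * Suc 5 + 1) + 4)) + 1) + 7)) + 1) + 4)
     (\<lambda>(r, M). r 0 = block 5 n m \<and> M 0 = 0 \<and> M 1 = 0 \<and>
       (\<forall>j<m. (\<forall>i<n. M (block 5 n j + i) = fst (S j) i) \<and> M (block 5 n j + n) = al j))"
    unfolding learner_main_def
    by (intro triple_Seq[OF _ finish] triple_Loop row) (auto simp: I_def frame_def split: prod.splits)
  then show ?thesis
    by (rule triple_weaken) (auto simp: I_def frame_def X_def block_0 algebra_simps)
qed

section \<open>Step size, constant hypotheses and running time\<close>

lemma halts_within_mono: "halts_within u c s T s' \<Longrightarrow> T \<le> T' \<Longrightarrow> halts_within u c s T' s'"
  unfolding halts_within_def by (meson order_trans)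

text \<open>The number of doublings from \<open>\<delta>\<close> to 1 stands in for \<open>ln (1/\<delta>)\<close>, which the machine cannot evaluate.\<close>

definition doublings :: "real \<Rightarrow> nat" where
  "doublings \<delta> = (LEAST k. 1 \<le> \<delta> * 2 ^ k)"

lemma doublings:
  assumes "0 < \<delta>"
  shows "1 \<le> \<delta> * 2 ^ doublings \<delta>" "i < doublings \<delta> \<Longrightarrow> \<delta> * 2 ^ i < 1"
proof -
  obtain k where "1 / \<delta> < 2 ^ k" using real_arch_pow[of 2 "1 / \<delta>"] by auto
  then have "1 \<le> \<delta> * 2 ^ k" using assms by (simp add: field_simps)
  then show "1 \<le> \<delta> * 2 ^ doublings \<delta>" unfolding doublings_def by (rule LeastI)
  show "\<delta> * 2 ^ i < 1" if "i < doublings \<delta>"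
    using not_less_Least[of i "\<lambda>k. 1 \<le> \<delta> * 2 ^ k"] that unfolding doublings_def by simp
qed

text \<open>The estimates 1/2 < ln 2 < 1 make the count comparable to ln (1/\<delta>). The lower
  bound justifies the step size; the upper bound limits time and sample size.\<close>

lemma doublings_bounds:
  assumes "0 < \<delta>" "\<delta> < 1"
  shows "1 \<le> doublings \<delta>" "ln (1 / \<delta>) \<le> doublings \<delta>" "doublings \<delta> \<le> 1 + 2 * ln (1 / \<delta>)"
proof -
  let ?k = "doublings \<delta>"
  show k1: "1 \<le> ?k" using doublings(1)[OF assms(1)] assms by (cases ?k) auto
  have "1 / \<delta> \<le> 2 ^ ?k" using doublings(1)[OF assms(1)] assms by (simp add: field_simps)
  then have "ln (1 / \<delta>) \<le> ln (2 ^ ?k)" using assms by (subst ln_le_cancel_iff) auto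
  also have "\<dots> = ?k * ln 2" by (simp add: ln_realpow)
  also have "\<dots> \<le> real ?k * 1" using ln_2_less_1 by (intro mult_left_mono) auto
  finally show "ln (1 / \<delta>) \<le> ?k" by simp
  have "2 ^ (?k - 1) \<le> 1 / \<delta>"
    using doublings(2)[OF assms(1), of "?k - 1"] k1 assms by (simp add: field_simps)
  then have "ln (2 ^ (?k - 1)) \<le> ln (1 / \<delta>)" using assms by (subst ln_le_cancel_iff) auto
  then have "real (?k - 1) * ln 2 \<le> ln (1 / \<delta>)" by (simp add: ln_realpow)
  moreover have "real (?k - 1) * (1 / 2) \<le> real (?k - 1) * ln 2"
    using ln2_ge_two_thirds by (intro mult_left_mono) auto
  ultimately show "?k \<le> 1 + 2 * ln (1 / \<delta>)" using k1 by (simp add: of_nat_diff)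
qed

text \<open>Chosen so that lam * (2 * ln (1/\<delta>) + 1) \<le> \<epsilon> / (2 * L). The quotients
  are nested in the order in which the machine divides.\<close>

definition step_size :: "real \<Rightarrow> real \<Rightarrow> real \<Rightarrow> real" where
  "step_size \<epsilon> \<delta> L = \<epsilon> / L / real (doublings \<delta>) / 6"

definition learner_rate :: com where
  "learner_rate = Seq (seq [RConst 5 1, RConst 6 0])
     (Seq (Loop (RLess 3 5) (seq [RArith Plus 3 3 3, RArith Plus 6 6 5]))
       (seq [RArith Divide 2 2 4, RArith Divide 2 2 6, RConst 3 6, RArith Divide 2 2 3, IConst 7 5]))"

definition learner_main_pre :: "nat \<Rightarrow> nat \<Rightarrow> sample \<Rightarrow> nat \<Rightarrow> (nat \<Rightarrow> nat) \<Rightarrow> (nat \<Rightarrow> real) \<Rightarrow> bool" where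
  "learner_main_pre n m S p r M \<longleftrightarrow> r 0 = n \<and> r 1 = m \<and> r 2 = 0 \<and> r 3 = 1 \<and> r 4 = 2 \<and> r 5 = 3 \<and> r 6 = 4
     \<and> r 7 = p \<and> r 8 = 0 \<and>
     (\<forall>j<m. (\<forall>i<n. M (block 5 n j + i) = fst (S j) i) \<and> M (block 5 n j + n) = snd (S j))"

lemma learner_main_pre_cell:
  assumes "learner_main_pre n m S p r M" "a < 5"
  shows "learner_main_pre n m S p r (M(a := v))"
proof -
  have "(M(a := v)) (block 5 n j + i) = M (block 5 n j + i)" for j i
    using block_ge[of 5 n j] assms by auto
  then show ?thesis using assms(1) unfolding learner_main_pre_def by (simp del: fun_upd_apply)
qed

text \<open>The guard compares \<delta> * 2 ^ i with 1, so by minimality of \<open>doublings\<close>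
  it first fails after exactly that many rounds.\<close>

lemma learner_rate_spec:
  assumes "0 < \<delta>"
  shows "triple u (\<lambda>(r, M). learner_main_pre n m S 0 r M \<and> M 0 = \<epsilon> \<and> M 1 = \<delta> \<and> M 2 = L)
    learner_rate (4 * doublings \<delta> + 10)
    (\<lambda>(r, M). learner_main_pre n m S 5 r M \<and> M 0 = step_size \<epsilon> \<delta> L)"
proof -
  define I where "I i s \<longleftrightarrow> (case s of (r, M) \<Rightarrow> learner_main_pre n m S 0 r M \<and> M 0 = \<epsilon> \<and> M 1 = \<delta> * 2 ^ i \<and>
     M 2 = L \<and> M 3 = 1 \<and> M 4 = real i)" for i and s :: state
  have regs: "r 2 = 0" "r 3 = 1" "r 4 = 2" "r 5 = 3" "r 6 = 4"
    if "learner_main_pre n m S p r M" for p r M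
    using that by (auto simp: learner_main_pre_def)
  have init: "triple u (\<lambda>(r, M). learner_main_pre n m S 0 r M \<and> M 0 = \<epsilon> \<and> M 1 = \<delta> \<and> M 2 = L)
     (seq [RConst 5 1, RConst 6 0]) 3 (I 0)"
    by (rule triple_loop_free) (auto simp: I_def regs intro!: learner_main_pre_cell)
  have body: "triple u (I i) (seq [RArith Plus 3 3 3, RArith Plus 6 6 5]) 3 (I (Suc i))" for i
  proof (rule triple_loop_free)
    fix r :: "nat \<Rightarrow> nat" and M :: "nat \<Rightarrow> real" assume *: "I i (r, M)"
    then have f: "learner_main_pre n m S 0 r M" by (simp add: I_def)
    show "I (Suc i) (denote u (seq [RArith Plus 3 3 3, RArith Plus 6 6 5]) (r, M))"
      using * regs[OF f] by (simp add: I_def learner_main_pre_cell)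
  qed simp_all
  have pre_reg: "learner_main_pre n m S 5 (r(7 := 5)) M" if "learner_main_pre n m S 0 r M" for r M
    using that by (auto simp: learner_main_pre_def)
  have finish: "triple u (I (doublings \<delta>))
     (seq [RArith Divide 2 2 4, RArith Divide 2 2 6, RConst 3 6, RArith Divide 2 2 3, IConst 7 5]) 6
     (\<lambda>(r, M). learner_main_pre n m S 5 r M \<and> M 0 = step_size \<epsilon> \<delta> L)"
  proof (rule triple_loop_free)
    fix r :: "nat \<Rightarrow> nat" and M :: "nat \<Rightarrow> real" assume *: "I (doublings \<delta>) (r, M)"
    then have f: "learner_main_pre n m S 0 r M" by (simp add: I_def)
    show "case denote u (seq [RArith Divide 2 2 4, RArith Divide 2 2 6, RConst 3 6, RArith Divide 2 2 3, IConst 7 5])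
        (r, M) of (r, M) \<Rightarrow> learner_main_pre n m S 5 r M \<and> M 0 = step_size \<epsilon> \<delta> L"
      using * regs[OF f] by (simp add: I_def learner_main_pre_cell pre_reg step_size_def)
  qed simp_all
  have "triple u (\<lambda>(r, M). learner_main_pre n m S 0 r M \<and> M 0 = \<epsilon> \<and> M 1 = \<delta> \<and> M 2 = L)
     learner_rate (3 + ((doublings \<delta> * Suc 3 + 1) + 6))
     (\<lambda>(r, M). learner_main_pre n m S 5 r M \<and> M 0 = step_size \<epsilon> \<delta> L)"
    unfolding learner_rate_def
  proof (intro triple_Seq[OF init] triple_Seq[OF _ finish] triple_Loop body)
    fix i s assume "i \<le> doublings \<delta>" "I i s"
    then show "holds (RLess 3 5) s \<longleftrightarrow> i < doublings \<delta>"
      using doublings(1)[OF assms] doublings(2)[OF assms, of i]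
      by (cases s; cases "i = doublings \<delta>") (auto simp: I_def learner_main_pre_def)
  qed
  then show ?thesis by (simp add: algebra_simps)
qed

text \<open>
  Two cases need no sample. The constant \<open>1/2\<close> has squared error at most \<open>1/4\<close>, and \<open>u 0\<close> has squared
  error at most \<open>(LA)\<^sup>2\<close>. Otherwise \<open>LA/\<epsilon> > 2\<close>, and powers of \<open>LA/\<epsilon>\<close> absorb all constants.
\<close>

definition hypothesis :: "nat \<Rightarrow> (real \<Rightarrow> real) \<Rightarrow> real \<Rightarrow> real \<Rightarrow> real \<Rightarrow> real \<Rightarrow> nat \<Rightarrow> sample \<Rightarrow> point \<Rightarrow> real" where
  "hypothesis n u \<epsilon> \<delta> L A m S x =
    (if 1 / 4 \<le> \<epsilon> then 1 / 2 else if (L * A)\<^sup>2 \<le> \<epsilon> then u 0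
     else (\<Sum>j<m. u (glm n u (step_size \<epsilon> \<delta> L) S j x)) / real m)"

definition learner_half :: com where
  "learner_half = seq [RConst 2 (1 / 2), RConst 3 1, IConst 0 5]"

definition learner_zero :: com where
  "learner_zero = seq [RConst 2 0, Oracle 2 2, RConst 3 1, IConst 0 5]"

definition learner_init :: com where
  "learner_init = seq [IConst 3 1, IConst 4 2, IConst 5 3, IConst 6 4, RConst 6 (1 / 4)]"

definition learner_square :: com where
  "learner_square = seq [RArith Times 6 4 5, RArith Times 6 6 6]"

definition learner_prog :: com where
  "learner_prog = Seq learner_init (Cond (RLess 2 6)
     (Seq learner_square (Cond (RLess 2 6) (Seq learner_rate learner_main) learner_zero))
     learner_half)"

text \<open>Covers both kinds of output: a constant has k = 0, its value as the sum and 1 as the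
  count; the mean has k = m and starts from zero sum and zero count.\<close>

definition represents :: "(real \<Rightarrow> real) \<Rightarrow> nat \<Rightarrow> nat \<Rightarrow> (point \<Rightarrow> real) \<Rightarrow> state \<Rightarrow> bool" where
  "represents u n m h s \<longleftrightarrow> (\<exists>k\<le>m. \<exists>X al. fst s 0 = block 5 n k \<and>
     (\<forall>j<k. (\<forall>i<n. snd s (block 5 n j + i) = X j i) \<and> snd s (block 5 n j + n) = al j) \<and>
     h = (\<lambda>x. (snd s 0 + (\<Sum>j<k. u (comb n X al j x))) / (snd s 1 + real k)))"

lemma predictor_represents:
  assumes "represents u n m h s"
  shows "\<exists>s'. halts_within u predictor_prog (predictor_input (learner_output s) n x) (11 + m * (14 + 6 * n)) s' \<and>
    h x = predictor_output s'"
proof -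
  obtain k X al where k: "k \<le> m" and s: "fst s 0 = block 5 n k"
    "\<And>j i. j < k \<Longrightarrow> i < n \<Longrightarrow> snd s (block 5 n j + i) = X j i"
    "\<And>j. j < k \<Longrightarrow> snd s (block 5 n j + n) = al j"
    and h: "h = (\<lambda>x. (snd s 0 + (\<Sum>j<k. u (comb n X al j x))) / (snd s 1 + real k))"
    using assms unfolding represents_def by blast
  have nth: "learner_output s ! a = snd s a" if "a < block 5 n k" for a
    using that s(1) by (simp add: learner_output_def)
  have ge: "5 \<le> block 5 n k" by (rule block_ge)
  have lt: "block 5 n j + i < block 5 n k" if "j < k" "i \<le> n" for j i
    using block_less that by blast
  obtain s' where s': "halts_within u predictor_prog (predictor_input (learner_output s) n x)
      (11 + k * (14 + 6 * n)) s'"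
    "predictor_output s' = (snd s 0 + (\<Sum>j<k. u (comb n X al j x))) / (snd s 1 + real k)"
    using predictor_spec[of "learner_output s" n k "snd s 0" "snd s 1" X al u x] s nth ge lt
    by (force simp: learner_output_def)
  have "11 + k * (14 + 6 * n) \<le> 11 + m * (14 + 6 * n)" using k by simp
  from halts_within_mono[OF s'(1) this] s'(2) show ?thesis
    by (intro exI[of _ s']) (simp add: h)
qed

text \<open>Only the branch that computes the step size is charged for the doublings. In the
  constant branches m may be far below ln (1/\<delta>), and such a cost could not be bounded in m
  and n.\<close>

lemma learner_represents:
  assumes "0 < \<delta>"
  shows "\<exists>s. halts_within u learner_prog (learner_input [\<epsilon>, \<delta>, L, A, \<rho>] n m S)
      (26 + (if \<epsilon> < 1 / 4 \<and> \<epsilon> < (L * A)\<^sup>2 then 4 * doublings \<delta> else 0) + m * (12 + m * (10 + 6 * n))) s \<and>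
    represents u n m (hypothesis n u \<epsilon> \<delta> L A m S) s"
proof -
  let ?d = "if \<epsilon> < 1 / 4 \<and> \<epsilon> < (L * A)\<^sup>2 then 4 * doublings \<delta> else 0"
  let ?t = "m * (12 + m * (10 + 6 * n))"
  let ?R = "represents u n m (hypothesis n u \<epsilon> \<delta> L A m S)"
  define P where "P v s \<longleftrightarrow> (case s of (r, M) \<Rightarrow> learner_main_pre n m S 0 r M \<and> M 0 = \<epsilon> \<and> M 1 = \<delta> \<and> M 2 = L \<and> M 3 = A \<and> M 4 = v)"
    for v and s :: state
  have regs: "r 2 = 0" "r 3 = 1" "r 4 = 2" "r 5 = 3" "r 6 = 4"
    if "learner_main_pre n m S p r M" for p r M
    using that by (auto simp: learner_main_pre_def)
  have init: "triple u ((=) (learner_input [\<epsilon>, \<delta>, L, A, \<rho>] n m S)) learner_init 6 (P (1 / 4))"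
  proof (rule triple_loop_free)
    fix r :: "nat \<Rightarrow> nat" and M :: "nat \<Rightarrow> real"
    let ?f = "\<lambda>j. map (fst (S j)) [0..<n] @ [snd (S j)]"
    let ?c = "concat (map ?f [0..<m])"
    assume "learner_input [\<epsilon>, \<delta>, L, A, \<rho>] n m S = (r, M)"
    then have r: "r = (\<lambda>_. 0)(0 := n, 1 := m)" and M: "M = memory ([\<epsilon>, \<delta>, L, A, \<rho>] @ ?c)"
      by (simp_all add: learner_input_def)
    have len: "length ?c = m * Suc n" by (induction m) simp_all
    have MS: "M (block 5 n j + i) = ?f j ! i" if "j < m" "i \<le> n" for j i
    proof -
      have a: "block 5 n j + i = 5 + (j * Suc n + i)" by (simp add: block_def)
      have "block 5 n j + i < 5 + m * Suc n" using block_less[OF that, of 5] by (simp add: block_def)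
      then have "M (block 5 n j + i) = ([\<epsilon>, \<delta>, L, A, \<rho>] @ ?c) ! (5 + (j * Suc n + i))"
        unfolding M memory_def a using len by simp
      also have "\<dots> = ?c ! (j * Suc n + i)" by (simp add: nth_append add.assoc)
      also have "\<dots> = ?f j ! i" using that by (intro nth_concat_uniform) auto
      finally show ?thesis .
    qed
    have pre: "learner_main_pre n m S 0 (r(3 := 1, 4 := 2, 5 := 3, 6 := 4)) M"
      unfolding learner_main_pre_def using MS by (auto simp: r nth_append)
    have "M 0 = \<epsilon>" "M 1 = \<delta>" "M 2 = L" "M 3 = A" by (simp_all add: M memory_def)
    then show "P (1 / 4) (denote u learner_init (r, M))"
      using learner_main_pre_cell[OF pre, of 4 "1 / 4"]
      by (simp add: P_def learner_init_def of_rat_divide)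
  qed (simp_all add: learner_init_def)
  have square: "triple u (\<lambda>s. P (1 / 4) s \<and> holds (RLess 2 6) s) learner_square 3 (\<lambda>s. P ((L * A)\<^sup>2) s \<and> \<epsilon> < 1 / 4)"
  proof (rule triple_loop_free)
    fix r :: "nat \<Rightarrow> nat" and M :: "nat \<Rightarrow> real"
    assume *: "P (1 / 4) (r, M) \<and> holds (RLess 2 6) (r, M)"
    then have f: "learner_main_pre n m S 0 r M" by (simp add: P_def)
    show "P ((L * A)\<^sup>2) (denote u learner_square (r, M)) \<and> \<epsilon> < 1 / 4"
      using * regs[OF f] by (simp add: P_def learner_square_def power2_eq_square learner_main_pre_cell)
  qed (simp_all add: learner_square_def)
  have half: "triple u (\<lambda>s. P (1 / 4) s \<and> \<not> holds (RLess 2 6) s) learner_half (18 + ?d + ?t) ?R"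
  proof (rule triple_loop_free)
    fix r :: "nat \<Rightarrow> nat" and M :: "nat \<Rightarrow> real"
    assume *: "P (1 / 4) (r, M) \<and> \<not> holds (RLess 2 6) (r, M)"
    then have f: "learner_main_pre n m S 0 r M" by (simp add: P_def)
    from * have "1 / 4 \<le> \<epsilon>" using regs[OF f] by (simp add: P_def)
    then show "?R (denote u learner_half (r, M))"
      using * regs[OF f] unfolding represents_def
      by (intro exI[of _ 0]) (simp add: P_def learner_half_def hypothesis_def block_0 of_rat_divide fun_eq_iff)
  qed (simp_all add: learner_half_def)
  have zero: "triple u (\<lambda>s. (P ((L * A)\<^sup>2) s \<and> \<epsilon> < 1 / 4) \<and> \<not> holds (RLess 2 6) s) learner_zero (14 + ?d + ?t) ?R"
  proof (rule triple_loop_free)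
    fix r :: "nat \<Rightarrow> nat" and M :: "nat \<Rightarrow> real"
    assume *: "(P ((L * A)\<^sup>2) (r, M) \<and> \<epsilon> < 1 / 4) \<and> \<not> holds (RLess 2 6) (r, M)"
    then have f: "learner_main_pre n m S 0 r M" by (simp add: P_def)
    from * have "(L * A)\<^sup>2 \<le> \<epsilon>" using regs[OF f] by (simp add: P_def)
    then show "?R (denote u learner_zero (r, M))"
      using * regs[OF f] unfolding represents_def
      by (intro exI[of _ 0]) (simp add: P_def learner_zero_def hypothesis_def block_0 fun_eq_iff)
  qed (simp_all add: learner_zero_def)
  have main: "triple u (\<lambda>s. (P ((L * A)\<^sup>2) s \<and> \<epsilon> < 1 / 4) \<and> holds (RLess 2 6) s)
     (Seq learner_rate learner_main) (15 + ?d + ?t) ?R"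
  proof (cases "\<epsilon> < 1 / 4 \<and> \<epsilon> < (L * A)\<^sup>2")
    case True
    have "triple u (\<lambda>(r, M). learner_main_pre n m S 0 r M \<and> M 0 = \<epsilon> \<and> M 1 = \<delta> \<and> M 2 = L)
      (Seq learner_rate learner_main) ((4 * doublings \<delta> + 10) + (?t + 5))
      (\<lambda>(r, M). r 0 = block 5 n m \<and> M 0 = 0 \<and> M 1 = 0 \<and>
       (\<forall>j<m. (\<forall>i<n. M (block 5 n j + i) = fst (S j) i) \<and>
         M (block 5 n j + n) = glm_coef n u (step_size \<epsilon> \<delta> L) S j))"
      by (rule triple_Seq[OF learner_rate_spec[OF assms, of u n m S \<epsilon> L]
            triple_weaken[OF learner_main_spec[of u n m "step_size \<epsilon> \<delta> L" S]]])
         (auto simp: learner_main_pre_def)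
    then show ?thesis
    proof (rule triple_weaken)
      fix s :: state assume "case s of (r, M) \<Rightarrow> r 0 = block 5 n m \<and> M 0 = 0 \<and> M 1 = 0 \<and>
         (\<forall>j<m. (\<forall>i<n. M (block 5 n j + i) = fst (S j) i) \<and>
           M (block 5 n j + n) = glm_coef n u (step_size \<epsilon> \<delta> L) S j)"
      then show "?R s" using True unfolding represents_def
        by (intro exI[of _ m] conjI exI[of _ "\<lambda>j. fst (S j)"] exI[of _ "glm_coef n u (step_size \<epsilon> \<delta> L) S"])
           (auto simp: comb_glm_coef hypothesis_def fun_eq_iff split: prod.splits)
    qed (use True in \<open>auto simp: P_def\<close>)
  next
    case False
    \<comment> \<open>Vacuous: the precondition contradicts the case. The split is made because the
      budget \<open>?d\<close> depends on it.\<close>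
    then show ?thesis by (auto simp: triple_def P_def learner_main_pre_def)
  qed
  have "triple u ((=) (learner_input [\<epsilon>, \<delta>, L, A, \<rho>] n m S)) learner_prog (6 + Suc (3 + Suc (15 + ?d + ?t))) ?R"
    unfolding learner_prog_def
  proof (intro triple_Seq[OF init] triple_Cond triple_Seq[OF square] main)
    show "triple u (\<lambda>s. (P ((L * A)\<^sup>2) s \<and> \<epsilon> < 1 / 4) \<and> \<not> holds (RLess 2 6) s) learner_zero (15 + ?d + ?t) ?R"
      by (rule triple_weaken[OF zero]) auto
    show "triple u (\<lambda>s. P (1 / 4) s \<and> \<not> holds (RLess 2 6) s) learner_half (3 + Suc (15 + ?d + ?t)) ?R"
      by (rule triple_weaken[OF half]) auto
  qed
  then show ?thesis unfolding triple_def by (simp add: algebra_simps)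
qed

text \<open>Apart from the doublings, the step counts are sums of monomials of degree at most 3 in m
  and n, and 1 \<le> n absorbs the constants. The last premise lets m pay for the doublings.\<close>

lemma outputs_hypothesis:
  assumes "0 < \<delta>" "1 \<le> n" "\<epsilon> < 1 / 4 \<Longrightarrow> \<epsilon> < (L * A)\<^sup>2 \<Longrightarrow> doublings \<delta> \<le> 1 + 2 * m"
  shows "outputs_hypothesis u learner_prog predictor_prog (100 * (m + n) ^ 3) n [\<epsilon>, \<delta>, L, A, \<rho>] m S
    (hypothesis n u \<epsilon> \<delta> L A m S)"
proof -
  let ?N = "m + n"
  have p: "?N \<le> ?N ^ 3" "?N ^ 2 \<le> ?N ^ 3" "1 \<le> ?N ^ 3"
    using assms(2) by (simp_all add: self_le_power power_increasing)
  have m: "m \<le> ?N ^ 3" using p(1) by simp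
  have mm: "m * m \<le> ?N ^ 3" using mult_mono[of m ?N m ?N] p(2) by (simp add: power2_eq_square)
  have mn: "m * n \<le> ?N ^ 3" using mult_mono[of m ?N n ?N] p(2) by (simp add: power2_eq_square)
  have mmn: "m * m * n \<le> ?N ^ 3"
    using mult_mono[OF mult_mono[of m ?N m ?N], of n ?N] by (simp add: power3_eq_cube)
  have "11 + m * (14 + 6 * n) = 11 + 14 * m + 6 * (m * n)" by (simp add: algebra_simps)
  also have "\<dots> \<le> 100 * ?N ^ 3" using p m mn by linarith
  finally have T1: "11 + m * (14 + 6 * n) \<le> 100 * ?N ^ 3" .
  let ?d = "if \<epsilon> < 1 / 4 \<and> \<epsilon> < (L * A)\<^sup>2 then 4 * doublings \<delta> else 0"
  have "?d \<le> 4 + 8 * m" using assms(3) by auto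
  moreover have "m * (12 + m * (10 + 6 * n)) = 12 * m + 10 * (m * m) + 6 * (m * m * n)"
    by (simp add: algebra_simps)
  ultimately have T2: "26 + ?d + m * (12 + m * (10 + 6 * n)) \<le> 100 * ?N ^ 3"
    using p m mm mmn by linarith
  obtain s where s: "halts_within u learner_prog (learner_input [\<epsilon>, \<delta>, L, A, \<rho>] n m S) (26 + ?d + m * (12 + m * (10 + 6 * n))) s"
    "represents u n m (hypothesis n u \<epsilon> \<delta> L A m S) s"
    using learner_represents[OF assms(1)] by blast
  show ?thesis unfolding outputs_hypothesis_def
    using halts_within_mono[OF s(1) T2] predictor_represents[OF s(2)] halts_within_mono[OF _ T1] by blast
qed

section \<open>The descent argument\<close>

text \<open>The squared kernel-space distance between the expansion and f, with the squared norm of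
  f replaced by its bound. The inner product with f is evaluated by the reproducing
  property.\<close>

definition potential :: "nat \<Rightarrow> (point \<Rightarrow> real) \<Rightarrow> real \<Rightarrow> nat \<Rightarrow> (nat \<Rightarrow> real) \<Rightarrow> (nat \<Rightarrow> point) \<Rightarrow> real" where
  "potential n f B J c X = gram J c (\<lambda>i j. ker n (X i) (X j)) - 2 * (\<Sum>i<J. c i * f (X i)) + B\<^sup>2"

text \<open>Bounding the linear part by \<open>rkhs_bound\<close> leaves (sqrt Q - B)^2, where Q is
  the Gram form.\<close>

lemma potential_nonneg:
  assumes "rkhs_bound n f B" "\<And>i. i < J \<Longrightarrow> X i \<in> unit_sphere n"
  shows "0 \<le> potential n f B J c X"
proof -
  let ?Q = "gram J c (\<lambda>i j. ker n (X i) (X j))"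
  have Q: "0 \<le> ?Q" using assms(2) by (rule gram_ker_nonneg)
  have "(\<Sum>i<J. c i * f (X i)) \<le> B * sqrt ?Q"
    using assms unfolding rkhs_bound_def by (meson abs_le_D1)
  moreover have "0 \<le> (sqrt ?Q - B)\<^sup>2" by simp
  ultimately show ?thesis unfolding potential_def using Q by (simp add: power2_diff mult_ac)
qed

text \<open>The cross term is the reproducing property: the new kernel function paired with the old
  difference gives its value at \<open>X J\<close>.\<close>

lemma potential_Suc:
  "potential n f B (Suc J) c X = potential n f B J c X
     + 2 * c J * ((\<Sum>i<J. c i * ker n (X i) (X J)) - f (X J)) + (c J)\<^sup>2 * ker n (X J) (X J)"
  unfolding potential_def
  by (subst gram_Suc) (simp_all add: ker_commute algebra_simps)

lemma potential_cong:
  assumes "\<And>i. i < J \<Longrightarrow> c i = d i" "\<And>i. i < J \<Longrightarrow> X i = Y i"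
  shows "potential n f B J c X = potential n f B J d Y"
proof -
  have "gram J c (\<lambda>i j. ker n (X i) (X j)) = gram J d (\<lambda>i j. ker n (Y i) (Y j))"
    using assms by (intro gram_cong) auto
  moreover have "(\<Sum>i<J. c i * f (X i)) = (\<Sum>i<J. d i * f (Y i))"
    using assms by (intro sum.cong) auto
  ultimately show ?thesis by (simp add: potential_def)
qed

text \<open>Point evaluation has norm 1 because ker n x x = 1. The discriminant argument again:
  adjoin x with the minimizing coefficient and use nonnegativity.\<close>

lemma square_le_potential:
  assumes "rkhs_bound n f B" "\<And>i. i < J \<Longrightarrow> X i \<in> unit_sphere n" "x \<in> unit_sphere n"
  shows "((\<Sum>i<J. c i * ker n (X i) x) - f x)\<^sup>2 \<le> potential n f B J c X"
proof -
  define s where "s = (\<Sum>i<J. c i * ker n (X i) x) - f x"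
  let ?c = "c(J := - s)" and ?X = "X(J := x)"
  have "0 \<le> potential n f B (Suc J) ?c ?X"
    using assms by (intro potential_nonneg) (auto simp: less_Suc_eq)
  also have "\<dots> = potential n f B J ?c ?X
     + 2 * ?c J * ((\<Sum>i<J. ?c i * ker n (?X i) (?X J)) - f (?X J)) + (?c J)\<^sup>2 * ker n (?X J) (?X J)"
    by (rule potential_Suc)
  also have "potential n f B J ?c ?X = potential n f B J c X" by (rule potential_cong) auto
  also have "(\<Sum>i<J. ?c i * ker n (?X i) (?X J)) = (\<Sum>i<J. c i * ker n (X i) x)" by (intro sum.cong) auto
  finally show ?thesis using assms(3) by (simp add: ker_self power2_eq_square flip: s_def)
qed

lemma glm_eq_sum: "glm n u lam S j x = (\<Sum>i<j. glm_coef n u lam S i * ker n (fst (S i)) x)"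
  by (induction j) (simp_all add: glm_coef_def)

text \<open>Adaptedness: iterate j is determined by the examples before j, so it is fixed when
  example j is integrated out.\<close>

lemma glm_cong: "(\<And>i. i < j \<Longrightarrow> S i = S' i) \<Longrightarrow> glm n u lam S j = glm n u lam S' j"
  by (induction j) simp_all

lemma glm_coef_cong: "(\<And>i. i \<le> j \<Longrightarrow> S i = S' i) \<Longrightarrow> glm_coef n u lam S j = glm_coef n u lam S' j"
  using glm_cong[of j S S'] by (simp add: glm_coef_def)

definition glm_pot :: "nat \<Rightarrow> (real \<Rightarrow> real) \<Rightarrow> real \<Rightarrow> (point \<Rightarrow> real) \<Rightarrow> real \<Rightarrow> sample \<Rightarrow> nat \<Rightarrow> real" where
  "glm_pot n u lam f B S j = potential n f B j (glm_coef n u lam S) (\<lambda>i. fst (S i))"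

lemma glm_pot_0: "glm_pot n u lam f B S 0 = B\<^sup>2"
  by (simp add: glm_pot_def potential_def gram_def)

lemma glm_pot_Suc:
  assumes "fst (S j) \<in> unit_sphere n"
  shows "glm_pot n u lam f B S (Suc j) = glm_pot n u lam f B S j
     + 2 * glm_coef n u lam S j * (glm n u lam S j (fst (S j)) - f (fst (S j))) + (glm_coef n u lam S j)\<^sup>2"
  unfolding glm_pot_def potential_Suc glm_eq_sum[symmetric] using ker_self[OF assms] by simp

lemma glm_pot_cong: "(\<And>i. i < j \<Longrightarrow> S i = S' i) \<Longrightarrow> glm_pot n u lam f B S j = glm_pot n u lam f B S' j"
  unfolding glm_pot_def by (intro potential_cong glm_coef_cong) auto

section \<open>Measurability on the sphere and under the data distribution\<close>

lemma space_sphere_space: "space (sphere_space n) = unit_sphere n"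
  unfolding sphere_space_def
  by (auto simp: space_restrict_space space_PiM unit_sphere_def)

lemma measurable_sphere_coordinate: "j < n \<Longrightarrow> (\<lambda>x. x j) \<in> borel_measurable (sphere_space n)"
  unfolding sphere_space_def
  by (intro measurable_restrict_space1 measurable_component_singleton) auto

lemma measurable_ip [measurable]:
  assumes "x \<in> measurable N (sphere_space n)" "z \<in> measurable N (sphere_space n)"
  shows "(\<lambda>\<omega>. ip n (x \<omega>) (z \<omega>)) \<in> borel_measurable N"
  unfolding ip_def
  by (intro borel_measurable_sum borel_measurable_times measurable_compose[OF assms(1)]
      measurable_compose[OF assms(2)] measurable_sphere_coordinate) auto

lemma measurable_ker [measurable]:
  assumes "x \<in> measurable N (sphere_space n)" "z \<in> measurable N (sphere_space n)"
  shows "(\<lambda>\<omega>. ker n (x \<omega>) (z \<omega>)) \<in> borel_measurable N"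
  unfolding ker_def using assms by measurable

lemma measurable_ip_const:
  "(\<lambda>x. ip n w x) \<in> borel_measurable (sphere_space n)"
  unfolding ip_def
  by (intro borel_measurable_sum borel_measurable_times measurable_sphere_coordinate) auto

text \<open>Nothing is known about f outside [-1, 1]; on the sphere the composition is a pointwise
  limit of polynomials in ip.\<close>

lemma wiener_bound_measurable:
  assumes "wiener_bound f M" "w \<in> unit_sphere n"
  shows "(\<lambda>x. f (ip n w x)) \<in> borel_measurable (sphere_space n)"
proof -
  obtain b where b: "\<And>s. \<bar>s\<bar> \<le> 1 \<Longrightarrow> (\<lambda>k. b k * s ^ k) sums f s"
    using assms unfolding wiener_bound_def by blast
  show ?thesis
  proof (rule borel_measurable_LIMSEQ_real)
    fix x assume "x \<in> space (sphere_space n)"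
    then show "(\<lambda>N. \<Sum>k<N. b k * (ip n w x) ^ k) \<longlonglongrightarrow> f (ip n w x)"
      using b abs_ip_le_1 assms by (simp add: sums_def space_sphere_space)
  qed (use measurable_ip_const in measurable)
qed

locale labelled_distribution = prob_space D for D :: "(point \<times> real) measure" +
  fixes n :: nat
  assumes sets_D: "sets D = sets (labelled_space n)"
begin

lemma space_D: "space D = unit_sphere n \<times> {0..1}"
  using sets_eq_imp_space_eq[OF sets_D]
  by (simp add: labelled_space_def space_pair_measure space_sphere_space space_restrict_space)

lemma measurable_fst_D [measurable]: "fst \<in> measurable D (sphere_space n)"
  unfolding measurable_cong_sets[OF sets_D refl] labelled_space_def by measurable

lemma measurable_snd_D [measurable]: "snd \<in> borel_measurable D"
  unfolding measurable_cong_sets[OF sets_D refl] labelled_space_def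
  by (rule measurable_compose[OF measurable_snd]) (simp add: measurable_restrict_space1)

lemma in_space_D: "z \<in> space D \<Longrightarrow> fst z \<in> unit_sphere n \<and> 0 \<le> snd z \<and> snd z \<le> 1"
  by (auto simp: space_D)

lemma bounded_integrable:
  fixes f :: "point \<times> real \<Rightarrow> real"
  assumes "f \<in> borel_measurable D" "\<And>z. z \<in> space D \<Longrightarrow> \<bar>f z\<bar> \<le> K"
  shows "integrable D f"
  by (rule integrable_const_bound[where B = K]) (use assms in auto)

lemma cond_exp_label_integral:
  assumes "g \<in> borel_measurable (sphere_space n)" "\<And>x. x \<in> unit_sphere n \<Longrightarrow> \<bar>g x\<bar> \<le> K"
  shows "(\<integral>z. g (fst z) * cond_exp_label n D z \<partial>D) = (\<integral>z. g (fst z) * snd z \<partial>D)"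
proof -
  let ?F = "vimage_algebra (space D) fst (sphere_space n)"
  have sub: "subalgebra D ?F"
    unfolding subalgebra_def
  proof (intro conjI)
    show "sets ?F \<subseteq> sets D"
      unfolding sets_vimage_algebra2[of fst "space D" "sphere_space n"]
      by (subst sets_vimage_algebra2)
         (use measurable_space[OF measurable_fst_D] measurable_sets[OF measurable_fst_D] in auto)
  qed simp
  interpret finite_measure_subalgebra D ?F by unfold_locales (rule sub)
  have fst: "fst \<in> measurable ?F (sphere_space n)"
    by (rule measurable_vimage_algebra1) (use measurable_space[OF measurable_fst_D] in auto)
  have int: "integrable D (\<lambda>z. g (fst z) * snd z)"
  proof (rule bounded_integrable)
    show "(\<lambda>z. g (fst z) * snd z) \<in> borel_measurable D"
      using measurable_compose[OF measurable_fst_D assms(1)] by measurable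
    fix z assume "z \<in> space D"
    then have z: "fst z \<in> unit_sphere n" "0 \<le> snd z" "snd z \<le> 1" using in_space_D by auto
    show "\<bar>g (fst z) * snd z\<bar> \<le> K"
      using mult_mono[OF assms(2)[OF z(1)] z(3)] z assms(2)[OF z(1)] by (simp add: abs_mult)
  qed
  show ?thesis unfolding cond_exp_label_def
    by (rule real_cond_exp_intg(2)[OF int measurable_compose[OF fst assms(1)] measurable_snd_D])
qed

end

text \<open>F is the true argument of the link function and f a comparator of kernel norm at most B
  that is almost surely within \<open>\<xi>\<close> of F. The halfspaces enter only through an
  interpretation of this locale.\<close>

locale single_index = labelled_distribution D n for D n +
  fixes u :: "real \<Rightarrow> real" and L \<xi> B lam :: real and F f :: "point \<Rightarrow> real"
  assumes range_u: "range u \<subseteq> {0..1}" and lipschitz_u: "L-lipschitz_on UNIV u" and mono_u: "mono u"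
    and L_pos: "0 < L" and lam_pos: "0 < lam" and xi_nonneg: "0 \<le> \<xi>"
    and measurable_F: "F \<in> borel_measurable (sphere_space n)"
    and measurable_f: "f \<in> borel_measurable (sphere_space n)"
    and regression: "AE z in D. cond_exp_label n D z = u (F (fst z))"
    and rkhs: "rkhs_bound n f B"
    and approx: "AE z in D. \<bar>f (fst z) - F (fst z)\<bar> \<le> \<xi>"
begin

lemma u_bounds: "0 \<le> u s" "u s \<le> 1"
  using subsetD[OF range_u rangeI[of u s]] by auto

lemma u_diff_bound: "\<bar>u s - u t\<bar> \<le> 1" and label_diff_bound: "0 \<le> y \<Longrightarrow> y \<le> 1 \<Longrightarrow> \<bar>y - u t\<bar> \<le> 1"
  using u_bounds[of s] u_bounds[of t] by auto

lemma measurable_u [measurable]: "u \<in> borel_measurable borel"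
  using lipschitz_on_continuous_on[OF lipschitz_u] by (rule borel_measurable_continuous_onI)

lemma measurable_F' [measurable]: "(\<lambda>z. F (fst z)) \<in> borel_measurable D"
  by (rule measurable_compose[OF measurable_fst_D measurable_F])

definition err :: "(point \<Rightarrow> real) \<Rightarrow> real" where
  "err g = (\<integral>z. (u (g (fst z)) - u (F (fst z)))\<^sup>2 \<partial>D)"

text \<open>Monotonicity gives the two differences the same sign, and the Lipschitz bound trades one
  for the other. This is why the derivative of the link can be left out of the update.\<close>

lemma square_le_monotone_product: "(u s - u t)\<^sup>2 / L \<le> (u s - u t) * (s - t)"
proof -
  have "\<bar>u s - u t\<bar> \<le> L * \<bar>s - t\<bar>"
    using lipschitz_onD[OF lipschitz_u, of s t] by (simp add: dist_real_def)
  then have "\<bar>u s - u t\<bar> * \<bar>u s - u t\<bar> \<le> \<bar>u s - u t\<bar> * (L * \<bar>s - t\<bar>)"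
    by (intro mult_left_mono) auto
  moreover have "\<bar>u s - u t\<bar> * \<bar>s - t\<bar> = (u s - u t) * (s - t)"
  proof (cases "t \<le> s")
    case True
    then show ?thesis using monoD[OF mono_u True] by simp
  next
    case False
    then show ?thesis using monoD[OF mono_u, of s t] by (simp add: algebra_simps)
  qed
  ultimately show ?thesis using L_pos by (simp add: power2_eq_square divide_le_eq mult_ac)
qed

text \<open>As g - f depends on the instance only, the label may be replaced by u (F). Splitting g -
  f into g - F and F - f yields - err g / L from the first part and at most \<open>\<xi>\<close>
  from the second.\<close>

lemma expected_drift:
  assumes g: "g \<in> borel_measurable (sphere_space n)" and R: "\<And>x. x \<in> unit_sphere n \<Longrightarrow> \<bar>g x - f x\<bar> \<le> R"
  shows "(\<integral>z. (snd z - u (g (fst z))) * (g (fst z) - f (fst z)) \<partial>D) \<le> \<xi> - err g / L"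
proof -
  have [measurable]: "(\<lambda>z. g (fst z)) \<in> borel_measurable D" "(\<lambda>z. f (fst z)) \<in> borel_measurable D"
    by (rule measurable_compose[OF measurable_fst_D g] measurable_compose[OF measurable_fst_D measurable_f])+
  have gf: "(\<lambda>x. g x - f x) \<in> borel_measurable (sphere_space n)" using g measurable_f by measurable
  have bd: "\<bar>a * (g (fst z) - f (fst z))\<bar> \<le> R" if "z \<in> space D" "\<bar>a\<bar> \<le> 1" for a z
    using mult_mono[OF that(2) R, of "fst z"] in_space_D[OF that(1)] by (auto simp: abs_mult)
  have i1: "integrable D (\<lambda>z. snd z * (g (fst z) - f (fst z)))"
    and i2: "integrable D (\<lambda>z. u (g (fst z)) * (g (fst z) - f (fst z)))"
    and i3: "integrable D (\<lambda>z. u (F (fst z)) * (g (fst z) - f (fst z)))"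
    using in_space_D u_bounds by (intro bounded_integrable[where K = R] bd; force)+
  have i4: "integrable D (\<lambda>z. (u (g (fst z)) - u (F (fst z)))\<^sup>2)"
    using u_diff_bound by (intro bounded_integrable[where K = 1]) (auto simp: abs_square_le_1)
  have "(\<integral>z. snd z * (g (fst z) - f (fst z)) \<partial>D) = (\<integral>z. (g (fst z) - f (fst z)) * cond_exp_label n D z \<partial>D)"
    using cond_exp_label_integral[OF gf R] by (simp add: mult.commute)
  also have "\<dots> = (\<integral>z. u (F (fst z)) * (g (fst z) - f (fst z)) \<partial>D)"
  proof (rule integral_cong_AE)
    show "(\<lambda>z. (g (fst z) - f (fst z)) * cond_exp_label n D z) \<in> borel_measurable D"
      unfolding cond_exp_label_def by measurable
  qed (use regression in auto)
  finally have "(\<integral>z. (snd z - u (g (fst z))) * (g (fst z) - f (fst z)) \<partial>D)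
      = (\<integral>z. u (F (fst z)) * (g (fst z) - f (fst z)) - u (g (fst z)) * (g (fst z) - f (fst z)) \<partial>D)"
    using i1 i2 i3 by (simp add: left_diff_distrib)
  also have "\<dots> \<le> (\<integral>z. \<xi> - (u (g (fst z)) - u (F (fst z)))\<^sup>2 / L \<partial>D)"
  proof (rule integral_mono_AE)
    show "AE z in D. u (F (fst z)) * (g (fst z) - f (fst z)) - u (g (fst z)) * (g (fst z) - f (fst z))
        \<le> \<xi> - (u (g (fst z)) - u (F (fst z)))\<^sup>2 / L"
      using approx
    proof eventually_elim
      case (elim z)
      let ?F = "F (fst z)" and ?f = "f (fst z)" and ?g = "g (fst z)"
      have "(u ?F - u ?g) * (?F - ?f) \<le> \<bar>u ?F - u ?g\<bar> * \<bar>?F - ?f\<bar>" by (metis abs_ge_self abs_mult)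
      also have "\<dots> \<le> 1 * \<xi>" using elim u_diff_bound by (intro mult_mono) (auto simp: abs_minus_commute)
      finally show ?case using square_le_monotone_product[of ?g ?F] by (simp add: algebra_simps)
    qed
  qed (use i2 i3 i4 in auto)
  also have "\<dots> = \<xi> - err g / L" using i4 by (simp add: err_def prob_space)
  finally show ?thesis .
qed

lemma step_mgf:
  assumes g: "g \<in> borel_measurable (sphere_space n)" and R: "\<And>x. x \<in> unit_sphere n \<Longrightarrow> \<bar>g x - f x\<bar> \<le> R"
    and "0 < \<theta>"
  shows "(\<integral>\<^sup>+z. ennreal (exp (2 * lam * \<theta> * ((snd z - u (g (fst z))) * (g (fst z) - f (fst z))))) \<partial>D)
    \<le> ennreal (exp (2 * lam * \<theta> * (\<xi> - err g / L) + 2 * lam\<^sup>2 * \<theta>\<^sup>2 * R\<^sup>2))"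
proof -
  define V where "V z = (snd z - u (g (fst z))) * (g (fst z) - f (fst z))" for z
  have [measurable]: "(\<lambda>z. g (fst z)) \<in> borel_measurable D" "(\<lambda>z. f (fst z)) \<in> borel_measurable D"
    by (rule measurable_compose[OF measurable_fst_D g] measurable_compose[OF measurable_fst_D measurable_f])+
  have V [measurable]: "V \<in> borel_measurable D" unfolding V_def by measurable
  have VR: "V z \<in> {-R..R}" if "z \<in> space D" for z
  proof -
    have "\<bar>V z\<bar> \<le> 1 * R" unfolding V_def abs_mult
      using in_space_D[OF that] label_diff_bound R by (intro mult_mono) auto
    then show ?thesis by auto
  qed
  interpret V: interval_bounded_random_variable D V "-R" R
    by unfold_locales (use VR in auto)
  define \<mu> where "\<mu> = expectation V"
  define l where "l = 2 * lam * \<theta>"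
  have l: "0 < l" using lam_pos assms by (simp add: l_def)
  have "(\<integral>\<^sup>+z. ennreal (exp (l * V z)) \<partial>D) = (\<integral>\<^sup>+z. ennreal (exp (l * \<mu>)) * ennreal (exp (l * (V z - \<mu>))) \<partial>D)"
    by (intro nn_integral_cong) (simp add: right_diff_distrib flip: ennreal_mult exp_add)
  also have "\<dots> = ennreal (exp (l * \<mu>)) * (\<integral>\<^sup>+z. ennreal (exp (l * (V z - \<mu>))) \<partial>D)"
    by (rule nn_integral_cmult) measurable
  \<comment> \<open>Hoeffding's lemma on an interval of length 2 * R; with l = 2 * lam *
    \<open>\<theta>\<close> the exponent l^2 (2 R)^2 / 8 is the term in the claim.\<close>
  also have "\<dots> \<le> ennreal (exp (l * \<mu>)) * ennreal (exp (l\<^sup>2 * (R - (-R))\<^sup>2 / 8))"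
    unfolding \<mu>_def by (intro mult_left_mono V.Hoeffdings_lemma_nn_integral l) auto
  also have "\<dots> = ennreal (exp (l * \<mu> + 2 * lam\<^sup>2 * \<theta>\<^sup>2 * R\<^sup>2))"
    by (simp add: exp_add l_def power_mult_distrib ennreal_mult mult_ac)
  also have "\<dots> \<le> ennreal (exp (l * (\<xi> - err g / L) + 2 * lam\<^sup>2 * \<theta>\<^sup>2 * R\<^sup>2))"
    using expected_drift[OF g R] l unfolding \<mu>_def V_def by (intro ennreal_leI) simp
  finally show ?thesis by (simp add: l_def V_def)
qed

lemma measurable_sample_component:
  assumes "\<sigma> \<in> measurable N (PiM I (\<lambda>_. D))" "i \<in> I"
  shows "(\<lambda>\<omega>. \<sigma> \<omega> i) \<in> measurable N D"
  using assms(2) by (intro measurable_compose[OF assms(1)] measurable_component_singleton) auto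

text \<open>The induction generalizes over the random evaluation point, since a step evaluates the
  previous iterate at x and at the new instance.\<close>

lemma measurable_glm:
  assumes \<sigma>: "\<sigma> \<in> measurable N (PiM I (\<lambda>_. D))" and "{..<j} \<subseteq> I" "x \<in> measurable N (sphere_space n)"
  shows "(\<lambda>\<omega>. glm n u lam (\<sigma> \<omega>) j (x \<omega>)) \<in> borel_measurable N"
  using assms(2,3)
proof (induction j arbitrary: x)
  case (Suc j)
  note [measurable] = Suc.prems(2)
  have s [measurable]: "(\<lambda>\<omega>. \<sigma> \<omega> j) \<in> measurable N D"
    using Suc.prems by (intro measurable_sample_component[OF \<sigma>]) auto
  have [measurable]: "(\<lambda>\<omega>. fst (\<sigma> \<omega> j)) \<in> measurable N (sphere_space n)"
    by (rule measurable_compose[OF s measurable_fst_D])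
  have [measurable]: "(\<lambda>\<omega>. snd (\<sigma> \<omega> j)) \<in> borel_measurable N"
    by (rule measurable_compose[OF s measurable_snd_D])
  have [measurable]: "(\<lambda>\<omega>. glm n u lam (\<sigma> \<omega>) j (x \<omega>)) \<in> borel_measurable N"
    "(\<lambda>\<omega>. glm n u lam (\<sigma> \<omega>) j (fst (\<sigma> \<omega> j))) \<in> borel_measurable N"
    using Suc.prems by (intro Suc.IH; auto)+
  show ?case by simp
qed simp

lemma measurable_glm_point: "(\<And>i. i < j \<Longrightarrow> S i \<in> space D) \<Longrightarrow> glm n u lam S j \<in> borel_measurable (sphere_space n)"
proof -
  assume *: "\<And>i. i < j \<Longrightarrow> S i \<in> space D"
  \<comment> \<open>Points of a product space are extensional, hence the restriction; the sample
    then enters \<open>measurable_glm\<close> as a constant map.\<close>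
  have "restrict S {..<j} \<in> space (PiM {..<j} (\<lambda>_. D))"
    using * by (auto simp: space_PiM)
  then have "(\<lambda>x. glm n u lam (restrict S {..<j}) j x) \<in> borel_measurable (sphere_space n)"
    by (intro measurable_glm[where I = "{..<j}"]) auto
  also have "glm n u lam (restrict S {..<j}) j = glm n u lam S j" by (rule glm_cong) auto
  finally show ?thesis .
qed

lemma measurable_glm_err:
  assumes "\<sigma> \<in> measurable N (PiM I (\<lambda>_. D))" "{..<j} \<subseteq> I"
  shows "(\<lambda>\<omega>. err (glm n u lam (\<sigma> \<omega>) j)) \<in> borel_measurable N"
  unfolding err_def
proof (rule borel_measurable_lebesgue_integral)
  have [measurable]: "(\<lambda>p. glm n u lam (\<sigma> (fst p)) j (fst (snd p))) \<in> borel_measurable (N \<Otimes>\<^sub>M D)"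
    by (rule measurable_glm[OF measurable_compose[OF measurable_fst assms(1)] assms(2)]) measurable
  show "(\<lambda>(\<omega>, z). (u (glm n u lam (\<sigma> \<omega>) j (fst z)) - u (F (fst z)))\<^sup>2) \<in> borel_measurable (N \<Otimes>\<^sub>M D)"
    unfolding case_prod_beta by measurable
qed

lemma measurable_glm_pot:
  assumes "\<sigma> \<in> measurable N (PiM I (\<lambda>_. D))" "{..<j} \<subseteq> I"
  shows "(\<lambda>\<omega>. glm_pot n u lam f B (\<sigma> \<omega>) j) \<in> borel_measurable N"
proof -
  have s: "(\<lambda>\<omega>. \<sigma> \<omega> i) \<in> measurable N D" if "i < j" for i
    using assms that by (intro measurable_sample_component[OF assms(1)]) auto
  have X: "(\<lambda>\<omega>. fst (\<sigma> \<omega> i)) \<in> measurable N (sphere_space n)" if "i < j" for i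
    by (rule measurable_compose[OF s[OF that] measurable_fst_D])
  have c: "(\<lambda>\<omega>. glm_coef n u lam (\<sigma> \<omega>) i) \<in> borel_measurable N" if "i < j" for i
  proof -
    have [measurable]: "(\<lambda>\<omega>. glm n u lam (\<sigma> \<omega>) i (fst (\<sigma> \<omega> i))) \<in> borel_measurable N"
      by (rule measurable_glm[OF assms(1) _ X[OF that]]) (use that assms in auto)
    have [measurable]: "(\<lambda>\<omega>. snd (\<sigma> \<omega> i)) \<in> borel_measurable N"
      by (rule measurable_compose[OF s[OF that] measurable_snd_D])
    show ?thesis unfolding glm_coef_def by measurable
  qed
  have fX: "(\<lambda>\<omega>. f (fst (\<sigma> \<omega> i))) \<in> borel_measurable N" if "i < j" for i
    by (rule measurable_compose[OF X[OF that] measurable_f])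
  show ?thesis unfolding glm_pot_def potential_def gram_def
    by (intro borel_measurable_add borel_measurable_diff borel_measurable_times borel_measurable_sum
        measurable_ker borel_measurable_const c X fX) auto
qed

section \<open>The exponential supermartingale\<close>

lemma glm_minus_f_bound:
  assumes "\<And>i. i < j \<Longrightarrow> S i \<in> space D" "x \<in> unit_sphere n"
  shows "\<bar>glm n u lam S j x - f x\<bar> \<le> sqrt (glm_pot n u lam f B S j)"
  unfolding glm_eq_sum glm_pot_def
  using square_le_potential[OF rkhs _ assms(2), of j "\<lambda>i. fst (S i)" "glm_coef n u lam S"] assms(1) in_space_D
  by (intro real_le_rsqrt) auto

lemma glm_pot_nonneg: "(\<And>i. i < j \<Longrightarrow> S i \<in> space D) \<Longrightarrow> 0 \<le> glm_pot n u lam f B S j"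
  unfolding glm_pot_def using in_space_D by (intro potential_nonneg rkhs) auto

text \<open>Modelled on the solution of the differential equation w' = -2 lam^2 w^2, whose discrete
  form is \<open>weight_step\<close>. The offset m keeps the weights with index at most m within a
  factor 2 of each other.\<close>

definition weight :: "nat \<Rightarrow> nat \<Rightarrow> real" where
  "weight m j = 1 / (2 * lam\<^sup>2 * real (j + m))"

lemma weight_pos: "0 < m \<Longrightarrow> 0 < weight m j"
  using lam_pos by (simp add: weight_def)

lemma weight_step:
  assumes "0 < m"
  shows "weight m (Suc j) + 2 * lam\<^sup>2 * (weight m (Suc j))\<^sup>2 \<le> weight m j"
proof -
  let ?J = "real (j + m)"
  have J: "0 < ?J" using assms by simp
  have w: "weight m (Suc j) = 1 / (2 * lam\<^sup>2) * (1 / (?J + 1))" "weight m j = 1 / (2 * lam\<^sup>2) * (1 / ?J)"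
    by (simp_all add: weight_def add_ac)
  have sq: "a * (1 / a * q)\<^sup>2 = 1 / a * q\<^sup>2" if "a \<noteq> 0" for a q :: real
    using that by (simp add: power_mult_distrib power2_eq_square)
  have "2 * lam\<^sup>2 * (weight m (Suc j))\<^sup>2 = 1 / (2 * lam\<^sup>2) * (1 / (?J + 1))\<^sup>2"
    unfolding w by (rule sq) (use lam_pos in simp)
  then have "weight m (Suc j) + 2 * lam\<^sup>2 * (weight m (Suc j))\<^sup>2
      = 1 / (2 * lam\<^sup>2) * (1 / (?J + 1) + (1 / (?J + 1))\<^sup>2)"
    by (simp add: w distrib_left)
  also have "\<dots> \<le> 1 / (2 * lam\<^sup>2) * (1 / ?J)"
  proof (rule mult_left_mono)
    have "1 / (?J + 1) + (1 / (?J + 1))\<^sup>2 = (?J + 2) / (?J + 1)\<^sup>2"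
      using J by (simp add: power2_eq_square divide_simps)
    also have "\<dots> \<le> 1 / ?J"
    proof -
      have "(y + 2) / (y + 1)\<^sup>2 \<le> 1 / y" if "0 < y" for y :: real
      proof -
        have "(y + 2) * y \<le> (y + 1)\<^sup>2" by (simp add: power2_eq_square algebra_simps)
        then show ?thesis using that by (simp add: pos_divide_le_eq pos_le_divide_eq)
      qed
      from this[OF J] show ?thesis .
    qed
    finally show "1 / (?J + 1) + (1 / (?J + 1))\<^sup>2 \<le> 1 / ?J" .
  qed simp
  finally show ?thesis by (simp add: w)
qed

text \<open>
  The noise in step \<open>j\<close> has size up to \<open>lam * sqrt (glm_pot S j)\<close>, and \<open>glm_pot\<close> has no useful
  almost sure bound. The decreasing weights let the potential pay for its own moment generating function.
\<close>

definition log_mart :: "nat \<Rightarrow> sample \<Rightarrow> nat \<Rightarrow> real" where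
  "log_mart m S j = weight m j * glm_pot n u lam f B S j
     + (\<Sum>i<j. weight m (Suc i) * (2 * lam * (err (glm n u lam S i) / L) - 2 * lam * \<xi> - lam\<^sup>2))"

lemma measurable_log_mart:
  assumes "\<sigma> \<in> measurable N (PiM I (\<lambda>_. D))" "{..<j} \<subseteq> I"
  shows "(\<lambda>\<omega>. log_mart m (\<sigma> \<omega>) j) \<in> borel_measurable N"
proof -
  have "(\<lambda>\<omega>. err (glm n u lam (\<sigma> \<omega>) i)) \<in> borel_measurable N" if "i < j" for i
    by (rule measurable_glm_err[OF assms(1)]) (use that assms in auto)
  then show ?thesis unfolding log_mart_def
    by (intro borel_measurable_add borel_measurable_diff borel_measurable_times borel_measurable_sum
        borel_measurable_const measurable_glm_pot[OF assms] borel_measurable_divide) auto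
qed

text \<open>The expected drift cancels the summand for step j. The noise is bounded by the root of
  the current potential, so Hoeffding's term is a multiple of the potential, and the drop of the
  weights absorbs it.\<close>

lemma log_mart_step:
  assumes S: "\<And>i. i < j \<Longrightarrow> S i \<in> space D" and m: "0 < m"
  shows "(\<integral>\<^sup>+z. ennreal (exp (log_mart m (S(j := z)) (Suc j))) \<partial>D) \<le> ennreal (exp (log_mart m S j))"
proof -
  let ?\<theta> = "weight m (Suc j)" and ?p = "glm_pot n u lam f B S j" and ?g = "glm n u lam S j"
  define A where "A = (\<Sum>i<j. weight m (Suc i) * (2 * lam * (err (glm n u lam S i) / L) - 2 * lam * \<xi> - lam\<^sup>2))"
  \<comment> \<open>The part of the exponent that does not depend on the new example, after bounding
    its squared coefficient by lam^2.\<close>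
  define c where "c = ?\<theta> * ?p + A + ?\<theta> * (2 * lam * (err ?g / L) - 2 * lam * \<xi>)"
  define V where "V z = (snd z - u (?g (fst z))) * (?g (fst z) - f (fst z))" for z
  have p: "0 \<le> ?p" by (rule glm_pot_nonneg[OF S])
  have \<theta>: "0 < ?\<theta>" by (rule weight_pos[OF m])
  have pt: "log_mart m (S(j := z)) (Suc j) \<le> c + 2 * lam * ?\<theta> * V z" if z: "z \<in> space D" for z
  proof -
    let ?S = "S(j := z)"
    have g: "glm n u lam ?S i = glm n u lam S i" if "i \<le> j" for i
      using that by (intro glm_cong) auto
    have coef: "glm_coef n u lam ?S j = lam * (snd z - u (?g (fst z)))"
      by (simp add: glm_coef_def g)
    have "(lam * (snd z - u (?g (fst z))))\<^sup>2 = lam\<^sup>2 * (snd z - u (?g (fst z)))\<^sup>2"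
      by (rule power_mult_distrib)
    also have "\<dots> \<le> lam\<^sup>2 * 1"
      using label_diff_bound in_space_D[OF z] by (intro mult_left_mono) (auto simp: abs_square_le_1)
    finally have sq: "(lam * (snd z - u (?g (fst z))))\<^sup>2 \<le> lam\<^sup>2" by simp
    have "glm_pot n u lam f B ?S j = ?p" by (rule glm_pot_cong) auto
    then have "glm_pot n u lam f B ?S (Suc j) = ?p + 2 * lam * V z + (lam * (snd z - u (?g (fst z))))\<^sup>2"
      using in_space_D[OF z] by (subst glm_pot_Suc) (auto simp: coef g V_def mult_ac)
    also have "\<dots> \<le> ?p + 2 * lam * V z + lam\<^sup>2" using sq by simp
    finally have "?\<theta> * glm_pot n u lam f B ?S (Suc j) \<le> ?\<theta> * (?p + 2 * lam * V z + lam\<^sup>2)"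
      using \<theta> by (intro mult_left_mono) auto
    moreover have "log_mart m ?S (Suc j) = ?\<theta> * glm_pot n u lam f B ?S (Suc j) + A
        + ?\<theta> * (2 * lam * (err ?g / L) - 2 * lam * \<xi> - lam\<^sup>2)"
      by (simp add: log_mart_def A_def g)
    ultimately show ?thesis by (simp add: c_def algebra_simps)
  qed
  have gm: "?g \<in> borel_measurable (sphere_space n)" by (rule measurable_glm_point[OF S])
  have [measurable]: "(\<lambda>z. ?g (fst z)) \<in> borel_measurable D" "(\<lambda>z. f (fst z)) \<in> borel_measurable D"
    by (rule measurable_compose[OF measurable_fst_D gm] measurable_compose[OF measurable_fst_D measurable_f])+
  have [measurable]: "V \<in> borel_measurable D" unfolding V_def by measurable
  have "(\<integral>\<^sup>+z. ennreal (exp (log_mart m (S(j := z)) (Suc j))) \<partial>D)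
      \<le> (\<integral>\<^sup>+z. ennreal (exp c) * ennreal (exp (2 * lam * ?\<theta> * V z)) \<partial>D)"
    using pt by (intro nn_integral_mono) (auto simp flip: ennreal_mult exp_add)
  also have "\<dots> = ennreal (exp c) * (\<integral>\<^sup>+z. ennreal (exp (2 * lam * ?\<theta> * V z)) \<partial>D)"
    by (rule nn_integral_cmult) measurable
  also have "\<dots> \<le> ennreal (exp c) * ennreal (exp (2 * lam * ?\<theta> * (\<xi> - err ?g / L) + 2 * lam\<^sup>2 * ?\<theta>\<^sup>2 * (sqrt ?p)\<^sup>2))"
    unfolding V_def by (intro mult_left_mono step_mgf gm glm_minus_f_bound[OF S] \<theta>) auto
  also have "\<dots> = ennreal (exp ((?\<theta> + 2 * lam\<^sup>2 * ?\<theta>\<^sup>2) * ?p + A))"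
  proof -
    have "c + (2 * lam * ?\<theta> * (\<xi> - err ?g / L) + 2 * lam\<^sup>2 * ?\<theta>\<^sup>2 * (sqrt ?p)\<^sup>2)
        = (?\<theta> + 2 * lam\<^sup>2 * ?\<theta>\<^sup>2) * ?p + A"
      using p by (simp add: c_def algebra_simps)
    then show ?thesis by (simp flip: ennreal_mult exp_add)
  qed
  also have "\<dots> \<le> ennreal (exp (log_mart m S j))"
    using mult_right_mono[OF weight_step[OF m, of j] p]
    by (intro ennreal_leI) (simp add: log_mart_def A_def)
  finally show ?thesis .
qed

text \<open>By Fubini the last example is integrated out first with the earlier ones fixed, which is
  the situation of \<open>log_mart_step\<close>.\<close>

lemma nn_integral_log_mart:
  assumes "0 < m"
  shows "(\<integral>\<^sup>+S. ennreal (exp (log_mart m S j)) \<partial>PiM {..<j} (\<lambda>_. D)) \<le> ennreal (exp (weight m 0 * B\<^sup>2))"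
proof (induction j)
  case 0
  interpret P: prob_space "PiM ({} :: nat set) (\<lambda>_. D)" by (rule prob_space_PiM) (rule prob_space_axioms)
  show ?case using P.emeasure_space_1 by (simp add: log_mart_def glm_pot_0)
next
  case (Suc j)
  interpret product_sigma_finite "\<lambda>_::nat. D" by unfold_locales
  have "(\<integral>\<^sup>+S. ennreal (exp (log_mart m S (Suc j))) \<partial>PiM (insert j {..<j}) (\<lambda>_. D))
      = (\<integral>\<^sup>+S. (\<integral>\<^sup>+z. ennreal (exp (log_mart m (S(j := z)) (Suc j))) \<partial>D) \<partial>PiM {..<j} (\<lambda>_. D))"
  proof (rule product_nn_integral_insert)
    have "(\<lambda>S. log_mart m S (Suc j)) \<in> borel_measurable (PiM (insert j {..<j}) (\<lambda>_. D))"
      by (rule measurable_log_mart[where \<sigma> = "\<lambda>S. S" and I = "insert j {..<j}"]) auto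
    then show "(\<lambda>S. ennreal (exp (log_mart m S (Suc j)))) \<in> borel_measurable (PiM (insert j {..<j}) (\<lambda>_. D))"
      by measurable
  qed auto
  also have "\<dots> \<le> (\<integral>\<^sup>+S. ennreal (exp (log_mart m S j)) \<partial>PiM {..<j} (\<lambda>_. D))"
    by (intro nn_integral_mono log_mart_step assms) (auto simp: space_PiM PiE_iff)
  also note Suc
  finally show ?case by (simp add: lessThan_Suc)
qed

text \<open>Markov's inequality for the exponential at level exp b / \<delta>, where b is the
  initial value of the exponent.\<close>

lemma log_mart_tail:
  assumes "0 < m" "0 < \<delta>"
  shows "measure (PiM {..<m} (\<lambda>_. D)) {S \<in> space (PiM {..<m} (\<lambda>_. D)).
    log_mart m S m \<le> weight m 0 * B\<^sup>2 + ln (1 / \<delta>)} \<ge> 1 - \<delta>"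
proof -
  let ?P = "PiM {..<m} (\<lambda>_. D)" and ?b = "weight m 0 * B\<^sup>2"
  interpret P: prob_space ?P by (rule prob_space_PiM) (rule prob_space_axioms)
  have [measurable]: "(\<lambda>S. log_mart m S m) \<in> borel_measurable ?P"
    by (rule measurable_log_mart[where \<sigma> = "\<lambda>S. S" and I = "{..<m}"]) auto
  let ?G = "{S \<in> space ?P. log_mart m S m \<le> ?b + ln (1 / \<delta>)}"
  let ?Z = "\<lambda>S. ennreal (exp (log_mart m S m))"
  have "emeasure ?P (space ?P - ?G) \<le> emeasure ?P {S \<in> space ?P. 1 \<le> ennreal (\<delta> * exp (- ?b)) * ?Z S}"
  proof (rule emeasure_mono)
    show "space ?P - ?G \<subseteq> {S \<in> space ?P. 1 \<le> ennreal (\<delta> * exp (- ?b)) * ?Z S}"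
    proof
      fix S assume "S \<in> space ?P - ?G"
      then have S: "S \<in> space ?P" "?b + ln (1 / \<delta>) < log_mart m S m" by auto
      have "exp (?b + ln (1 / \<delta>)) \<le> exp (log_mart m S m)" using S by simp
      then have "exp ?b / \<delta> \<le> exp (log_mart m S m)" using assms by (simp add: exp_add)
      then have "1 \<le> \<delta> * exp (- ?b) * exp (log_mart m S m)"
        using assms by (simp add: exp_minus field_simps)
      then show "S \<in> {S \<in> space ?P. 1 \<le> ennreal (\<delta> * exp (- ?b)) * ?Z S}"
        using S assms by (simp flip: ennreal_mult)
    qed
  qed measurable
  also have "\<dots> \<le> ennreal (\<delta> * exp (- ?b)) * (\<integral>\<^sup>+S. ?Z S \<partial>?P)"
  proof -
    have "(\<integral>\<^sup>+S. ?Z S * indicator (space ?P) S \<partial>?P) = (\<integral>\<^sup>+S. ?Z S \<partial>?P)"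
      by (intro nn_integral_cong) simp
    then show ?thesis
      using nn_integral_Markov_inequality[of ?Z "space ?P" ?P "ennreal (\<delta> * exp (- ?b))"] by simp
  qed
  also have "\<dots> \<le> ennreal (\<delta> * exp (- ?b)) * ennreal (exp ?b)"
    by (intro mult_left_mono nn_integral_log_mart assms) auto
  also have "\<dots> = ennreal \<delta>" using assms by (simp add: exp_minus flip: ennreal_mult)
  finally have "P.prob (space ?P - ?G) \<le> \<delta>"
    using assms by (simp add: P.emeasure_eq_measure)
  moreover have "P.prob (space ?P - ?G) = 1 - P.prob ?G" by (rule P.prob_compl) measurable
  ultimately show ?thesis by simp
qed

text \<open>The weights lie between t and 2 * t, so errors can be weighted by t from below and
  penalties by 2 * t from above. The final potential is nonnegative and is dropped.\<close>

lemma mean_err_le: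
  assumes S: "S \<in> space (PiM {..<m} (\<lambda>_. D))" and m: "0 < m"
    and le: "log_mart m S m \<le> weight m 0 * B\<^sup>2 + l"
  shows "(\<Sum>i<m. err (glm n u lam S i)) / m \<le> L * (B\<^sup>2 / (lam * m) + 2 * lam * l + 2 * \<xi> + lam)"
proof -
  have Si: "S i \<in> space D" if "i < m" for i using S that by (auto simp: space_PiM PiE_iff)
  define t where "t = weight m m"
  define E where "E = (\<Sum>i<m. err (glm n u lam S i))"
  have e: "0 \<le> err g" for g unfolding err_def by simp
  have t: "t = 1 / (4 * lam\<^sup>2 * m)" by (simp add: t_def weight_def)
  have tp: "0 < t" unfolding t_def by (rule weight_pos[OF m])
  have w0: "weight m 0 = 2 * t" by (simp add: t weight_def)
  have wi: "t \<le> weight m i" "weight m i \<le> 2 * t" if "i \<le> m" for i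
    unfolding w0[symmetric] unfolding t_def weight_def using lam_pos m that
    by (intro divide_left_mono mult_left_mono mult_pos_pos; simp)+
  have split: "t * (2 * B\<^sup>2 + l / t + 2 * c) = 2 * t * B\<^sup>2 + l + 2 * t * c" for c
    using tp by (simp add: distrib_left)
  have "t * (2 * lam / L * E) - 2 * t * (m * (2 * lam * \<xi> + lam\<^sup>2))
      = (\<Sum>i<m. t * (2 * lam * (err (glm n u lam S i) / L)) - 2 * t * (2 * lam * \<xi> + lam\<^sup>2))"
    by (simp add: E_def sum_subtractf sum_distrib_left mult_ac)
  also have "\<dots> \<le> (\<Sum>i<m. weight m (Suc i) * (2 * lam * (err (glm n u lam S i) / L) - 2 * lam * \<xi> - lam\<^sup>2))"
  proof (rule sum_mono)
    fix i assume "i \<in> {..<m}"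
    then have "Suc i \<le> m" by simp
    then have "t * (2 * lam * (err (glm n u lam S i) / L)) \<le> weight m (Suc i) * (2 * lam * (err (glm n u lam S i) / L))"
      and "weight m (Suc i) * (2 * lam * \<xi> + lam\<^sup>2) \<le> 2 * t * (2 * lam * \<xi> + lam\<^sup>2)"
      using lam_pos L_pos xi_nonneg e by (intro mult_right_mono wi; simp)+
    then show "t * (2 * lam * (err (glm n u lam S i) / L)) - 2 * t * (2 * lam * \<xi> + lam\<^sup>2)
        \<le> weight m (Suc i) * (2 * lam * (err (glm n u lam S i) / L) - 2 * lam * \<xi> - lam\<^sup>2)"
      by (simp add: algebra_simps)
  qed
  also have "\<dots> \<le> log_mart m S m"
    unfolding log_mart_def using weight_pos[OF m, of m] glm_pot_nonneg[OF Si] by simp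
  also have "\<dots> \<le> 2 * t * B\<^sup>2 + l" using le by (simp add: w0)
  finally have "t * (2 * lam / L * E) \<le> t * (2 * B\<^sup>2 + l / t + 2 * (m * (2 * lam * \<xi> + lam\<^sup>2)))"
    unfolding split by (simp only: diff_le_eq)
  then have "2 * lam / L * E \<le> 2 * B\<^sup>2 + l / t + 2 * (m * (2 * lam * \<xi> + lam\<^sup>2))"
    using tp by (simp only: mult_le_cancel_left_pos)
  also have "l / t = 4 * lam\<^sup>2 * m * l" by (simp add: t)
  finally have "L / (2 * lam * m) * (2 * lam / L * E)
      \<le> L / (2 * lam * m) * (2 * B\<^sup>2 + 4 * lam\<^sup>2 * m * l + 2 * (m * (2 * lam * \<xi> + lam\<^sup>2)))"
    using L_pos lam_pos by (intro mult_left_mono) auto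
  also have "L / (2 * lam * m) * (2 * lam / L * E) = E / m" using L_pos lam_pos by simp
  also have "L / (2 * lam * m) * (2 * B\<^sup>2 + 4 * lam\<^sup>2 * m * l + 2 * (m * (2 * lam * \<xi> + lam\<^sup>2)))
      = L * (B\<^sup>2 / (lam * m) + 2 * lam * l + 2 * \<xi> + lam)"
    using L_pos lam_pos m by (simp add: field_simps power2_eq_square)
  finally show ?thesis unfolding E_def .
qed

end

section \<open>From the supermartingale to the averaged hypothesis\<close>

context single_index
begin

text \<open>Convexity of the square, applied pointwise as the Cauchy-Schwarz inequality.\<close>

lemma mean_hypothesis_err:
  assumes S: "S \<in> space (PiM {..<m} (\<lambda>_. D))" and m: "0 < m"
  defines "H \<equiv> \<lambda>x. (\<Sum>j<m. u (glm n u lam S j x)) / real m"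
  shows "integrable D (\<lambda>z. (H (fst z) - u (F (fst z)))\<^sup>2)"
    and "(\<integral>z. (H (fst z) - u (F (fst z)))\<^sup>2 \<partial>D) \<le> (\<Sum>j<m. err (glm n u lam S j)) / m"
proof -
  have g: "glm n u lam S j \<in> borel_measurable (sphere_space n)" if "j < m" for j
    using S that by (intro measurable_glm_point) (auto simp: space_PiM PiE_iff)
  have gz: "(\<lambda>z. u (glm n u lam S j (fst z))) \<in> borel_measurable D" if "j < m" for j
    by (rule measurable_compose[OF measurable_compose[OF measurable_fst_D g[OF that]] measurable_u])
  have [measurable]: "(\<lambda>z. H (fst z)) \<in> borel_measurable D"
    unfolding H_def by (intro borel_measurable_divide borel_measurable_sum gz) auto
  have i: "integrable D (\<lambda>z. (u (glm n u lam S j (fst z)) - u (F (fst z)))\<^sup>2)" if "j < m" for j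
    using u_diff_bound gz[OF that]
    by (intro bounded_integrable[where K = 1]) (auto simp: abs_square_le_1)
  have int_sum: "integrable D (\<lambda>z. (\<Sum>j<m. (u (glm n u lam S j (fst z)) - u (F (fst z)))\<^sup>2) / m)"
    by (intro integrable_divide Bochner_Integration.integrable_sum i) auto
  have pt: "(H x - c)\<^sup>2 \<le> (\<Sum>j<m. (u (glm n u lam S j x) - c)\<^sup>2) / m" for x c
  proof -
    have "H x - c = (\<Sum>j<m. u (glm n u lam S j x) - c) / m"
      using m by (simp add: H_def sum_subtractf diff_divide_distrib)
    then have "(H x - c)\<^sup>2 = (\<Sum>j<m. u (glm n u lam S j x) - c)\<^sup>2 / (real m)\<^sup>2"
      by (simp add: power_divide)
    also have "\<dots> \<le> (real m * (\<Sum>j<m. (u (glm n u lam S j x) - c)\<^sup>2)) / (real m)\<^sup>2"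
      using sum_squared_le_sum_of_squares[of "\<lambda>j. u (glm n u lam S j x) - c" "{..<m}"]
      by (intro divide_right_mono) (auto simp: mult.commute)
    also have "\<dots> = (\<Sum>j<m. (u (glm n u lam S j x) - c)\<^sup>2) / m"
      using m by (simp add: power2_eq_square)
    finally show ?thesis .
  qed
  show I: "integrable D (\<lambda>z. (H (fst z) - u (F (fst z)))\<^sup>2)"
    by (rule Bochner_Integration.integrable_bound[OF int_sum]) (use pt in \<open>auto intro!: AE_I2 simp: abs_of_nonneg[OF sum_nonneg]\<close>)
  have "(\<integral>z. (H (fst z) - u (F (fst z)))\<^sup>2 \<partial>D)
      \<le> (\<integral>z. (\<Sum>j<m. (u (glm n u lam S j (fst z)) - u (F (fst z)))\<^sup>2) / m \<partial>D)"
    by (intro integral_mono I int_sum pt)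
  also have "\<dots> = (\<Sum>j<m. err (glm n u lam S j)) / m"
    unfolding err_def using i by (simp add: Bochner_Integration.integral_sum)
  finally show "(\<integral>z. (H (fst z) - u (F (fst z)))\<^sup>2 \<partial>D) \<le> (\<Sum>j<m. err (glm n u lam S j)) / m" .
qed

lemma learning_guarantee:
  assumes m: "0 < m" and \<delta>: "0 < \<delta>"
    and small: "L * (B\<^sup>2 / (lam * m) + 2 * lam * ln (1 / \<delta>) + 2 * \<xi> + lam) \<le> \<epsilon>"
  defines "H \<equiv> \<lambda>S x. (\<Sum>j<m. u (glm n u lam S j x)) / real m"
  shows "measure (PiM {..<m} (\<lambda>_. D)) {S \<in> space (PiM {..<m} (\<lambda>_. D)).
     integrable D (\<lambda>z. (H S (fst z) - u (F (fst z)))\<^sup>2) \<and>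
     (\<integral>z. (H S (fst z) - u (F (fst z)))\<^sup>2 \<partial>D) \<le> \<epsilon>} \<ge> 1 - \<delta>"
proof -
  let ?P = "PiM {..<m} (\<lambda>_. D)"
  let ?I = "\<lambda>S. \<integral>z. (H S (fst z) - u (F (fst z)))\<^sup>2 \<partial>D"
  interpret P: prob_space ?P by (rule prob_space_PiM) (rule prob_space_axioms)
  have "(\<lambda>p. glm n u lam (fst p) j (fst (snd p))) \<in> borel_measurable (?P \<Otimes>\<^sub>M D)" if "j < m" for j
    by (rule measurable_glm[where I = "{..<m}"]) (use that in \<open>auto intro: measurable_compose[OF measurable_snd]\<close>)
  then have [measurable]: "(\<lambda>p. H (fst p) (fst (snd p))) \<in> borel_measurable (?P \<Otimes>\<^sub>M D)"
    unfolding H_def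
    by (intro borel_measurable_divide borel_measurable_sum measurable_compose[OF _ measurable_u]) auto
  have [measurable]: "?I \<in> borel_measurable ?P"
  proof (rule borel_measurable_lebesgue_integral)
    show "(\<lambda>(S, z). (H S (fst z) - u (F (fst z)))\<^sup>2) \<in> borel_measurable (?P \<Otimes>\<^sub>M D)"
      unfolding case_prod_beta by measurable
  qed
  have "1 - \<delta> \<le> P.prob {S \<in> space ?P. log_mart m S m \<le> weight m 0 * B\<^sup>2 + ln (1 / \<delta>)}"
    by (rule log_mart_tail[OF m \<delta>])
  also have "\<dots> \<le> P.prob {S \<in> space ?P. ?I S \<le> \<epsilon>}"
  proof (rule P.finite_measure_mono)
    show "{S \<in> space ?P. log_mart m S m \<le> weight m 0 * B\<^sup>2 + ln (1 / \<delta>)} \<subseteq> {S \<in> space ?P. ?I S \<le> \<epsilon>}"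
    proof (intro subsetI CollectI conjI; elim CollectE conjE)
      fix S assume S: "S \<in> space ?P" "log_mart m S m \<le> weight m 0 * B\<^sup>2 + ln (1 / \<delta>)"
      show "?I S \<le> \<epsilon>" unfolding H_def
        by (rule order_trans[OF mean_hypothesis_err(2)[OF S(1) m] order_trans[OF mean_err_le[OF S(1) m S(2)] small]])
    qed
  qed measurable
  also have "{S \<in> space ?P. ?I S \<le> \<epsilon>} = {S \<in> space ?P.
     integrable D (\<lambda>z. (H S (fst z) - u (F (fst z)))\<^sup>2) \<and> ?I S \<le> \<epsilon>}"
    using mean_hypothesis_err(1)[OF _ m] unfolding H_def by auto
  finally show ?thesis .
qed

end

section \<open>The support of the marginal and the comparator\<close>

context labelled_distribution
begin

text \<open>Outside the support every point has a null ball. The balls are open in the product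
  topology on \<open>point\<close>, so by Lindelof countably many of the null ones have the same
  union.\<close>

lemma AE_in_support: "AE z in D. fst z \<in> sphere_support n (instance_marginal n D)"
proof -
  define U where "U x r = {z :: point. sqrt (\<Sum>j<n. (z j - x j)\<^sup>2) < r}" for x r
  have open_U: "open (U x r)" for x r
    unfolding U_def
    by (intro open_Collect_less continuous_intros continuous_on_product_coordinates)
  let ?\<mu> = "instance_marginal n D"
  define FF where "FF = {U x r |x r. measure ?\<mu> {z \<in> unit_sphere n. z \<in> U x r} = 0}"
  obtain F' where F': "F' \<subseteq> FF" "countable F'" "\<Union>F' = \<Union>FF"
    using Lindelof[of FF] open_U unfolding FF_def by blast
  have null: "AE z in D. fst z \<notin> V" if "V \<in> F'" for V
  proof -
    have "V \<in> FF" using that F'(1) by blast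
    then obtain x r where V: "V = U x r" "measure ?\<mu> {z \<in> unit_sphere n. z \<in> U x r} = 0"
      unfolding FF_def by blast
    have "{z \<in> space (sphere_space n). sqrt (\<Sum>j<n. (z j - x j)\<^sup>2) < r} \<in> sets (sphere_space n)"
    proof -
      have [measurable]: "(\<lambda>z. \<Sum>j<n. (z j - x j)\<^sup>2) \<in> borel_measurable (sphere_space n)"
        by (intro borel_measurable_sum borel_measurable_power borel_measurable_diff
            measurable_sphere_coordinate borel_measurable_const) auto
      then show ?thesis by measurable
    qed
    then have s: "{z \<in> unit_sphere n. z \<in> U x r} \<in> sets (sphere_space n)"
      by (simp add: space_sphere_space U_def)
    have eq: "fst -` {z \<in> unit_sphere n. z \<in> U x r} \<inter> space D = {z \<in> space D. fst z \<in> V}"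
      using in_space_D by (auto simp: V)
    have "measure D {z \<in> space D. fst z \<in> V} = 0"
      using V(2) measure_distr[OF measurable_fst_D s] unfolding instance_marginal_def eq by simp
    moreover have "{z \<in> space D. fst z \<in> V} \<in> sets D"
      using measurable_sets[OF measurable_fst_D s] unfolding eq .
    ultimately show ?thesis
      by (intro AE_I[where N = "{z \<in> space D. fst z \<in> V}"]) (auto simp: emeasure_eq_measure)
  qed
  have "AE z in D. \<forall>V\<in>F'. fst z \<notin> V"
    using null F'(2) by (simp add: AE_ball_countable)
  then show ?thesis
  proof (rule AE_mp, intro AE_I2 impI)
    fix z assume z: "z \<in> space D" and out: "\<forall>V\<in>F'. fst z \<notin> V"
    show "fst z \<in> sphere_support n ?\<mu>"
    proof (rule ccontr)
      assume "fst z \<notin> sphere_support n ?\<mu>"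
      then obtain r where r: "0 < r" "\<not> 0 < measure ?\<mu> {y \<in> unit_sphere n. sqrt (\<Sum>j<n. (y j - fst z j)\<^sup>2) < r}"
        using in_space_D[OF z] unfolding sphere_support_def by auto
      then have "measure ?\<mu> {y \<in> unit_sphere n. y \<in> U (fst z) r} = 0"
        unfolding U_def using measure_nonneg[of ?\<mu>] by (simp add: not_less antisym)
      then have "U (fst z) r \<in> FF" unfolding FF_def by blast
      moreover have "fst z \<in> U (fst z) r" using r by (simp add: U_def)
      ultimately show False using F'(3) out by blast
    qed
  qed
qed

end

lemma margin_halfspace_measurable:
  assumes "margin_halfspace n \<rho> X h"
  shows "h \<in> borel_measurable (sphere_space n)"
proof -
  obtain w where h: "h = (\<lambda>x. if 0 \<le> ip n w x then 1 else 0)"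
    using assms unfolding margin_halfspace_def ip_def by blast
  have [measurable]: "ip n w \<in> borel_measurable (sphere_space n)" by (rule measurable_ip_const)
  show ?thesis unfolding h by measurable
qed

lemma margin_halfspace_bounds: "margin_halfspace n \<rho> X h \<Longrightarrow> 0 \<le> h x \<and> h x \<le> 1"
  unfolding margin_halfspace_def by auto

text \<open>The margin keeps ip n w x out of the gap in which f is not controlled.\<close>

lemma margin_halfspace_approximation:
  assumes f: "wiener_bound f M" "\<And>s. \<bar>s\<bar> \<le> 1 \<Longrightarrow> \<rho> \<le> \<bar>s\<bar> \<Longrightarrow> \<bar>f s - (if 0 \<le> s then 1 else 0)\<bar> \<le> \<eta>"
    and h: "margin_halfspace n \<rho> X h" and X: "X \<subseteq> unit_sphere n"
  shows "\<exists>g. rkhs_bound n g (2 * M) \<and> g \<in> borel_measurable (sphere_space n) \<and> (\<forall>x\<in>X. \<bar>g x - h x\<bar> \<le> \<eta>)"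
proof -
  obtain w where w: "w \<in> unit_sphere n" "h = (\<lambda>x. if 0 \<le> ip n w x then 1 else 0)"
    "\<And>x. x \<in> X \<Longrightarrow> \<rho> \<le> \<bar>ip n w x\<bar>"
    using h unfolding margin_halfspace_def ip_def by blast
  show ?thesis
  proof (intro exI[of _ "\<lambda>x. f (ip n w x)"] conjI ballI)
    fix x assume "x \<in> X"
    then show "\<bar>f (ip n w x) - h x\<bar> \<le> \<eta>"
      using f(2)[OF abs_ip_le_1[OF w(1) subsetD[OF X]] w(3)] unfolding w(2) by simp
  qed (use f w rkhs_bound_wiener wiener_bound_measurable in auto)
qed

text \<open>Norms and errors add with the factors \<bar>a i\<bar>, so both bounds depend on the
  coefficients through their l1 norm and not on t.\<close>

lemma combination_approximation:
  fixes t :: nat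
  assumes f: "wiener_bound f M" "\<And>s. \<bar>s\<bar> \<le> 1 \<Longrightarrow> \<rho> \<le> \<bar>s\<bar> \<Longrightarrow> \<bar>f s - (if 0 \<le> s then 1 else 0)\<bar> \<le> \<eta>"
    and h: "\<And>i. i < t \<Longrightarrow> margin_halfspace n \<rho> X (h i)" and X: "X \<subseteq> unit_sphere n"
  shows "\<exists>g. rkhs_bound n g ((\<Sum>i<t. \<bar>a i\<bar>) * (2 * M)) \<and> g \<in> borel_measurable (sphere_space n) \<and>
    (\<forall>x\<in>X. \<bar>g x - (\<Sum>i<t. a i * h i x)\<bar> \<le> (\<Sum>i<t. \<bar>a i\<bar>) * \<eta>)"
proof -
  have "\<forall>i. \<exists>g. i < t \<longrightarrow> rkhs_bound n g (2 * M) \<and> g \<in> borel_measurable (sphere_space n) \<and>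
      (\<forall>x\<in>X. \<bar>g x - h i x\<bar> \<le> \<eta>)"
    using margin_halfspace_approximation[OF f h X] by blast
  then obtain g where g: "\<And>i. i < t \<Longrightarrow> rkhs_bound n (g i) (2 * M)"
    "\<And>i. i < t \<Longrightarrow> g i \<in> borel_measurable (sphere_space n)"
    "\<And>i x. i < t \<Longrightarrow> x \<in> X \<Longrightarrow> \<bar>g i x - h i x\<bar> \<le> \<eta>"
    by metis
  show ?thesis
  proof (intro exI[of _ "\<lambda>x. \<Sum>i<t. a i * g i x"] conjI ballI)
    show "rkhs_bound n (\<lambda>x. \<Sum>i<t. a i * g i x) ((\<Sum>i<t. \<bar>a i\<bar>) * (2 * M))"
      unfolding sum_distrib_right by (intro rkhs_bound_sum rkhs_bound_scale g)
    show "(\<lambda>x. \<Sum>i<t. a i * g i x) \<in> borel_measurable (sphere_space n)"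
      by (intro borel_measurable_sum borel_measurable_times g) auto
    fix x assume x: "x \<in> X"
    have "\<bar>(\<Sum>i<t. a i * g i x) - (\<Sum>i<t. a i * h i x)\<bar> = \<bar>\<Sum>i<t. a i * (g i x - h i x)\<bar>"
      by (simp add: sum_subtractf right_diff_distrib)
    also have "\<dots> \<le> (\<Sum>i<t. \<bar>a i\<bar> * \<eta>)"
      using g(3)[OF _ x] by (intro order_trans[OF sum_abs] sum_mono) (auto simp: abs_mult intro!: mult_left_mono)
    finally show "\<bar>(\<Sum>i<t. a i * g i x) - (\<Sum>i<t. a i * h i x)\<bar> \<le> (\<Sum>i<t. \<bar>a i\<bar>) * \<eta>"
      by (simp add: sum_distrib_right)
  qed
qed

section \<open>Choice of parameters and conclusion\<close>

lemma three_quarters_power_le: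
  assumes "0 < x" "4 * ln x \<le> real r"
  shows "(3/4 :: real) ^ r \<le> 1 / x"
proof -
  have "(3/4 :: real) \<le> exp (- (1/4))" using exp_ge_add_one_self[of "- (1/4)"] by simp
  then have "(3/4 :: real) ^ r \<le> exp (- (1/4)) ^ r" by (intro power_mono) auto
  also have "\<dots> = exp (- (real r / 4))" using exp_of_nat_mult[of r "- (1/4) :: real"] by simp
  also have "\<dots> \<le> exp (- ln x)" using assms by simp
  also have "\<dots> = 1 / x" using assms by (simp add: exp_minus inverse_eq_divide)
  finally show ?thesis .
qed

lemma (in labelled_distribution) constant_hypothesis:
  fixes v \<epsilon> :: real
  assumes [measurable]: "G \<in> borel_measurable (sphere_space n)"
    and G: "\<And>x. x \<in> unit_sphere n \<Longrightarrow> (v - G x)\<^sup>2 \<le> \<epsilon>"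
  shows "integrable D (\<lambda>z. (v - G (fst z))\<^sup>2) \<and> (\<integral>z. (v - G (fst z))\<^sup>2 \<partial>D) \<le> \<epsilon>"
proof -
  have "integrable D (\<lambda>z. (v - G (fst z))\<^sup>2)"
    by (rule bounded_integrable[where K = \<epsilon>]) (use G in_space_D in auto)
  moreover from this have "(\<integral>z. (v - G (fst z))\<^sup>2 \<partial>D) \<le> (\<integral>z. \<epsilon> \<partial>D)"
    by (intro integral_mono) (use G in_space_D in auto)
  ultimately show ?thesis by (simp add: prob_space)
qed

text \<open>
  With \<open>K = LA/\<epsilon> > 2\<close>, the degree parameter \<open>r\<close> is of order \<open>ln K\<close>. It makes the approximation error
  \<open>1/(8K)\<close> and the norm bound \<open>exp (Y r/\<rho>)\<close> a power of \<open>K\<close> with exponent of order \<open>1/\<rho>\<close>.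
\<close>

lemma parameter_choice:
  fixes Y l0 :: real
  assumes Y: "0 < Y" and l0: "0 < l0"
  shows "\<exists>C>0. \<forall>K \<rho> l. 2 < K \<longrightarrow> 0 < \<rho> \<longrightarrow> \<rho> \<le> 1 \<longrightarrow> l0 \<le> l \<longrightarrow>
    (\<exists>r. (3/4) ^ r \<le> 1 / (8 * K) \<and>
       96 * (1 + 2 * l) * K\<^sup>2 * (exp (Y * real r / \<rho>))\<^sup>2 \<le> K powr (C / \<rho>) * l \<and> 1 \<le> K powr (C / \<rho>))"
proof -
  \<comment> \<open>Since l is at least l0, 1 + 2 * l is at most (2 + 1 / l0) * l; as 2 < K, the
    resulting constant is absorbed by K ^ q.\<close>
  obtain q where q: "96 * (2 + 1 / l0) < 2 ^ q" using real_arch_pow[of 2 "96 * (2 + 1 / l0)"] by auto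
  \<comment> \<open>36 * Y comes from the squared norm with r \<le> 18 * ln K, 2 from K^2, and q
    from the constants.\<close>
  define C where "C = 36 * Y + 2 + real q"
  show ?thesis
  proof (intro exI[of _ C] conjI allI impI)
    show "0 < C" using Y by (simp add: C_def)
    fix K \<rho> l :: real assume K: "2 < K" and \<rho>: "0 < \<rho>" "\<rho> \<le> 1" and l: "l0 \<le> l"
    define r where "r = nat \<lceil>4 * ln (8 * K)\<rceil>"
    have "ln 2 \<le> ln K" using K by (subst ln_le_cancel_iff) auto
    then have lnK: "2/3 \<le> ln K" using ln2_ge_two_thirds by simp
    have "ln (8::real) = 3 * ln 2" using ln_realpow[of 2 3] by simp
    then have l8: "ln (8 * K) \<le> 4 * ln K" using \<open>ln 2 \<le> ln K\<close> K by (simp add: ln_mult)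
    have l8': "0 \<le> ln (8 * K)" using K by simp
    have r: "4 * ln (8 * K) \<le> real r" "real r \<le> 4 * ln (8 * K) + 1"
      using l8' by (auto simp: r_def)
    \<comment> \<open>r \<le> 16 * ln K + 1, and 2/3 \<le> ln K lets 2 * ln K absorb the 1.\<close>
    have r18: "real r \<le> 18 * ln K" using r l8 lnK by linarith
    have "exp (Y * real r / \<rho>) \<le> exp (Y * (18 * ln K) / \<rho>)"
      using r18 Y \<rho> by (simp add: divide_right_mono)
    also have "\<dots> = K powr (18 * Y / \<rho>)" using K by (simp add: powr_def mult_ac)
    finally have "(exp (Y * real r / \<rho>))\<^sup>2 \<le> (K powr (18 * Y / \<rho>))\<^sup>2" by (intro power_mono) auto
    also have "\<dots> = K powr (36 * Y / \<rho>)" by (simp add: power2_eq_square flip: powr_add)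
    finally have e: "(exp (Y * real r / \<rho>))\<^sup>2 \<le> K powr (36 * Y / \<rho>)" .
    have l': "1 + 2 * l \<le> (2 + 1 / l0) * l"
      using l l0 by (simp add: distrib_right pos_le_divide_eq)
    have "96 * (1 + 2 * l) \<le> 96 * ((2 + 1 / l0) * l)" using l' by simp
    also have "\<dots> = 96 * (2 + 1 / l0) * l" by simp
    also have "\<dots> \<le> 2 ^ q * l" using q l l0 by (intro mult_right_mono) auto
    also have "\<dots> \<le> K ^ q * l" using K l l0 by (intro mult_right_mono power_mono) auto
    also have "K ^ q = K powr real q" using K by (simp add: powr_realpow)
    also have "K powr real q * l \<le> K powr (real q / \<rho>) * l"
      using K l l0 \<rho> by (intro mult_right_mono powr_mono) (auto simp: pos_le_divide_eq mult_left_le)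
    finally have a: "96 * (1 + 2 * l) \<le> K powr (real q / \<rho>) * l" .
    have "K\<^sup>2 = K powr 2" using K by (simp add: powr_numeral)
    also have "\<dots> \<le> K powr (2 / \<rho>)" using K \<rho> by (intro powr_mono) (auto simp: pos_le_divide_eq)
    finally have b: "K\<^sup>2 \<le> K powr (2 / \<rho>)" .
    have "96 * (1 + 2 * l) * K\<^sup>2 * (exp (Y * real r / \<rho>))\<^sup>2
        \<le> (K powr (real q / \<rho>) * l) * K powr (2 / \<rho>) * K powr (36 * Y / \<rho>)"
      using l l0 by (intro mult_mono[OF mult_mono[OF a b] e]) auto
    also have "\<dots> = K powr (real q / \<rho> + 2 / \<rho> + 36 * Y / \<rho>) * l" by (simp add: powr_add)
    also have "real q / \<rho> + 2 / \<rho> + 36 * Y / \<rho> = C / \<rho>" by (simp add: C_def add_divide_distrib)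
    finally have c: "96 * (1 + 2 * l) * K\<^sup>2 * (exp (Y * real r / \<rho>))\<^sup>2 \<le> K powr (C / \<rho>) * l" .
    have "1 \<le> K powr (C / \<rho>)" using K \<rho> \<open>0 < C\<close> by (intro ge_one_powr_ge_zero) auto
    with c three_quarters_power_le[of "8 * K" r] r K
    show "\<exists>r. (3/4) ^ r \<le> 1 / (8 * K) \<and>
       96 * (1 + 2 * l) * K\<^sup>2 * (exp (Y * real r / \<rho>))\<^sup>2 \<le> K powr (C / \<rho>) * l \<and> 1 \<le> K powr (C / \<rho>)"
      by auto
  qed
qed

text \<open>L * A > sqrt \<epsilon> > 2 * \<epsilon>, the second because sqrt \<epsilon> <
  1/2.\<close>

lemma nontrivial_ratio:
  fixes L A \<epsilon> :: real
  assumes "0 < \<epsilon>" "\<epsilon> < 1 / 4" "\<epsilon> < (L * A)\<^sup>2" "0 \<le> L" "0 \<le> A"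
  shows "2 < L * A / \<epsilon>"
proof -
  have "sqrt \<epsilon> < sqrt (1 / 4)" using assms by (intro real_sqrt_less_mono) auto
  then have s: "sqrt \<epsilon> < 1 / 2" by (simp add: real_sqrt_divide)
  have "sqrt \<epsilon> < L * A" using assms real_sqrt_less_mono[of \<epsilon> "(L * A)\<^sup>2"] by simp
  moreover have "2 * \<epsilon> < sqrt \<epsilon>"
    using mult_strict_left_mono[OF s, of "sqrt \<epsilon>"] assms by simp
  ultimately show ?thesis using assms by (simp add: pos_less_divide_eq)
qed

text \<open>A quarter of \<epsilon> pays for the initial potential, a half for deviation and step
  size, a quarter for approximation. The 96 is 4 from the square of 2 * M, times 6 from the step
  size, times 4 from the quarter.\<close>

lemma error_budget:
  fixes L A \<epsilon> M cnt lam \<eta> l m :: real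
  assumes pos: "0 < L" "0 < A" "0 < \<epsilon>" "1 \<le> cnt" "0 < m" "0 < lam"
    and lam: "lam = \<epsilon> / L / cnt / 6" and l: "l \<le> cnt"
    and \<eta>: "\<eta> \<le> 1 / (8 * (L * A / \<epsilon>))"
    and m: "96 * cnt * (L * A / \<epsilon>)\<^sup>2 * M\<^sup>2 \<le> m"
  shows "L * ((A * (2 * M))\<^sup>2 / (lam * m) + 2 * lam * l + 2 * (A * \<eta>) + lam) \<le> \<epsilon>"
proof -
  have Ll: "L * lam = \<epsilon> / (6 * cnt)" using pos by (simp add: lam)
  have "L * ((A * (2 * M))\<^sup>2 / (lam * m)) = (96 * cnt * (L * A / \<epsilon>)\<^sup>2 * M\<^sup>2) / m * (\<epsilon> / 4)"
    using pos by (simp add: lam field_simps power2_eq_square)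
  also have "\<dots> \<le> 1 * (\<epsilon> / 4)" using m pos by (intro mult_right_mono) (auto simp: divide_le_eq)
  finally have 1: "L * ((A * (2 * M))\<^sup>2 / (lam * m)) \<le> \<epsilon> / 4" by simp
  have "(L * lam) * (2 * l + 1) \<le> (L * lam) * (3 * cnt)"
    using pos l by (intro mult_left_mono) auto
  also have "\<dots> = \<epsilon> / 2" using pos by (simp add: Ll)
  finally have 2: "L * (2 * lam * l) + L * lam \<le> \<epsilon> / 2" by (simp add: algebra_simps)
  have "(L * A) * \<eta> \<le> (L * A) * (1 / (8 * (L * A / \<epsilon>)))" using \<eta> pos by (intro mult_left_mono) auto
  also have "\<dots> = \<epsilon> / 8" using pos by simp
  finally have 3: "L * (2 * (A * \<eta>)) \<le> \<epsilon> / 4" by simp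
  have "L * ((A * (2 * M))\<^sup>2 / (lam * m) + 2 * lam * l + 2 * (A * \<eta>) + lam)
      = L * ((A * (2 * M))\<^sup>2 / (lam * m)) + (L * (2 * lam * l) + L * lam) + L * (2 * (A * \<eta>))"
    by (simp only: distrib_left add_ac)
  then show ?thesis using 1 2 3 by linarith
qed

lemma margin_le_1:
  assumes "margin_halfspace n \<rho> X h" "x \<in> X" "X \<subseteq> unit_sphere n"
  shows "\<rho> \<le> 1"
proof -
  obtain w where "w \<in> unit_sphere n" "\<rho> \<le> \<bar>ip n w x\<bar>"
    using assms unfolding margin_halfspace_def ip_def by blast
  then show ?thesis using abs_ip_le_1[of w n x] assms by auto
qed

text \<open>The three cases are the branches of the learner. \<open>lmin\<close> keeps ln
  (1/\<delta>) away from 0, so that additive constants in the sample size fit into a multiple of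
  it.\<close>

lemma kernel_learner_guarantee:
  fixes Y lmin C L A \<rho> \<epsilon> \<delta> :: real and a :: "nat \<Rightarrow> real" and t n m :: nat
  assumes approx: "\<forall>\<rho> r. 0 < \<rho> \<longrightarrow> \<rho> \<le> 1 \<longrightarrow> (\<exists>f. wiener_bound f (exp (Y * real r / \<rho>)) \<and>
     (\<forall>s. \<bar>s\<bar> \<le> 1 \<longrightarrow> \<rho> \<le> \<bar>s\<bar> \<longrightarrow> \<bar>f s - (if 0 \<le> s then 1 else 0)\<bar> \<le> (3/4) ^ r))"
    and C: "\<forall>K \<rho> l. 2 < K \<longrightarrow> 0 < \<rho> \<longrightarrow> \<rho> \<le> 1 \<longrightarrow> lmin \<le> l \<longrightarrow>
      (\<exists>r. (3/4) ^ r \<le> 1 / (8 * K) \<and>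
       96 * (1 + 2 * l) * K\<^sup>2 * (exp (Y * real r / \<rho>))\<^sup>2 \<le> K powr (C / \<rho>) * l \<and> 1 \<le> K powr (C / \<rho>))"
    and lmin: "0 < lmin"
    and n: "1 \<le> n" and D: "prob_space D" "sets D = sets (labelled_space n)"
    and u: "range u \<subseteq> {0..1}" "L-lipschitz_on UNIV u" "mono u" and \<rho>: "0 < \<rho>"
    and halfspaces: "\<forall>i<t. margin_halfspace n \<rho> (sphere_support n (instance_marginal n D)) (h i)"
    and A: "(\<Sum>i<t. \<bar>a i\<bar>) = A"
    and regression: "AE z in D. cond_exp_label n D z = u (\<Sum>i<t. a i * h i (fst z))"
    and \<epsilon>: "0 < \<epsilon>" and \<delta>: "0 < \<delta>" "\<delta> < 1" "lmin \<le> ln (1 / \<delta>)"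
    and m: "(L * A / \<epsilon>) powr (C / \<rho>) * ln (1 / \<delta>) \<le> real m"
  defines "H \<equiv> hypothesis n u \<epsilon> \<delta> L A m" and "F \<equiv> \<lambda>x. \<Sum>i<t. a i * h i x"
  shows "outputs_hypothesis u learner_prog predictor_prog (100 * (m + n) ^ 3) n [\<epsilon>, \<delta>, L, A, \<rho>] m S (H S)"
    and "measure (PiM {..<m} (\<lambda>_. D)) {S \<in> space (PiM {..<m} (\<lambda>_. D)).
       integrable D (\<lambda>z. (H S (fst z) - u (F (fst z)))\<^sup>2) \<and>
       (\<integral>z. (H S (fst z) - u (F (fst z)))\<^sup>2 \<partial>D) \<le> \<epsilon>} \<ge> 1 - \<delta>"
proof -
  note h = halfspaces[rule_format]
  let ?l = "ln (1 / \<delta>)" and ?X = "sphere_support n (instance_marginal n D)" and ?K = "L * A / \<epsilon>"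
  interpret labelled_distribution D n
    by (intro labelled_distribution.intro labelled_distribution_axioms.intro D)
  have L: "0 \<le> L" using u(2) by (rule lipschitz_on_nonneg)
  have A0: "0 \<le> A" using A by (metis sum_nonneg abs_ge_zero)
  have X: "?X \<subseteq> unit_sphere n" by (auto simp: sphere_support_def)
  have F: "F \<in> borel_measurable (sphere_space n)" unfolding F_def
    by (intro borel_measurable_sum borel_measurable_times margin_halfspace_measurable[OF h]) auto
  have FA: "\<bar>F x\<bar> \<le> A" for x
    unfolding F_def A[symmetric]
    using margin_halfspace_bounds[OF h] by (intro order_trans[OF sum_abs] sum_mono) (auto simp: abs_mult mult_left_le)
  have u_le: "0 \<le> u s" "u s \<le> 1" for s using subsetD[OF u(1) rangeI[of u s]] by auto
  have "continuous_on UNIV u" by (rule lipschitz_on_continuous_on[OF u(2)])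
  then have mu: "u \<in> borel_measurable borel" by (rule borel_measurable_continuous_onI)
  have uF: "(\<lambda>x. u (F x)) \<in> borel_measurable (sphere_space n)" by (rule measurable_compose[OF F mu])
  \<comment> \<open>A nonzero A forces at least one halfspace, and the support is nonempty because
    it carries full measure; a margin attained at one of its points is at most 1.\<close>
  have nontrivial: "2 < ?K \<and> 0 < L \<and> 0 < A \<and> \<rho> \<le> 1" if "\<epsilon> < 1 / 4" "\<epsilon> < (L * A)\<^sup>2"
  proof -
    have K: "2 < ?K" by (rule nontrivial_ratio[OF \<epsilon> that L A0])
    then have "L \<noteq> 0" "A \<noteq> 0" by auto
    then obtain i where i: "i < t" using A by (cases t) auto
    obtain x where "x \<in> ?X"
      using eventually_happens[OF AE_in_support] emeasure_space_1 by (auto simp: ae_filter_eq_bot_iff)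
    then have "\<rho> \<le> 1" by (rule margin_le_1[OF h[OF i] _ X])
    then show ?thesis using K L A0 \<open>L \<noteq> 0\<close> \<open>A \<noteq> 0\<close> by simp
  qed
  show "outputs_hypothesis u learner_prog predictor_prog (100 * (m + n) ^ 3) n [\<epsilon>, \<delta>, L, A, \<rho>] m S (H S)"
    unfolding H_def
  proof (rule outputs_hypothesis[OF \<delta>(1) n])
    assume "\<epsilon> < 1 / 4" "\<epsilon> < (L * A)\<^sup>2"
    then have "1 \<le> ?K powr (C / \<rho>)" using C nontrivial \<rho> \<delta> by blast
    then have "?l \<le> ?K powr (C / \<rho>) * ?l" using \<delta> lmin by simp
    then have "real (doublings \<delta>) \<le> 1 + 2 * real m"
      using doublings_bounds(3)[OF \<delta>(1,2)] m by linarith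
    then show "doublings \<delta> \<le> 1 + 2 * m" by linarith
  qed
  interpret P: prob_space "PiM {..<m} (\<lambda>_. D)" by (rule prob_space_PiM) (rule prob_space_axioms)
  let ?success = "measure (PiM {..<m} (\<lambda>_. D)) {S \<in> space (PiM {..<m} (\<lambda>_. D)).
       integrable D (\<lambda>z. (H S (fst z) - u (F (fst z)))\<^sup>2) \<and>
       (\<integral>z. (H S (fst z) - u (F (fst z)))\<^sup>2 \<partial>D) \<le> \<epsilon>} \<ge> 1 - \<delta>"
  have const_case: ?success if H: "H = (\<lambda>S x. v)" and v: "\<And>x. (v - u (F x))\<^sup>2 \<le> \<epsilon>" for v
    using constant_hypothesis[OF uF v] \<delta> unfolding H by (simp add: P.prob_space)
  consider "1 / 4 \<le> \<epsilon>" | "\<epsilon> < 1 / 4" "(L * A)\<^sup>2 \<le> \<epsilon>" | "\<epsilon> < 1 / 4" "\<epsilon> < (L * A)\<^sup>2" by linarith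
  then show ?success
  proof cases
    case 1
    show ?thesis
    proof (rule const_case)
      show "H = (\<lambda>S x. 1 / 2)" using 1 by (simp add: H_def hypothesis_def fun_eq_iff)
      fix x
      have "\<bar>1 / 2 - u (F x)\<bar> \<le> \<bar>1 / 2\<bar>" using u_le[of "F x"] by linarith
      then have "(1 / 2 - u (F x))\<^sup>2 \<le> (1 / 2)\<^sup>2" by (simp only: abs_le_square_iff)
      then show "(1 / 2 - u (F x))\<^sup>2 \<le> \<epsilon>" using 1 by (simp add: power2_eq_square)
    qed
  next
    case 2
    show ?thesis
    proof (rule const_case)
      show "H = (\<lambda>S x. u 0)" using 2 by (simp add: H_def hypothesis_def fun_eq_iff)
      fix x
      have "\<bar>u 0 - u (F x)\<bar> \<le> L * \<bar>F x\<bar>"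
        using lipschitz_onD[OF u(2), of 0 "F x"] by (simp add: dist_real_def)
      also have "\<dots> \<le> L * A" using FA L by (intro mult_left_mono)
      finally have "\<bar>u 0 - u (F x)\<bar>\<^sup>2 \<le> (L * A)\<^sup>2" by (intro power_mono) auto
      then show "(u 0 - u (F x))\<^sup>2 \<le> \<epsilon>" using 2 by simp
    qed
  next
    case 3
    have K: "2 < ?K" "0 < L" "0 < A" "\<rho> \<le> 1" using nontrivial[OF 3] by auto
    obtain r where r: "(3/4) ^ r \<le> 1 / (8 * ?K)"
      "96 * (1 + 2 * ?l) * ?K\<^sup>2 * (exp (Y * real r / \<rho>))\<^sup>2 \<le> ?K powr (C / \<rho>) * ?l"
      using C K(1,4) \<rho> \<delta>(3) by blast
    define M where "M = exp (Y * real r / \<rho>)"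
    obtain p where p: "wiener_bound p M"
      "\<And>s. \<bar>s\<bar> \<le> 1 \<Longrightarrow> \<rho> \<le> \<bar>s\<bar> \<Longrightarrow> \<bar>p s - (if 0 \<le> s then 1 else 0)\<bar> \<le> (3/4) ^ r"
      using approx \<rho> K(4) unfolding M_def by blast
    obtain f where f: "rkhs_bound n f (A * (2 * M))" "f \<in> borel_measurable (sphere_space n)"
      "\<And>x. x \<in> ?X \<Longrightarrow> \<bar>f x - F x\<bar> \<le> A * (3/4) ^ r"
      using combination_approximation[where t = t and a = a and h = h, OF p h X] unfolding F_def A by blast
    define lam where "lam = step_size \<epsilon> \<delta> L"
    let ?cnt = "real (doublings \<delta>)"
    note cnt = doublings_bounds[OF \<delta>(1,2)]
    have lam: "0 < lam" "lam = \<epsilon> / L / ?cnt / 6" using \<epsilon> K cnt by (simp_all add: lam_def step_size_def)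
    interpret single_index D n u L "A * (3/4) ^ r" "A * (2 * M)" lam F f
    proof
      show "AE z in D. cond_exp_label n D z = u (F (fst z))" using regression unfolding F_def .
      show "AE z in D. \<bar>f (fst z) - F (fst z)\<bar> \<le> A * (3/4) ^ r"
        using AE_in_support f(3) by auto
    qed (use u K lam F f A0 in auto)
    \<comment> \<open>The step size uses the count of doublings and the sample size ln (1/\<delta>);
      the bound 1 + 2 * ln (1/\<delta>) on the count reconciles them.\<close>
    have "96 * ?cnt * ?K\<^sup>2 * M\<^sup>2 \<le> 96 * (1 + 2 * ?l) * ?K\<^sup>2 * M\<^sup>2"
      using cnt(3) by (intro mult_right_mono mult_left_mono) auto
    also have "\<dots> \<le> real m" using r(2) m unfolding M_def by linarith
    finally have m_ge: "96 * ?cnt * ?K\<^sup>2 * M\<^sup>2 \<le> real m" .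
    have "0 < 96 * ?cnt * ?K\<^sup>2 * M\<^sup>2" using cnt(1) K \<epsilon> by (simp add: M_def)
    then have m_pos: "0 < real m" using m_ge by linarith
    have H: "H = (\<lambda>S x. (\<Sum>j<m. u (glm n u lam S j x)) / real m)"
      using 3 by (simp add: H_def hypothesis_def lam_def fun_eq_iff)
    show ?thesis unfolding H
    proof (rule learning_guarantee)
      show "L * ((A * (2 * M))\<^sup>2 / (lam * real m) + 2 * lam * ?l + 2 * (A * (3/4) ^ r) + lam) \<le> \<epsilon>"
        using K \<epsilon> cnt lam m_pos r(1) m_ge by (intro error_budget[where cnt = ?cnt]) auto
    qed (use m_pos \<delta> in auto)
  qed
qed

text \<open>\<open>C\<close> is chosen after \<open>\<delta>\<^sub>0\<close> because the sample size
  is proportional to ln (1/\<delta>), which vanishes as \<delta> tends to 1, whereas the descent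
  needs a number of examples bounded below. The programs and the time polynomial are fixed before
  \<open>\<delta>\<^sub>0\<close>.\<close>

theorem theorem8:
  "\<exists>(learner :: com) (predictor :: com) (c :: nat) (d :: nat).
    \<forall>\<delta>\<^sub>0 :: real. 0 < \<delta>\<^sub>0 \<and> \<delta>\<^sub>0 < 1 \<longrightarrow> (\<exists>C :: real. C > 0 \<and>
      (\<forall>(n :: nat) (D :: (point \<times> real) measure) (u :: real \<Rightarrow> real) (L :: real) (A :: real)
        (\<rho> :: real) (t :: nat) (a :: nat \<Rightarrow> real) (h :: nat \<Rightarrow> point \<Rightarrow> real)
        (\<epsilon> :: real) (\<delta> :: real) (m :: nat).
        1 \<le> n \<longrightarrow> prob_space D \<longrightarrow> sets D = sets (labelled_space n) \<longrightarrow>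
        range u \<subseteq> {0..1} \<longrightarrow> L-lipschitz_on UNIV u \<longrightarrow> mono u \<longrightarrow>
        0 < \<rho> \<longrightarrow>
        (\<forall>i<t. margin_halfspace n \<rho> (sphere_support n (instance_marginal n D)) (h i)) \<longrightarrow>
        (\<Sum>i<t. \<bar>a i\<bar>) = A \<longrightarrow>
        (AE z in D. cond_exp_label n D z = u (\<Sum>i<t. a i * h i (fst z))) \<longrightarrow>
        0 < \<epsilon> \<longrightarrow> 0 < \<delta> \<longrightarrow> \<delta> \<le> \<delta>\<^sub>0 \<longrightarrow>
        m = nat \<lceil>(L * A / \<epsilon>) powr (C / \<rho>) * ln (1 / \<delta>)\<rceil> \<longrightarrow>
        (\<exists>H :: sample \<Rightarrow> point \<Rightarrow> real.
          (\<forall>S \<in> space (PiM {..<m} (\<lambda>_. D)).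
            outputs_hypothesis u learner predictor (c * (m + n) ^ d) n [\<epsilon>, \<delta>, L, A, \<rho>] m S (H S)) \<and>
          measure (PiM {..<m} (\<lambda>_. D))
            {S \<in> space (PiM {..<m} (\<lambda>_. D)).
              integrable D (\<lambda>z. (H S (fst z) - u (\<Sum>i<t. a i * h i (fst z)))\<^sup>2) \<and>
              (\<integral>z. (H S (fst z) - u (\<Sum>i<t. a i * h i (fst z)))\<^sup>2 \<partial>D) \<le> \<epsilon>}
            \<ge> 1 - \<delta>)))"
proof -
  obtain Y where Y: "0 < Y" and approx: "\<forall>\<rho> r. 0 < \<rho> \<longrightarrow> \<rho> \<le> 1 \<longrightarrow>
    (\<exists>f. wiener_bound f (exp (Y * real r / \<rho>)) \<and>
     (\<forall>s. \<bar>s\<bar> \<le> 1 \<longrightarrow> \<rho> \<le> \<bar>s\<bar> \<longrightarrow> \<bar>f s - (if 0 \<le> s then 1 else 0)\<bar> \<le> (3/4) ^ r))"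
    using step_approximation by blast
  show ?thesis
  proof (rule exI[of _ learner_prog], rule exI[of _ predictor_prog], rule exI[of _ 100], rule exI[of _ 3],
      intro allI impI, goal_cases)
    case (1 \<delta>\<^sub>0)
    then have l0: "0 < ln (1 / \<delta>\<^sub>0)" by simp
    obtain C where C: "0 < C" "\<forall>K \<rho> l. 2 < K \<longrightarrow> 0 < \<rho> \<longrightarrow> \<rho> \<le> 1 \<longrightarrow> ln (1 / \<delta>\<^sub>0) \<le> l \<longrightarrow>
       (\<exists>r. (3/4) ^ r \<le> 1 / (8 * K) \<and>
       96 * (1 + 2 * l) * K\<^sup>2 * (exp (Y * real r / \<rho>))\<^sup>2 \<le> K powr (C / \<rho>) * l \<and> 1 \<le> K powr (C / \<rho>))"
      using parameter_choice[OF Y l0] by blast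
    show ?case
    proof (intro exI[of _ C] conjI C(1) allI impI, goal_cases)
      case (1 n D u L A \<rho> t a h \<epsilon> \<delta> m)
      note hyps = this
      have \<delta>1: "\<delta> < 1" using hyps \<open>0 < \<delta>\<^sub>0 \<and> \<delta>\<^sub>0 < 1\<close> by linarith
      have "1 / \<delta>\<^sub>0 \<le> 1 / \<delta>" using hyps by (intro divide_left_mono) auto
      then have l: "ln (1 / \<delta>\<^sub>0) \<le> ln (1 / \<delta>)"
        using hyps \<open>0 < \<delta>\<^sub>0 \<and> \<delta>\<^sub>0 < 1\<close> by (subst ln_le_cancel_iff) auto
      have m: "(L * A / \<epsilon>) powr (C / \<rho>) * ln (1 / \<delta>) \<le> real m"
        unfolding hyps(14) by (rule real_nat_ceiling_ge)
      note guarantee = kernel_learner_guarantee[OF approx C(2) l0 hyps(1-12) \<delta>1 l m]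
      show ?case by (intro exI[of _ "hypothesis n u \<epsilon> \<delta> L A m"] conjI ballI guarantee)
    qed
  qed
qed

end
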